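(* Suppose that $E_0, E, F \in \mathcal{HB}$ have no real zeros, that $\mathcal{H}(E_0) = \mathcal{H}(E)$ (the two spaces coincide as sets and have equivalent norms), and that $\varphi_F' \lesssim \varphi_E'$, i.e. there is a constant $C>0$ with $\varphi_F'(x) \le C\varphi_E'(x)$ for all $x\in\mathbb{R}$. Suppose $\{\lambda_n\}_{n\in\mathbb{Z}} \subset \mathbb{R}$ satisfies $\varphi_{EF}(\lambda_n) = n\pi + \alpha$ for all $n$, for some $\alpha \in [0,\pi)$. Then $\{\lambda_n\}$ is a normalized sampling sequence for $\mathcal{H}(E_0)$.
   Context: For an entire function $f$ put $f^{*}(z) := \overline{f(\bar z)}$. $\mathcal{HB}$ (the Hermite–Biehler class) is the set of entire functions $E$ satisfying $|E(\bar z)| < |E(z)|$ for all $z \in \mathbb{C}^{+} = \{z : \operatorname{Im} z > 0\}$. An analytic function on $\mathbb{C}^{+}$ is of bounded type if it is a quotient of two bounded analytic functions on $\mathbb{C}^{+}$; its mean type is $\limsup_{y\to+\infty} \frac{\log|f(iy)|}{y}$. For $E \in \mathcal{HB}$, the de Branges space $\mathcal{H}(E)$ is the Hilbert space of all entire functions $f$ such that $\|f\|_E^2 := \int_{\mathbb{R}} |f(t)/E(t)|^2\,dt < \infty$ and both $f/E$ and $f^{*}/E$ are of bounded type and nonpositive mean type in $\mathbb{C}^{+}$; the inner product is $\langle f,g\rangle_E = \int_{\mathbb{R}} f(t)\overline{g(t)}\,|E(t)|^{-2}\,dt$. It has reproducing kernel $K_E(w,z) = \frac{\overline{E(w)}E(z)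 - E(\bar w)E^{*}(z)}{2\pi i(\bar w - z)}$ (extended by continuity to $z=\bar w$), so $f(w) = \langle f, K_E(w,\cdot)\rangle_E$ for all $f\in\mathcal{H}(E)$, $w \in \mathbb{C}$. A phase function $\varphi_E$ of $E\in\mathcal{HB}$ is a continuous strictly increasing function $\varphi_E:\mathbb{R}\to\mathbb{R}$ with $E(x)e^{i\varphi_E(x)} \in \mathbb{R}$ and $E(x) = |E(x)|e^{-i\varphi_E(x)}$ for $x \in \mathbb{R}$; it is unique up to an additive multiple of $2\pi$. $\varphi_F,\varphi_{EF}$ are phase functions of $F$ and of the product $EF \in \mathcal{HB}$. A sequence $\{\lambda_n\}\subset\mathbb{R}$ is a normalized sampling sequence for $\mathcal{H}(E_0)$ if there exist constants $\widetilde A,\widetilde B>0$ such that $\widetilde A\|f\|_{E_0}^2 \le \sum_n \frac{|f(\lambda_n)|^2}{K_{E_0}(\lambda_n,\lambda_n)} \le \widetilde B\|f\|_{E_0}^2$ for all $f\in\mathcal{H}(E_0)$. *)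

theory Defs
  imports "HOL-Complex_Analysis.Complex_Analysis"
begin

definition upper_half_plane :: "complex set" where
  "upper_half_plane = {z. Im z > 0}"

definition conj_reflect :: "(complex \<Rightarrow> complex) \<Rightarrow> complex \<Rightarrow> complex" where
  "conj_reflect f = (\<lambda>z. cnj (f (cnj z)))"

definition hermite_biehler :: "(complex \<Rightarrow> complex) set" where
  "hermite_biehler =
     {E. E holomorphic_on UNIV \<and> (\<forall>z\<in>upper_half_plane. cmod (E (cnj z)) < cmod (E z))}"

text \<open>The quotient \<open>g / h\<close> is a quotient of meromorphic functions: the denominator \<open>h\<close> is
  not identically zero, but it may vanish at points where \<open>g\<close> vanishes as well.\<close>

definition bounded_type :: "(complex \<Rightarrow> complex) \<Rightarrow> bool" where
  "bounded_type f \<longleftrightarrow>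
     f holomorphic_on upper_half_plane \<and>
     (\<exists>g h. g holomorphic_on upper_half_plane \<and> bounded (g ` upper_half_plane) \<and>
            h holomorphic_on upper_half_plane \<and> bounded (h ` upper_half_plane) \<and>
            (\<exists>z\<in>upper_half_plane. h z \<noteq> 0) \<and>
            (\<forall>z\<in>upper_half_plane. h z \<noteq> 0 \<longrightarrow> f z = g z / h z))"

text \<open>The case distinction implements \<open>log 0 = -\<infinity>\<close> (whereas \<^term>\<open>ln (0::real)\<close> is \<open>0\<close>); in
  particular the zero function has mean type \<open>-\<infinity>\<close>.\<close>

definition mean_type :: "(complex \<Rightarrow> complex) \<Rightarrow> ereal" where
  "mean_type f = Limsup at_top (\<lambda>y::real.
     if f (\<i> * complex_of_real y) = 0 then - \<infinity>
     else ereal (ln (cmod (f (\<i> * complex_of_real y))) / y))"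

definition de_branges_norm :: "(complex \<Rightarrow> complex) \<Rightarrow> (complex \<Rightarrow> complex) \<Rightarrow> real" where
  "de_branges_norm E f =
     sqrt (LINT t|lborel. (cmod (f (complex_of_real t) / E (complex_of_real t)))\<^sup>2)"

definition de_branges_space :: "(complex \<Rightarrow> complex) \<Rightarrow> (complex \<Rightarrow> complex) set" where
  "de_branges_space E =
     {f. f holomorphic_on UNIV \<and>
         integrable lborel
           (\<lambda>t::real. (cmod (f (complex_of_real t) / E (complex_of_real t)))\<^sup>2) \<and>
         bounded_type (\<lambda>z. f z / E z) \<and> mean_type (\<lambda>z. f z / E z) \<le> 0 \<and>
         bounded_type (\<lambda>z. conj_reflect f z / E z) \<and>
         mean_type (\<lambda>z. conj_reflect f z / E z) \<le> 0}"

definition de_branges_quotient ::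
    "(complex \<Rightarrow> complex) \<Rightarrow> complex \<Rightarrow> complex \<Rightarrow> complex" where
  "de_branges_quotient E w z =
     (cnj (E w) * E z - E (cnj w) * conj_reflect E z) / (2 * pi * \<i> * (cnj w - z))"

definition de_branges_kernel ::
    "(complex \<Rightarrow> complex) \<Rightarrow> complex \<Rightarrow> complex \<Rightarrow> complex" where
  "de_branges_kernel E w z =
     (if z = cnj w then Lim (at (cnj w)) (de_branges_quotient E w)
      else de_branges_quotient E w z)"

definition same_de_branges_space ::
    "(complex \<Rightarrow> complex) \<Rightarrow> (complex \<Rightarrow> complex) \<Rightarrow> bool" where
  "same_de_branges_space E\<^sub>0 E \<longleftrightarrow>
     de_branges_space E\<^sub>0 = de_branges_space E \<and>
     (\<exists>a b. a > 0 \<and> b > 0 \<and>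
        (\<forall>f\<in>de_branges_space E. a * de_branges_norm E f \<le> de_branges_norm E\<^sub>0 f \<and>
                              de_branges_norm E\<^sub>0 f \<le> b * de_branges_norm E f))"

definition phase_function :: "(complex \<Rightarrow> complex) \<Rightarrow> (real \<Rightarrow> real) \<Rightarrow> bool" where
  "phase_function E \<phi> \<longleftrightarrow>
     continuous_on UNIV \<phi> \<and> strict_mono \<phi> \<and>
     (\<forall>x. E (complex_of_real x) * exp (\<i> * complex_of_real (\<phi> x)) \<in> \<real> \<and>
          E (complex_of_real x) =
            complex_of_real (cmod (E (complex_of_real x))) * exp (- \<i> * complex_of_real (\<phi> x)))"

text \<open>For real \<open>\<lambda>\<close> the value \<open>K(\<lambda>, \<lambda>)\<close> is real, so taking real parts only changes its type.
  Summability is required explicitly because \<^const>\<open>infsum\<close> is \<open>0\<close> on divergent families.\<close>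

definition normalized_sampling_sequence ::
    "(complex \<Rightarrow> complex) \<Rightarrow> ('i \<Rightarrow> real) \<Rightarrow> bool" where
  "normalized_sampling_sequence E \<Lambda> \<longleftrightarrow>
     (\<exists>A B. A > 0 \<and> B > 0 \<and>
       (\<forall>f\<in>de_branges_space E.
          let s = (\<lambda>n. (cmod (f (complex_of_real (\<Lambda> n))))\<^sup>2 /
                       Re (de_branges_kernel E (complex_of_real (\<Lambda> n)) (complex_of_real (\<Lambda> n))))
          in s summable_on UNIV \<and>
             A * (de_branges_norm E f)\<^sup>2 \<le> infsum s UNIV \<and>
             infsum s UNIV \<le> B * (de_branges_norm E f)\<^sup>2))"

end

theory Submission
  imports Defs
begin

text \<open>
Put \<open>\<Phi> = E\<^sup>* / E\<close> and \<open>\<Psi> = F\<^sup>* / F\<close>. These functions have modulus less than 1 in the upper half-plane and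
modulus 1 on the real line, where \<open>\<Phi> \<Psi> = exp (2 \<i> \<phi>)\<close> with the phase \<open>\<phi>\<close> of \<open>E F\<close>; the sampling points are
the solutions of \<open>\<Phi> \<Psi> = exp (2 \<i> \<alpha>)\<close>. For \<open>f\<close> in the space of \<open>E\<close> let \<open>u = f / E\<close> and \<open>v = f\<^sup>* / E\<close>, so
that \<open>u v = \<Phi> |u|\<^sup>2\<close> on the line.

The integral of \<open>u v B\<close> over the line vanishes for every bounded analytic \<open>B\<close>. With \<open>B\<close> equal to \<open>\<Psi>\<close> times a
geometric series in \<open>\<Phi> \<Psi>\<close> it follows that the integral of \<open>|u|\<^sup>2\<close> against the Poisson kernel of parameter
\<open>\<rho> < 1\<close> in the variable \<open>2 (\<phi> - \<alpha>)\<close> equals the squared norm of \<open>f\<close>. As \<open>\<rho>\<close> tends to 1 the mass concentrates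
at the sampling points, with weights \<open>\<pi> |u|\<^sup>2 / \<phi>'\<close>. Therefore the sum of these weights is at most the
squared norm, and it falls short of it by the mass that escapes to infinity (\<open>sampling_bounds\<close>).

Mass really can escape, for instance when the space of \<open>E F\<close> contains a function that vanishes exactly at
the sampling points. The loss is nevertheless a fixed proportion less than 1 of the squared norm
(\<open>model_sampling\<close>). It is bounded through the values of \<open>u\<close>, \<open>v\<close> and \<open>\<Psi>\<close> at \<open>\<i> y\<close> for large \<open>y\<close>. If
\<open>1 - |\<Phi> (\<i> y)|\<close> is of order \<open>1/y\<close> along a sequence, then \<open>1 - |\<Psi> (\<i> y)|\<close>, which is always at least of this
order, makes the difference; if \<open>y (1 - |\<Phi> (\<i> y)|)\<close> tends to infinity, the normalized reproducing kernels at
\<open>\<i> y\<close> tend weakly to 0 and nothing is lost.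

The kernel \<open>K(x, x)\<close> equals \<open>|E x|\<^sup>2 / \<pi>\<close> times the derivative of the phase of \<open>E\<close>, and it is the squared norm of
the evaluation at \<open>x\<close>. Hence the kernels of two spaces with equivalent norms are comparable
(\<open>kernel_diagonal_comparison\<close>), and the hypothesis on the phase of \<open>F\<close> makes the derivatives of the
phases of \<open>E\<close> and \<open>E F\<close> comparable.

The analytic foundation is \<open>smirnov_integral_eq_0\<close>: the integral over the line of a function of bounded type
and nonpositive mean type is 0 as soon as it converges absolutely. A quotient of bounded functions has
bounded logarithmic means, so its modulus is at most the Poisson integral of its boundary modulus times
an exponential \<open>exp (C Im z)\<close>; the mean type condition and the Phragmen-Lindelof principle remove the
exponential, after which Cauchy's theorem applies above the line.
\<close>

section \<open>The Poisson kernel of the disc and subharmonicity of logarithms\<close>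

definition disc_poisson :: "complex \<Rightarrow> real \<Rightarrow> real" where
  "disc_poisson z \<theta> = (1 - (cmod z)\<^sup>2) / (cmod (cis \<theta> - z))\<^sup>2"

lemma disc_poisson_nonneg: "cmod z < 1 \<Longrightarrow> 0 \<le> disc_poisson z \<theta>"
  by (auto simp: disc_poisson_def intro!: divide_nonneg_nonneg power_le_one)

lemma cis_neq_in_disc: "cmod z < 1 \<Longrightarrow> cis \<theta> \<noteq> z"
  by (metis norm_cis less_irrefl)

lemma continuous_on_disc_poisson: "cmod z < 1 \<Longrightarrow> continuous_on A (disc_poisson z)"
  unfolding disc_poisson_def [abs_def]
  by (intro continuous_intros) (auto simp: cis_neq_in_disc)

text \<open>Cauchy's formula for \<open>u \<mapsto> f u (1 - |z|\<^sup>2) / (1 - cnj z u)\<close>, a function with the same value at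
\<open>z\<close> as \<open>f\<close>: on the unit circle the extra factor turns the Cauchy kernel into the Poisson kernel.\<close>

lemma poisson_formula_holomorphic:
  fixes f :: "complex \<Rightarrow> complex"
  assumes f: "continuous_on (cball 0 1) f" "f holomorphic_on ball 0 1" and z: "cmod z < 1"
  shows "((\<lambda>\<theta>. of_real (disc_poisson z \<theta>) * f (cis \<theta>)) has_integral (2 * of_real pi * f z)) {0..2*pi}"
proof -
  have z2: "(cmod z)\<^sup>2 < 1" using z by (simp add: power_less_one_iff abs_square_less_1)
  have nz: "1 - cnj z * u \<noteq> 0" if "cmod u \<le> 1" for u
  proof
    assume "1 - cnj z * u = 0"
    hence "cmod (cnj z * u) = 1" by simp
    moreover have "cmod (cnj z * u) < 1"
      using mult_left_mono[OF that norm_ge_zero[of z]] z by (simp add: norm_mult)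
    ultimately show False by simp
  qed
  define g where "g = (\<lambda>u. f u * (1 - (cmod z)\<^sup>2) / (1 - cnj z * u))"
  have "((\<lambda>u. g u/(u-z)) has_contour_integral (2 * of_real pi * \<i> * g z)) (circlepath 0 1)"
  proof (rule Cauchy_integral_circlepath)
    show "continuous_on (cball 0 1) g" unfolding g_def
      by (intro continuous_intros f) (use nz in auto)
    show "g holomorphic_on ball 0 1" unfolding g_def
      by (intro holomorphic_intros f) (use nz in auto)
  qed (use z in auto)
  moreover have "g z = f z"
  proof -
    have "cnj z * z = of_real ((cmod z)\<^sup>2)" by (metis complex_norm_square mult.commute)
    hence eq: "(1 - (complex_of_real (cmod z))\<^sup>2) = 1 - cnj z * z" by simp
    moreover have "1 - cnj z * z \<noteq> 0" using nz z by simp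
    ultimately show ?thesis unfolding g_def by (simp add: eq)
  qed
  ultimately have "((\<lambda>t. g (cis t) / (cis t - z) * \<i> * cis t) has_integral (2 * of_real pi * \<i> * f z)) {0..2*pi}"
    unfolding circlepath_def by (subst (asm) has_contour_integral_part_circlepath_iff) auto
  hence "((\<lambda>t. -\<i> * (g (cis t) / (cis t - z) * \<i> * cis t)) has_integral (-\<i> * (2 * of_real pi * \<i> * f z))) {0..2*pi}"
    by (rule has_integral_mult_right)
  moreover have "-\<i> * (g (cis t) / (cis t - z) * \<i> * cis t) = of_real (disc_poisson z t) * f (cis t)" for t
  proof -
    have a: "cis t * cnj (cis t) = 1" by (simp add: complex_norm_square [symmetric])
    have "of_real ((cmod (cis t - z))\<^sup>2) = (cis t - z) * cnj (cis t - z)"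
      by (rule complex_norm_square)
    also have "\<dots> * cis t = (cis t - z) * (1 - cnj z * cis t)"
      using a by (simp add: algebra_simps)
    finally have b: "of_real ((cmod (cis t - z))\<^sup>2) * cis t = (cis t - z) * (1 - cnj z * cis t)" .
    have n: "cis t - z \<noteq> 0" using cis_neq_in_disc[OF z] by simp
    have n2: "1 - cnj z * cis t \<noteq> 0" using nz by simp
    have "-\<i> * (g (cis t) / (cis t - z) * \<i> * cis t) = g (cis t) / (cis t - z) * cis t"
      by (simp add: field_simps)
    also have "\<dots> = f (cis t) * (1 - (cmod z)\<^sup>2) * cis t / ((cis t - z) * (1 - cnj z * cis t))"
      unfolding g_def by (simp add: field_simps)
    also have "\<dots> = f (cis t) * (1 - (cmod z)\<^sup>2) * cis t / (of_real ((cmod (cis t - z))\<^sup>2) * cis t)"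
      unfolding b ..
    also have "\<dots> = of_real (disc_poisson z t) * f (cis t)"
      unfolding disc_poisson_def using n by simp
    finally show ?thesis .
  qed
  ultimately have "((\<lambda>t. of_real (disc_poisson z t) * f (cis t)) has_integral (-\<i> * (2 * of_real pi * \<i> * f z))) {0..2*pi}"
    by simp
  thus ?thesis by (simp add: algebra_simps)
qed

lemma disc_poisson_has_integral:
  assumes "cmod z < 1"
  shows "(disc_poisson z has_integral 2 * pi) {0..2*pi}"
proof -
  have "((\<lambda>\<theta>. complex_of_real (disc_poisson z \<theta>)) has_integral of_real (2 * pi)) {0..2*pi}"
    using poisson_formula_holomorphic[of "\<lambda>_. 1" z] assms by simp
  from has_integral_Re[OF this] show ?thesis by simp
qed

text \<open>On the unit circle conjugation replaces \<open>\<zeta>\<close> by \<open>1/\<zeta>\<close>, and under a real part a negative power can be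
conjugated back into a positive one. Therefore the real parts of polynomials are closed under
multiplication there, which is what makes them dense in the continuous functions.\<close>

lemma Re_mult_cnj_poly_on_circle:
  "\<exists>r. \<forall>\<zeta>. cmod \<zeta> = 1 \<longrightarrow> Re (poly p \<zeta> * cnj (poly q \<zeta>)) = Re (poly r \<zeta>)"
proof (induction p arbitrary: q)
  case 0
  show ?case by (rule exI[of _ 0]) simp
next
  case (pCons a p)
  obtain b q' where q: "q = pCons b q'" by (cases q)
  obtain r where r: "\<And>\<zeta>. cmod \<zeta> = 1 \<Longrightarrow> Re (poly p \<zeta> * cnj (poly q' \<zeta>)) = Re (poly r \<zeta>)"
    using pCons.IH by blast
  show ?case
  proof (intro exI[of _ "[:a * cnj b:] + pCons 0 (smult (cnj a) q') + pCons 0 (smult (cnj b) p) + r"] allI impI)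
    fix \<zeta> :: complex assume z: "cmod \<zeta> = 1"
    have one: "\<zeta> * cnj \<zeta> = 1" using z by (simp add: complex_norm_square [symmetric])
    have "poly (pCons a p) \<zeta> * cnj (poly q \<zeta>) =
       a * cnj b + a * cnj (\<zeta> * poly q' \<zeta>) + \<zeta> * poly p \<zeta> * cnj b + (\<zeta> * cnj \<zeta>) * (poly p \<zeta> * cnj (poly q' \<zeta>))"
      by (simp add: q algebra_simps)
    hence "Re (poly (pCons a p) \<zeta> * cnj (poly q \<zeta>)) =
       Re (a * cnj b) + Re (cnj (a * cnj (\<zeta> * poly q' \<zeta>))) + Re (\<zeta> * poly p \<zeta> * cnj b) + Re (poly r \<zeta>)"
      unfolding one by (simp only: plus_complex.simps complex_cnj r[OF z] mult_1 cnj.simps)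
    also have "cnj (a * cnj (\<zeta> * poly q' \<zeta>)) = cnj a * (\<zeta> * poly q' \<zeta>)" by simp
    finally show "Re (poly (pCons a p) \<zeta> * cnj (poly q \<zeta>)) =
      Re (poly ([:a * cnj b:] + pCons 0 (smult (cnj a) q') + pCons 0 (smult (cnj b) p) + r) \<zeta>)"
      by (simp add: algebra_simps)
  qed
qed

lemma real_polynomial_on_circle:
  assumes "real_polynomial_function (f :: complex \<Rightarrow> real)"
  shows "\<exists>p. \<forall>\<zeta>. cmod \<zeta> = 1 \<longrightarrow> f \<zeta> = Re (poly p \<zeta>)"
  using assms
proof (induction rule: real_polynomial_function.induct)
  case (linear f)
  show ?case
  proof (intro exI[of _ "[:0, of_real (f 1) - \<i> * of_real (f \<i>):]"] allI impI)
    fix \<zeta> :: complex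
    interpret bounded_linear f by fact
    have "f \<zeta> = f (Re \<zeta> *\<^sub>R 1 + Im \<zeta> *\<^sub>R \<i>)"
      by (rule arg_cong[where f=f]) (simp add: complex_eq_iff)
    also have "\<dots> = Re \<zeta> * f 1 + Im \<zeta> * f \<i>" by (simp only: add scaleR) simp
    finally show "f \<zeta> = Re (poly [:0, of_real (f 1) - \<i> * of_real (f \<i>):] \<zeta>)" by simp
  qed
next
  case (const c)
  show ?case by (rule exI[of _ "[:of_real c:]"]) simp
next
  case (add f g)
  then obtain p q where "\<And>\<zeta>. cmod \<zeta> = 1 \<Longrightarrow> f \<zeta> = Re (poly p \<zeta>)"
    "\<And>\<zeta>. cmod \<zeta> = 1 \<Longrightarrow> g \<zeta> = Re (poly q \<zeta>)" by metis
  thus ?case by (intro exI[of _ "p + q"]) simp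
next
  case (mult f g)
  then obtain p q where pq: "\<And>\<zeta>. cmod \<zeta> = 1 \<Longrightarrow> f \<zeta> = Re (poly p \<zeta>)"
    "\<And>\<zeta>. cmod \<zeta> = 1 \<Longrightarrow> g \<zeta> = Re (poly q \<zeta>)" by metis
  obtain r where r: "\<And>\<zeta>. cmod \<zeta> = 1 \<Longrightarrow> Re (poly p \<zeta> * cnj (poly q \<zeta>)) = Re (poly r \<zeta>)"
    using Re_mult_cnj_poly_on_circle by metis
  show ?case
  proof (intro exI[of _ "smult (1/2) (p * q + r)"] allI impI)
    fix \<zeta> :: complex assume z: "cmod \<zeta> = 1"
    have "Re (poly (smult (1/2) (p * q + r)) \<zeta>) = (Re (poly p \<zeta> * poly q \<zeta>) + Re (poly r \<zeta>)) / 2"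
      by (simp add: field_simps)
    also have "\<dots> = f \<zeta> * g \<zeta>" using r[OF z] pq[OF z] by simp
    finally show "f \<zeta> * g \<zeta> = Re (poly (smult (1/2) (p * q + r)) \<zeta>)" by simp
  qed
qed

text \<open>Multiplying \<open>f\<close> and \<open>g\<close> by constants of modulus 1 that make \<open>f z\<close> and \<open>g z\<close> nonnegative turns the
sum of moduli at \<open>z\<close> into the modulus of a single analytic function.\<close>

lemma maximum_modulus_sum_disc:
  fixes f g :: "complex \<Rightarrow> complex"
  assumes f: "continuous_on (cball 0 1) f" "f holomorphic_on ball 0 1"
    and g: "continuous_on (cball 0 1) g" "g holomorphic_on ball 0 1"
    and B: "\<And>\<zeta>. cmod \<zeta> = 1 \<Longrightarrow> cmod (f \<zeta>) + cmod (g \<zeta>) \<le> B"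
    and z: "cmod z \<le> 1"
  shows "cmod (f z) + cmod (g z) \<le> B"
proof -
  have rot: "\<exists>a. cmod a = 1 \<and> a * w = of_real (cmod w)" for w :: complex
  proof (cases "w = 0")
    case True thus ?thesis by (intro exI[of _ 1]) simp
  next
    case False thus ?thesis
      by (intro exI[of _ "cnj w / cmod w"])
        (simp add: norm_divide complex_norm_square [symmetric] power2_eq_square mult.commute)
  qed
  obtain a b where a: "cmod a = 1" "a * f z = of_real (cmod (f z))"
    and b: "cmod b = 1" "b * g z = of_real (cmod (g z))" using rot by metis
  have "cmod (a * f z + b * g z) \<le> B"
  proof (rule maximum_modulus_frontier[of "\<lambda>z. a * f z + b * g z" "cball 0 1"])
    show "(\<lambda>z. a * f z + b * g z) holomorphic_on interior (cball 0 1)"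
      using f g by (auto intro!: holomorphic_intros)
    show "continuous_on (closure (cball 0 1)) (\<lambda>z. a * f z + b * g z)"
      using f g by (auto intro!: continuous_intros)
    fix \<zeta> :: complex assume "\<zeta> \<in> frontier (cball 0 1)"
    hence "cmod \<zeta> = 1" by auto
    hence "cmod (f \<zeta>) + cmod (g \<zeta>) \<le> B" by (rule B)
    thus "cmod (a * f \<zeta> + b * g \<zeta>) \<le> B"
      using norm_triangle_ineq[of "a * f \<zeta>" "b * g \<zeta>"] a b by (simp add: norm_mult)
  qed (use z in auto)
  also have "a * f z + b * g z = of_real (cmod (f z) + cmod (g z))" using a b by simp
  finally show ?thesis by (simp only: norm_of_real)
qed

text \<open>Subharmonicity of \<open>ln (\<epsilon> + |f|)\<close>. If \<open>Re p\<close>, for a polynomial \<open>p\<close>, is uniformly close to these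
boundary values, then \<open>|f exp (-p)| + |\<epsilon> exp (-p)|\<close> is close to 1 on the circle and so at most
about 1 inside, while \<open>Re p\<close> is the Poisson integral of its boundary values. The summand \<open>\<epsilon>\<close> keeps
the logarithm finite at the zeros of \<open>f\<close>.\<close>

lemma ln_norm_le_poisson_integral:
  fixes f :: "complex \<Rightarrow> complex"
  assumes f: "continuous_on (cball 0 1) f" "f holomorphic_on ball 0 1"
    and e: "\<epsilon> > 0" and z: "cmod z < 1"
  shows "2 * pi * ln (\<epsilon> + cmod (f z)) \<le>
         integral {0..2*pi} (\<lambda>\<theta>. disc_poisson z \<theta> * ln (\<epsilon> + cmod (f (cis \<theta>))))"
proof (rule field_le_epsilon)
  fix d :: real assume d: "d > 0"
  define e where "e = d / (4 * pi)"
  have e0: "e > 0" using d by (simp add: e_def)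
  let ?u = "\<lambda>\<zeta>. ln (\<epsilon> + cmod (f \<zeta>))"
  have pos: "\<epsilon> + cmod (f w) > 0" for w using e norm_ge_zero[of "f w"] by linarith
  have sub: "sphere 0 1 \<subseteq> (cball 0 1 :: complex set)" by auto
  have contu: "continuous_on (sphere 0 1) ?u"
    using pos by (intro continuous_intros continuous_on_subset[OF f(1) sub]) (metis less_irrefl)
  obtain h where h: "real_polynomial_function h" "\<And>\<zeta>. \<zeta> \<in> sphere 0 1 \<Longrightarrow> \<bar>?u \<zeta> - h \<zeta>\<bar> < e"
    using Stone_Weierstrass_real_polynomial_function[OF compact_sphere contu e0] by metis
  obtain p where p: "\<And>\<zeta>. cmod \<zeta> = 1 \<Longrightarrow> h \<zeta> = Re (poly p \<zeta>)"
    using real_polynomial_on_circle[OF h(1)] by metis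
  have close: "\<bar>?u \<zeta> - Re (poly p \<zeta>)\<bar> < e" if "cmod \<zeta> = 1" for \<zeta>
    using h(2)[of \<zeta>] p[OF that] that by simp
  have "cmod (f z * exp (- poly p z)) + cmod (of_real \<epsilon> * exp (- poly p z)) \<le> exp e"
  proof (rule maximum_modulus_sum_disc[of "\<lambda>z. f z * exp (- poly p z)" "\<lambda>z. of_real \<epsilon> * exp (- poly p z)"])
    fix \<zeta> :: complex assume c: "cmod \<zeta> = 1"
    have "cmod (f \<zeta> * exp (- poly p \<zeta>)) + cmod (of_real \<epsilon> * exp (- poly p \<zeta>)) =
       (\<epsilon> + cmod (f \<zeta>)) * exp (- Re (poly p \<zeta>))"
      using e by (simp add: norm_mult algebra_simps)
    also have "\<dots> = exp (?u \<zeta> - Re (poly p \<zeta>))"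
      using pos by (simp add: exp_diff exp_minus field_simps)
    also have "\<dots> \<le> exp e" using close[OF c] by (simp add: abs_if split: if_splits)
    finally show "cmod (f \<zeta> * exp (- poly p \<zeta>)) + cmod (of_real \<epsilon> * exp (- poly p \<zeta>)) \<le> exp e" .
  qed (use f z in \<open>auto intro!: continuous_intros holomorphic_intros\<close>)
  also have "cmod (f z * exp (- poly p z)) + cmod (of_real \<epsilon> * exp (- poly p z)) = (\<epsilon> + cmod (f z)) * exp (- Re (poly p z))"
    using e by (simp add: norm_mult algebra_simps)
  also have "\<dots> = exp (?u z - Re (poly p z))"
    using pos by (simp add: exp_diff exp_minus field_simps)
  finally have A: "?u z \<le> Re (poly p z) + e" by simp
  have "((\<lambda>\<theta>. Re (of_real (disc_poisson z \<theta>) * poly p (cis \<theta>))) has_integral Re (2 * of_real pi * poly p z)) {0..2*pi}"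
    by (rule has_integral_Re, rule poisson_formula_holomorphic)
      (use z in \<open>auto intro!: continuous_intros holomorphic_intros\<close>)
  hence B: "((\<lambda>\<theta>. disc_poisson z \<theta> * Re (poly p (cis \<theta>))) has_integral 2 * pi * Re (poly p z)) {0..2*pi}"
    by simp
  have I: "(\<lambda>\<theta>. disc_poisson z \<theta> * ?u (cis \<theta>)) integrable_on {0..2*pi}"
  proof (rule integrable_continuous_real, intro continuous_intros continuous_on_disc_poisson z)
    show "continuous_on {0..2*pi} (\<lambda>\<theta>. f (cis \<theta>))"
      by (rule continuous_on_compose2[OF f(1)]) (auto intro!: continuous_intros)
    show "\<forall>\<theta>\<in>{0..2*pi}. \<epsilon> + cmod (f (cis \<theta>)) \<noteq> 0" using pos by (metis less_irrefl)
  qed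
  have "2 * pi * Re (poly p z) \<le> integral {0..2*pi} (\<lambda>\<theta>. disc_poisson z \<theta> * ?u (cis \<theta>)) + 2 * pi * e"
  proof (rule has_integral_le[OF B])
    show "((\<lambda>\<theta>. disc_poisson z \<theta> * ?u (cis \<theta>) + disc_poisson z \<theta> * e) has_integral
       integral {0..2*pi} (\<lambda>\<theta>. disc_poisson z \<theta> * ?u (cis \<theta>)) + 2 * pi * e) {0..2*pi}"
      by (intro has_integral_add integrable_integral I has_integral_mult_left disc_poisson_has_integral z)
    fix \<theta> :: real
    have "disc_poisson z \<theta> * Re (poly p (cis \<theta>)) \<le> disc_poisson z \<theta> * (?u (cis \<theta>) + e)"
      using close[of "cis \<theta>"] disc_poisson_nonneg[OF z] by (intro mult_left_mono) auto
    thus "disc_poisson z \<theta> * Re (poly p (cis \<theta>)) \<le> disc_poisson z \<theta> * ?u (cis \<theta>) + disc_poisson z \<theta> * e"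
      by (simp add: algebra_simps)
  qed
  moreover have "2 * pi * ?u z \<le> 2 * pi * (Re (poly p z) + e)" using A by (intro mult_left_mono) auto
  moreover have "4 * pi * e = d" by (simp add: e_def)
  ultimately show "2 * pi * ?u z \<le> integral {0..2*pi} (\<lambda>\<theta>. disc_poisson z \<theta> * ?u (cis \<theta>)) + d"
    by (simp add: algebra_simps)
qed

lemma disc_poisson_ge:
  assumes "cmod z \<le> \<rho>" "\<rho> < 1"
  shows "(1 - \<rho>) / (1 + \<rho>) \<le> disc_poisson z \<theta>"
proof -
  let ?m = "cmod z"
  have m: "0 \<le> ?m" "?m < 1" using assms norm_ge_zero[of z] by linarith+
  have "(1 - \<rho>) / (1 + \<rho>) \<le> (1 - ?m) / (1 + ?m)"
    using assms m by (intro frac_le) (auto intro: add_pos_nonneg)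
  also have "\<dots> = (1 - ?m\<^sup>2) / (1 + ?m)\<^sup>2"
  proof -
    have "1 + ?m \<noteq> 0" using m by linarith
    moreover have "1 - ?m\<^sup>2 = (1 - ?m) * (1 + ?m)" by (simp add: algebra_simps power2_eq_square)
    ultimately show ?thesis by (simp add: power2_eq_square)
  qed
  also have "\<dots> \<le> (1 - ?m\<^sup>2) / (cmod (cis \<theta> - z))\<^sup>2"
  proof (rule divide_left_mono)
    show "(cmod (cis \<theta> - z))\<^sup>2 \<le> (1 + ?m)\<^sup>2"
      using norm_triangle_ineq4[of "cis \<theta>" z] by (intro power_mono) auto
    show "0 \<le> 1 - ?m\<^sup>2" using m by (simp add: power_le_one)
    show "0 < (1 + ?m)\<^sup>2 * (cmod (cis \<theta> - z))\<^sup>2" using cis_neq_in_disc[OF m(2), of \<theta>] add_pos_nonneg[OF zero_less_one m(1)] by simp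
  qed
  finally show ?thesis unfolding disc_poisson_def .
qed

lemma dilation_on_disc:
  fixes f :: "complex \<Rightarrow> complex"
  assumes f: "f holomorphic_on ball 0 1" and r: "0 < r" "r < 1"
  shows "continuous_on (cball 0 1) (\<lambda>z. f (of_real r * z))" "(\<lambda>z. f (of_real r * z)) holomorphic_on ball 0 1"
proof -
  have im: "of_real r * z \<in> ball 0 1" if "z \<in> cball 0 1" for z :: complex
  proof -
    have "r * cmod z \<le> r * 1" using that r by (intro mult_left_mono) auto
    hence "cmod (of_real r * z) \<le> r" using r by (simp add: norm_mult)
    thus ?thesis using r by simp
  qed
  show "continuous_on (cball 0 1) (\<lambda>z. f (of_real r * z))"
    by (rule continuous_on_compose2[OF holomorphic_on_imp_continuous_on[OF f]]) (use im in \<open>auto intro!: continuous_intros\<close>)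
  show "(\<lambda>z. f (of_real r * z)) holomorphic_on ball 0 1"
    by (rule holomorphic_on_compose_gen[OF _ f, unfolded o_def]) (use im in \<open>auto intro!: holomorphic_intros\<close>)
qed

text \<open>Logarithmic mean values of a quotient \<open>g / k\<close> of functions bounded by 1 stay bounded as the radius
tends to 1. Since \<open>(1 + |H|) (e + |k|)\<close> is at most about 2, the mean of \<open>ln (1 + |H|)\<close> is controlled by
minus the mean of \<open>ln (e + |k|)\<close>, and subharmonicity at one point \<open>z1\<close> with \<open>k z1 \<noteq> 0\<close> bounds the
latter. The radius must exceed \<open>|z1|\<close> by a fixed amount, whence \<open>r0\<close>.\<close>

lemma log_mass_bound_disc:
  assumes H: "H holomorphic_on ball 0 1" and k: "k holomorphic_on ball 0 1"
    and k1: "\<And>z. cmod z < 1 \<Longrightarrow> cmod (k z) \<le> 1" and Hk: "\<And>z. cmod z < 1 \<Longrightarrow> cmod (H z * k z) \<le> 1"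
    and z1: "cmod z1 < 1" "k z1 \<noteq> 0"
  obtains C r0 where "C \<ge> 0" "0 \<le> r0" "r0 < 1"
    "\<And>r. r0 < r \<Longrightarrow> r < 1 \<Longrightarrow> integral {0..2*pi} (\<lambda>\<theta>. ln (1 + cmod (H (of_real r * cis \<theta>)))) \<le> 2 * pi * C"
proof -
  define r0 where "r0 = (1 + cmod z1) / 2"
  define \<rho> where "\<rho> = cmod z1 / r0"
  have r0: "0 < r0" "r0 < 1" "cmod z1 < r0" using z1 add_pos_nonneg[OF zero_less_one norm_ge_zero[of z1]] unfolding r0_def by (simp_all add: field_simps)
  have \<rho>: "0 \<le> \<rho>" "\<rho> < 1" using r0 unfolding \<rho>_def by auto
  define c where "c = (1 - \<rho>) / (1 + \<rho>)"
  have c: "c > 0" using \<rho> unfolding c_def by auto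
  have kz1: "cmod (k z1) > 0" "ln (cmod (k z1)) \<le> 0" using z1 k1[OF z1(1)] by (auto simp: ln_le_zero_iff)
  show thesis
  proof (rule that[of "ln 2 - ln (cmod (k z1)) / c" r0])
    show "0 \<le> ln 2 - ln (cmod (k z1)) / c" using kz1 c by (simp add: divide_nonpos_pos order_trans[of _ 0])
    fix r assume r: "r0 < r" "r < 1"
    have rpos: "0 < r" using r r0 by simp
    have rb: "cmod (of_real r * cis \<theta>) < 1" for \<theta> using r rpos by (simp add: norm_mult)
    have contr: "continuous_on {0..2*pi} (\<lambda>\<theta>. f (of_real r * cis \<theta>))" if "f holomorphic_on ball 0 1" for f :: "complex \<Rightarrow> complex"
      by (rule continuous_on_compose2[OF holomorphic_on_imp_continuous_on[OF that]]) (use rb in \<open>auto intro!: continuous_intros\<close>)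
    obtain S where S: "S \<ge> 0" "\<And>\<theta>. \<theta> \<in> {0..2*pi} \<Longrightarrow> cmod (H (of_real r * cis \<theta>)) \<le> S"
    proof -
      have "compact ((\<lambda>\<theta>. H (of_real r * cis \<theta>)) ` {0..2*pi})"
        by (intro compact_continuous_image contr H) simp
      from compact_imp_bounded[OF this] obtain S where "\<And>\<theta>. \<theta> \<in> {0..2*pi} \<Longrightarrow> cmod (H (of_real r * cis \<theta>)) \<le> S"
        unfolding bounded_iff by blast
      thus thesis using that[of "max S 0"] by (meson max.cobounded2 max.coboundedI1)
    qed
    let ?I = "integral {0..2*pi} (\<lambda>\<theta>. ln (1 + cmod (H (of_real r * cis \<theta>))))"
    have pos1: "1 + cmod w > 0" for w :: complex using norm_ge_zero[of w] by linarith
    have est: "?I \<le> 2 * pi * (ln (2 + e * (1 + S)) - (ln (1 + e) + (ln (cmod (k z1)) - ln (1 + e)) / c))" if e: "e > 0" for e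
    proof -
      let ?L = "\<lambda>\<theta>. ln (e + cmod (k (of_real r * cis \<theta>)))"
      have pose: "e + cmod w > 0" for w :: complex using e norm_ge_zero[of w] by linarith
      have cL: "continuous_on {0..2*pi} ?L"
        by (intro continuous_intros contr k) (metis pose less_irrefl)
      have cH: "continuous_on {0..2*pi} (\<lambda>\<theta>. ln (1 + cmod (H (of_real r * cis \<theta>))))"
        by (intro continuous_intros contr H) (metis pos1 less_irrefl)
      \<comment> \<open>The dilated function \<open>k (r u)\<close> takes the value \<open>k z1\<close> at this point.\<close>
      let ?z = "z1 / of_real r"
      have z: "cmod ?z < 1" "cmod ?z \<le> \<rho>"
        using r r0 unfolding \<rho>_def by (auto simp: norm_divide intro!: divide_left_mono)
      have "2 * pi * ln (e + cmod (k (of_real r * ?z))) \<le>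
         integral {0..2*pi} (\<lambda>\<theta>. disc_poisson ?z \<theta> * ln (e + cmod (k (of_real r * cis \<theta>))))"
        by (rule ln_norm_le_poisson_integral[OF dilation_on_disc[OF k rpos r(2)] e z(1)])
      hence "2 * pi * ln (e + cmod (k z1)) \<le> integral {0..2*pi} (\<lambda>\<theta>. disc_poisson ?z \<theta> * ?L \<theta>)"
        using rpos by simp
      also have "\<dots> \<le> 2 * pi * ln (1 + e) + c * (integral {0..2*pi} ?L - 2 * pi * ln (1 + e))"
      proof (rule has_integral_le)
        show "((\<lambda>\<theta>. disc_poisson ?z \<theta> * ?L \<theta>) has_integral integral {0..2*pi} (\<lambda>\<theta>. disc_poisson ?z \<theta> * ?L \<theta>)) {0..2*pi}"
          by (intro integrable_integral integrable_continuous_real continuous_intros continuous_on_disc_poisson z cL)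
        have "((\<lambda>\<theta>. ln (1 + e)) has_integral (2 * pi * ln (1 + e))) {0..2*pi}"
          using has_integral_const_real[of "ln (1 + e)" 0 "2 * pi"] by simp
        thus "((\<lambda>\<theta>. disc_poisson ?z \<theta> * ln (1 + e) + c * (?L \<theta> - ln (1 + e))) has_integral
           2 * pi * ln (1 + e) + c * (integral {0..2*pi} ?L - 2 * pi * ln (1 + e))) {0..2*pi}"
          by (intro has_integral_add has_integral_mult_left has_integral_mult_right has_integral_diff
              disc_poisson_has_integral z integrable_integral integrable_continuous_real cL)
        fix \<theta> :: real
        have "cmod (k (of_real r * cis \<theta>)) \<le> 1" using k1 rb by auto
        hence "?L \<theta> \<le> ln (1 + e)" using pose[of "k (of_real r * cis \<theta>)"] e by (subst ln_le_cancel_iff) auto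
        \<comment> \<open>The integrand is nonpositive after subtracting \<open>ln (1 + e)\<close>, so the kernel may be replaced by its lower bound \<open>c\<close>.\<close>
        hence "(disc_poisson ?z \<theta> - c) * (?L \<theta> - ln (1 + e)) \<le> 0"
          using disc_poisson_ge[OF z(2) \<rho>(2), of \<theta>] unfolding c_def by (intro mult_nonneg_nonpos) auto
        thus "disc_poisson ?z \<theta> * ?L \<theta> \<le> disc_poisson ?z \<theta> * ln (1 + e) + c * (?L \<theta> - ln (1 + e))"
          by (simp add: algebra_simps)
      qed
      finally have "2 * pi * ln (e + cmod (k z1)) \<le> 2 * pi * ln (1 + e) + c * (integral {0..2*pi} ?L - 2 * pi * ln (1 + e))" .
      moreover have "2 * pi * ln (cmod (k z1)) \<le> 2 * pi * ln (e + cmod (k z1))"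
        using kz1 e pose[of "k z1"] by (intro mult_left_mono) (auto simp del: zero_less_norm_iff)
      ultimately have "2 * pi * (ln (cmod (k z1)) - ln (1 + e)) \<le> c * (integral {0..2*pi} ?L - 2 * pi * ln (1 + e))"
        by (simp only: right_diff_distrib[of "2 * pi"])
      hence "2 * pi * (ln (cmod (k z1)) - ln (1 + e)) / c \<le> integral {0..2*pi} ?L - 2 * pi * ln (1 + e)"
        using c by (simp add: field_simps)
      hence low: "2 * pi * (ln (1 + e) + (ln (cmod (k z1)) - ln (1 + e)) / c) \<le> integral {0..2*pi} ?L"
        by (simp add: algebra_simps)
      have "?I \<le> 2 * pi * ln (2 + e * (1 + S)) - integral {0..2*pi} ?L"
      proof (rule has_integral_le)
        show "((\<lambda>\<theta>. ln (1 + cmod (H (of_real r * cis \<theta>)))) has_integral ?I) {0..2*pi}"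
          by (intro integrable_integral integrable_continuous_real cH)
        have "((\<lambda>\<theta>. ln (2 + e * (1 + S))) has_integral (2 * pi * ln (2 + e * (1 + S)))) {0..2*pi}"
          using has_integral_const_real[of "ln (2 + e * (1 + S))" 0 "2 * pi"] by simp
        thus "((\<lambda>\<theta>. ln (2 + e * (1 + S)) - ?L \<theta>) has_integral 2 * pi * ln (2 + e * (1 + S)) - integral {0..2*pi} ?L) {0..2*pi}"
          by (intro has_integral_diff integrable_integral integrable_continuous_real cL)
        fix \<theta> assume th: "\<theta> \<in> {0..2*pi}"
        let ?h = "cmod (H (of_real r * cis \<theta>))" and ?k = "cmod (k (of_real r * cis \<theta>))"
        have "?h * ?k \<le> 1" using Hk[OF rb[of \<theta>]] by (simp add: norm_mult)
        moreover have "?k \<le> 1" using k1 rb by auto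
        moreover have "e * ?h \<le> e * S" using S(2)[OF th] e by (intro mult_left_mono) auto
        ultimately have "(1 + ?h) * (e + ?k) \<le> 2 + e * (1 + S)" by (simp add: algebra_simps)
        moreover have "(1 + ?h) * (e + ?k) > 0" using pos1 pose by simp
        ultimately have "ln ((1 + ?h) * (e + ?k)) \<le> ln (2 + e * (1 + S))" by simp
        moreover have "ln ((1 + ?h) * (e + ?k)) = ln (1 + ?h) + ?L \<theta>"
          by (intro ln_mult_pos pos1 pose)
        ultimately show "ln (1 + ?h) \<le> ln (2 + e * (1 + S)) - ?L \<theta>" by simp
      qed
      with low show ?thesis by (simp add: algebra_simps)
    qed
    have "((\<lambda>e. 2 * pi * (ln (2 + e * (1 + S)) - (ln (1 + e) + (ln (cmod (k z1)) - ln (1 + e)) / c))) \<longlongrightarrow>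
      2 * pi * (ln (2 + 0 * (1 + S)) - (ln (1 + 0) + (ln (cmod (k z1)) - ln (1 + 0)) / c))) (at_right 0)"
      using c by (intro tendsto_intros) auto
    moreover have "eventually (\<lambda>e. ?I \<le> 2 * pi * (ln (2 + e * (1 + S)) - (ln (1 + e) + (ln (cmod (k z1)) - ln (1 + e)) / c))) (at_right 0)"
      using eventually_at_right_less[of "0::real"] by (rule eventually_mono) (rule est)
    ultimately have "?I \<le> 2 * pi * (ln (2 + 0 * (1 + S)) - (ln (1 + 0) + (ln (cmod (k z1)) - ln (1 + 0)) / c))"
      by (rule tendsto_lowerbound) simp
    thus "?I \<le> 2 * pi * (ln 2 - ln (cmod (k z1)) / c)" by simp
  qed (use r0 in auto)
qed

text \<open>Subharmonicity on the circle of radius \<open>r < 1\<close>, followed by \<open>r \<rightarrow> 1\<close>. The boundary function may be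
unbounded near the point 1 only. The arc around that point carries at most the mass \<open>2 \<pi> C\<close>, so
it contributes at most \<open>S\<close> times this mass; on the complementary arc the limit can be taken under
the integral. There \<open>ln s\<close> is replaced by its tangent \<open>ln a - 1 + s / a\<close>, which leaves only an
integral of \<open>|H|\<close> itself.\<close>

lemma log_majorant_disc:
  assumes H: "H holomorphic_on ball 0 1" "continuous_on (cball 0 1 - {1}) H"
    and C: "\<And>r. r0 < r \<Longrightarrow> r < 1 \<Longrightarrow> integral {0..2*pi} (\<lambda>\<theta>. ln (1 + cmod (H (of_real r * cis \<theta>)))) \<le> 2 * pi * C"
    and r0: "0 \<le> r0" "r0 < 1"
    and z: "cmod z < 1" and \<eta>: "0 < \<eta>" "\<eta> \<le> 1" and a: "a > 0" and \<beta>: "0 < \<beta>" "\<beta> < pi"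
    and S: "\<And>\<theta>. \<theta> \<in> {0..2*pi} \<Longrightarrow> \<theta> \<notin> {\<beta>..2*pi - \<beta>} \<Longrightarrow> disc_poisson z \<theta> \<le> S" "S \<ge> 0"
  shows "2 * pi * ln (\<eta> + cmod (H z)) \<le>
     integral {\<beta>..2*pi - \<beta>} (\<lambda>\<theta>. disc_poisson z \<theta> * (ln a - 1 + (\<eta> + cmod (H (cis \<theta>))) / a)) + S * (2 * pi * C)"
proof -
  define G where "G = (\<lambda>r \<theta>. disc_poisson z \<theta> * (ln a - 1 + (\<eta> + cmod (H (of_real r * cis \<theta>))) / a))"
  define D where "D = (\<lambda>r. 2 * pi * ln (\<eta> + cmod (H (of_real r * z))) - integral {\<beta>..2*pi - \<beta>} (G r))"
  have pos: "\<eta> + cmod w > 0" for w :: complex using \<eta> norm_ge_zero[of w] by linarith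
  have pos1: "1 + cmod w > 0" for w :: complex using norm_ge_zero[of w] by linarith
  have sub: "{\<beta>..2*pi - \<beta>} \<subseteq> {0..2*pi}" using \<beta> by auto
  have neq1: "of_real r * cis \<theta> \<noteq> 1" if "\<theta> \<in> {\<beta>..2*pi - \<beta>}" "r \<in> {0..1}" for r \<theta>
  proof
    assume eq: "of_real r * cis \<theta> = 1"
    hence "cmod (of_real r * cis \<theta>) = 1" by simp
    hence "r = 1" using that by (simp add: norm_mult)
    hence "cos \<theta> = 1" using eq by (simp add: complex_eq_iff)
    moreover have "cos \<theta> < 1"
    proof (cases "\<theta> \<le> pi")
      case True
      hence "cos \<theta> < cos 0" using that \<beta> by (intro cos_monotone_0_pi) auto
      thus ?thesis by simp
    next
      case False
      hence "cos (2*pi - \<theta>) < cos 0" using that \<beta> by (intro cos_monotone_0_pi) auto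
      thus ?thesis by simp
    qed
    ultimately show False by simp
  qed
  have contD: "continuous_on {r0..1} D"
  proof -
    have jc: "continuous_on ({r0..1} \<times> {\<beta>..2*pi - \<beta>}) (\<lambda>p. H (of_real (fst p) * cis (snd p)))"
    proof (rule continuous_on_compose2[OF H(2)])
      show "continuous_on ({r0..1} \<times> {\<beta>..2*pi - \<beta>}) (\<lambda>p. of_real (fst p) * cis (snd p))"
        by (intro continuous_intros)
      show "(\<lambda>p. of_real (fst p) * cis (snd p)) ` ({r0..1} \<times> {\<beta>..2*pi - \<beta>}) \<subseteq> cball 0 1 - {1}"
        using neq1 r0 by (auto simp: norm_mult)
    qed
    have dp: "continuous_on ({r0..1} \<times> {\<beta>..2*pi - \<beta>}) (\<lambda>p. disc_poisson z (snd p))"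
      by (rule continuous_on_compose2[OF continuous_on_disc_poisson[OF z, of UNIV]]) (auto intro!: continuous_intros)
    have "continuous_on ({r0..1} \<times> cbox \<beta> (2*pi - \<beta>)) (\<lambda>(r, \<theta>). G r \<theta>)"
      unfolding G_def case_prod_unfold using jc dp a by (auto intro!: continuous_intros)
    from integral_continuous_on_param[OF this]
    have "continuous_on {r0..1} (\<lambda>r. integral {\<beta>..2*pi - \<beta>} (G r))" by simp
    moreover have "continuous_on {r0..1} (\<lambda>r. H (of_real r * z))"
    proof (rule continuous_on_compose2[OF holomorphic_on_imp_continuous_on[OF H(1)]])
      show "(\<lambda>r. of_real r * z) ` {r0..1} \<subseteq> ball 0 1"
      proof safe
        fix r assume "r \<in> {r0..1}"
        hence r: "0 \<le> r" "r \<le> 1" using r0 by auto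
        hence "r * cmod z \<le> 1 * cmod z" by (intro mult_right_mono) auto
        thus "of_real r * z \<in> ball 0 1" using z r by (simp add: norm_mult)
      qed
    qed (intro continuous_intros)
    ultimately show ?thesis unfolding D_def
      by (intro continuous_intros) (use pos in \<open>auto simp: less_imp_neq[symmetric]\<close>)
  qed
  have "D 1 \<le> S * (2 * pi * C)"
  proof (rule continuous_le_on_closure[of "{r0<..<1}" D 1])
    show "continuous_on (closure {r0<..<1}) D" using contD r0 by simp
    show "1 \<in> closure {r0<..<1}" using r0 by simp
    fix r assume "r \<in> {r0<..<1}"
    hence r: "r0 < r" "r < 1" "0 < r" using r0 by auto
    have rb: "cmod (of_real r * cis \<theta>) < 1" for \<theta> using r by (simp add: norm_mult)
    have cHr: "continuous_on {0..2*pi} (\<lambda>\<theta>. H (of_real r * cis \<theta>))"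
      by (rule continuous_on_compose2[OF holomorphic_on_imp_continuous_on[OF H(1)]]) (use rb in \<open>auto intro!: continuous_intros\<close>)
    let ?L = "\<lambda>\<theta>. ln (1 + cmod (H (of_real r * cis \<theta>)))"
    let ?F = "\<lambda>\<theta>. disc_poisson z \<theta> * ln (\<eta> + cmod (H (of_real r * cis \<theta>)))"
    have "2 * pi * ln (\<eta> + cmod (H (of_real r * z))) \<le> integral {0..2*pi} ?F"
      by (rule ln_norm_le_poisson_integral[OF dilation_on_disc[OF H(1) r(3,2)] \<eta>(1) z])
    also have "\<dots> \<le> integral {\<beta>..2*pi - \<beta>} (G r) + S * integral {0..2*pi} ?L"
    proof (rule has_integral_le)
      have "continuous_on {0..2*pi} ?F"
        by (intro continuous_intros continuous_on_disc_poisson z cHr) (metis pos less_irrefl)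
      thus "(?F has_integral integral {0..2*pi} ?F) {0..2*pi}"
        by (intro integrable_integral integrable_continuous_real)
      have cL: "continuous_on {0..2*pi} ?L"
        by (intro continuous_intros cHr) (metis pos1 less_irrefl)
      have "(G r has_integral integral {\<beta>..2*pi - \<beta>} (G r)) {\<beta>..2*pi - \<beta>}"
        unfolding G_def using a
        by (intro integrable_integral integrable_continuous_real continuous_intros continuous_on_disc_poisson z continuous_on_subset[OF cHr sub]) auto
      hence "((\<lambda>\<theta>. if \<theta> \<in> {\<beta>..2*pi - \<beta>} then G r \<theta> else 0) has_integral integral {\<beta>..2*pi - \<beta>} (G r)) {0..2*pi}"
        by (subst has_integral_restrict[OF sub])
      thus "((\<lambda>\<theta>. (if \<theta> \<in> {\<beta>..2*pi - \<beta>} then G r \<theta> else 0) + S * ?L \<theta>) has_integral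
        integral {\<beta>..2*pi - \<beta>} (G r) + S * integral {0..2*pi} ?L) {0..2*pi}"
        by (intro has_integral_add has_integral_mult_right integrable_integral integrable_continuous_real cL)
      fix \<theta> assume th: "\<theta> \<in> {0..2*pi}"
      let ?h = "cmod (H (of_real r * cis \<theta>))"
      have L0: "?L \<theta> \<ge> 0" by simp
      show "?F \<theta> \<le> (if \<theta> \<in> {\<beta>..2*pi - \<beta>} then G r \<theta> else 0) + S * ?L \<theta>"
      proof (cases "\<theta> \<in> {\<beta>..2*pi - \<beta>}")
        case True
        \<comment> \<open>Concavity of the logarithm: the graph lies below its tangent at \<open>a\<close>.\<close>
        have "ln ((\<eta> + ?h) / a) \<le> (\<eta> + ?h) / a - 1"
          using pos a by (intro ln_le_minus_one) auto
        hence "ln (\<eta> + ?h) \<le> ln a - 1 + (\<eta> + ?h) / a"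
          using ln_divide_pos[OF pos[of "H (of_real r * cis \<theta>)"] a] by simp
        hence "?F \<theta> \<le> G r \<theta>" unfolding G_def using disc_poisson_nonneg[OF z] by (intro mult_left_mono) auto
        moreover have "0 \<le> S * ?L \<theta>" using L0 S(2) by simp
        ultimately show ?thesis using True by (simp only: if_True)
      next
        case False
        have "ln (\<eta> + ?h) \<le> ?L \<theta>" using \<eta> pos by (subst ln_le_cancel_iff) (auto intro: pos1)
        hence "?F \<theta> \<le> disc_poisson z \<theta> * ?L \<theta>" using disc_poisson_nonneg[OF z] by (intro mult_left_mono) auto
        also have "\<dots> \<le> S * ?L \<theta>" using S(1)[OF th False] L0 by (rule mult_right_mono)
        finally show ?thesis using False by (simp only: if_False add_0)
      qed
    qed
    also have "S * integral {0..2*pi} ?L \<le> S * (2 * pi * C)"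
      using C[OF r(1,2)] S(2) by (rule mult_left_mono)
    finally show "D r \<le> S * (2 * pi * C)" unfolding D_def by simp
  qed
  thus ?thesis unfolding D_def G_def by simp
qed

section \<open>Transfer to the upper half-plane\<close>

definition hp_poisson :: "complex \<Rightarrow> real \<Rightarrow> real" where
  "hp_poisson w t = Im w / (pi * (cmod (of_real t - w))\<^sup>2)"

lemma cmod_plus_i_diff: "(cmod (w + \<i>))\<^sup>2 - (cmod (w - \<i>))\<^sup>2 = 4 * Im w"
  unfolding cmod_power2 by (simp add: power2_eq_square algebra_simps)

lemma real_neq_upper: "Im w > 0 \<Longrightarrow> of_real t \<noteq> w"
  by auto

lemma plus_i_nonzero: "Im w \<ge> 0 \<Longrightarrow> w + \<i> \<noteq> 0"
  by (auto simp: complex_eq_iff)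

lemma cayley_inverse_in_disc:
  assumes "Im w > 0" shows "cmod ((w - \<i>) / (w + \<i>)) < 1"
proof -
  have "(cmod (w - \<i>))\<^sup>2 < (cmod (w + \<i>))\<^sup>2" using cmod_plus_i_diff[of w] assms by simp
  hence "cmod (w - \<i>) < cmod (w + \<i>)" using power_less_imp_less_base by (metis norm_ge_zero)
  thus ?thesis using plus_i_nonzero[of w] assms by (simp add: norm_divide)
qed

lemma one_minus_cayley_inverse: "Im w \<ge> 0 \<Longrightarrow> 1 - (w - \<i>) / (w + \<i>) = 2 * \<i> / (w + \<i>)"
  using plus_i_nonzero[of w] by (simp add: field_simps)

lemma cayley_cayley_inverse:
  assumes "Im w \<ge> 0"
  shows "\<i> * (1 + (w - \<i>) / (w + \<i>)) / (1 - (w - \<i>) / (w + \<i>)) = w"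
proof -
  have "1 + (w - \<i>) / (w + \<i>) = 2 * w / (w + \<i>)"
    using plus_i_nonzero[OF assms] by (simp add: field_simps)
  thus ?thesis unfolding one_minus_cayley_inverse[OF assms] using plus_i_nonzero[OF assms] by simp
qed

lemma Im_cayley:
  assumes "z \<noteq> 1"
  shows "Im (\<i> * (1 + z) / (1 - z)) = (1 - (cmod z)\<^sup>2) / (cmod (1 - z))\<^sup>2"
proof -
  have "\<i> * (1 + z) / (1 - z) = \<i> * (1 + z) * cnj (1 - z) / of_real ((cmod (1 - z))\<^sup>2)"
    using assms unfolding complex_norm_square by simp
  hence "Im (\<i> * (1 + z) / (1 - z)) = Im (\<i> * (1 + z) * cnj (1 - z)) / (cmod (1 - z))\<^sup>2"
    by (simp only: Im_divide_of_real)
  also have "Im (\<i> * (1 + z) * cnj (1 - z)) = 1 - (cmod z)\<^sup>2"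
    unfolding cmod_power2 by (simp add: power2_eq_square algebra_simps)
  finally show ?thesis .
qed

lemma cis_two_arctan: "cis (pi + 2 * arctan t) = (of_real t - \<i>) / (of_real t + \<i>)"
proof -
  let ?s = "sqrt (1 + t\<^sup>2)"
  have s: "?s \<noteq> 0" "?s * ?s = 1 + t\<^sup>2" by (auto simp: add_nonneg_eq_0_iff)
  have c: "cis (arctan t) = (1 + \<i> * of_real t) / of_real ?s"
    by (simp add: complex_eq_iff cos_arctan sin_arctan)
  have "cis (pi + 2 * arctan t) = cis pi * (cis (arctan t) * cis (arctan t))"
    by (simp only: cis_mult mult_2)
  hence "cis (pi + 2 * arctan t) = - (cis (arctan t) * cis (arctan t))" by simp
  also have "\<dots> = - ((1 + \<i> * of_real t) * (1 + \<i> * of_real t) / of_real (1 + t\<^sup>2))"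
    unfolding c by (simp only: times_divide_times_eq of_real_mult[symmetric] s(2))
  also have "of_real (1 + t\<^sup>2) = (1 + \<i> * of_real t) * (1 - \<i> * of_real t)"
    by (simp add: algebra_simps power2_eq_square)
  also have "- ((1 + \<i> * of_real t) * (1 + \<i> * of_real t) / \<dots>) = (of_real t - \<i>) / (of_real t + \<i>)"
  proof -
    have "1 + \<i> * of_real t \<noteq> 0" "1 - \<i> * of_real t \<noteq> 0" "of_real t + \<i> \<noteq> 0" by (auto simp: complex_eq_iff)
    thus ?thesis by (simp add: divide_simps) (simp add: algebra_simps)
  qed
  finally show ?thesis .
qed

text \<open>Under the Cayley map the point \<open>t\<close> of the line corresponds to the angle \<open>\<pi> + 2 arctan t\<close> of the
circle and infinity to the angle 0. The second identity explains the exponential factor in the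
majorants below: a point mass at infinity has the harmonic extension \<open>Im w\<close>.\<close>

lemma disc_poisson_cayley:
  assumes w: "Im w > 0"
  shows "2 / (1 + t\<^sup>2) * disc_poisson ((w - \<i>) / (w + \<i>)) (pi + 2 * arctan t) = 2 * pi * hp_poisson w t"
    and "disc_poisson ((w - \<i>) / (w + \<i>)) 0 = Im w"
proof -
  let ?z = "(w - \<i>) / (w + \<i>)"
  have n: "w + \<i> \<noteq> 0" using w plus_i_nonzero by simp
  have nt: "of_real t + \<i> \<noteq> 0" by (simp add: complex_eq_iff)
  have num: "1 - (cmod ?z)\<^sup>2 = 4 * Im w / (cmod (w + \<i>))\<^sup>2"
  proof -
    have "(cmod (w + \<i>))\<^sup>2 \<noteq> 0" using n by simp
    hence "1 - (cmod ?z)\<^sup>2 = ((cmod (w + \<i>))\<^sup>2 - (cmod (w - \<i>))\<^sup>2) / (cmod (w + \<i>))\<^sup>2"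
      unfolding norm_divide power_divide by (simp add: diff_divide_distrib)
    thus ?thesis unfolding cmod_plus_i_diff .
  qed
  have "cis (pi + 2 * arctan t) - ?z = 2 * \<i> * (of_real t - w) / ((of_real t + \<i>) * (w + \<i>))"
    unfolding cis_two_arctan using n nt by (simp add: field_simps)
  hence "(cmod (cis (pi + 2 * arctan t) - ?z))\<^sup>2 = 4 * (cmod (of_real t - w))\<^sup>2 / ((cmod (of_real t + \<i>))\<^sup>2 * (cmod (w + \<i>))\<^sup>2)"
    by (simp add: norm_divide norm_mult power_divide power_mult_distrib)
  moreover have "(cmod (of_real t + \<i>))\<^sup>2 = 1 + t\<^sup>2" by (simp add: cmod_power2)
  ultimately have den: "(cmod (cis (pi + 2 * arctan t) - ?z))\<^sup>2 = 4 * (cmod (of_real t - w))\<^sup>2 / ((1 + t\<^sup>2) * (cmod (w + \<i>))\<^sup>2)"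
    by simp
  have "1 + t\<^sup>2 \<noteq> 0" by (simp add: add_nonneg_eq_0_iff)
  moreover have "2 / A * ((4 * y / W) / (4 * D / (A * W))) = 2 * pi * (y / (pi * D))"
    if "A \<noteq> 0" "W \<noteq> 0" "D \<noteq> 0" for A W D y :: real
    using that by simp
  ultimately show "2 / (1 + t\<^sup>2) * disc_poisson ?z (pi + 2 * arctan t) = 2 * pi * hp_poisson w t"
    unfolding disc_poisson_def hp_poisson_def num den using n real_neq_upper[OF w, of t]
    by simp
  have "(cmod (1 - ?z))\<^sup>2 = 4 / (cmod (w + \<i>))\<^sup>2"
    using one_minus_cayley_inverse[of w] w by (simp add: norm_divide norm_mult power_divide)
  thus "disc_poisson ?z 0 = Im w" unfolding disc_poisson_def num using n by simp
qed

lemma integral_disc_to_half_plane: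
  assumes w: "Im w > 0" and T: "T > 0" and f: "continuous_on {pi - 2 * arctan T..pi + 2 * arctan T} f"
  shows "integral {pi - 2 * arctan T..pi + 2 * arctan T} (\<lambda>\<theta>. disc_poisson ((w - \<i>) / (w + \<i>)) \<theta> * f \<theta>) =
     2 * pi * integral {-T..T} (\<lambda>t. hp_poisson w t * f (pi + 2 * arctan t))"
proof -
  let ?z = "(w - \<i>) / (w + \<i>)"
  have "((\<lambda>t. (2 / (1 + t\<^sup>2)) *\<^sub>R (disc_poisson ?z (pi + 2 * arctan t) * f (pi + 2 * arctan t))) has_integral
     integral {pi + 2 * arctan (-T)..pi + 2 * arctan T} (\<lambda>\<theta>. disc_poisson ?z \<theta> * f \<theta>)) {-T..T}"
  proof (rule has_integral_substitution[where c = "pi - 2 * arctan T" and d = "pi + 2 * arctan T"])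
    show "continuous_on {pi - 2 * arctan T..pi + 2 * arctan T} (\<lambda>\<theta>. disc_poisson ?z \<theta> * f \<theta>)"
      by (intro continuous_intros continuous_on_disc_poisson cayley_inverse_in_disc w f)
    show "(\<lambda>t. pi + 2 * arctan t) ` {-T..T} \<subseteq> {pi - 2 * arctan T..pi + 2 * arctan T}"
      using arctan_le_iff[of "-T"] arctan_le_iff[of _ T] by (auto simp: arctan_minus)
    show "((\<lambda>t. pi + 2 * arctan t) has_real_derivative 2 / (1 + x\<^sup>2)) (at x within {-T..T})" for x
      by (auto intro!: derivative_eq_intros simp: divide_inverse)
    show "pi + 2 * arctan (- T) \<le> pi + 2 * arctan T"
      using T by (simp add: arctan_le_iff)
  qed (use T in auto)
  moreover have "(2 / (1 + t\<^sup>2)) *\<^sub>R (disc_poisson ?z (pi + 2 * arctan t) * f (pi + 2 * arctan t))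
     = 2 * pi * (hp_poisson w t * f (pi + 2 * arctan t))" for t
    using disc_poisson_cayley(1)[OF w, of t] by (simp only: real_scaleR_def mult.assoc[symmetric])
  ultimately have "((\<lambda>t. 2 * pi * (hp_poisson w t * f (pi + 2 * arctan t))) has_integral
     integral {pi - 2 * arctan T..pi + 2 * arctan T} (\<lambda>\<theta>. disc_poisson ?z \<theta> * f \<theta>)) {-T..T}"
    by (simp add: arctan_minus)
  from integral_unique[OF this] show ?thesis by simp
qed

lemma hp_poisson_nonneg: "Im w > 0 \<Longrightarrow> 0 \<le> hp_poisson w t"
  by (simp add: hp_poisson_def)

lemma continuous_on_hp_poisson: "Im w > 0 \<Longrightarrow> continuous_on A (hp_poisson w)"
  unfolding hp_poisson_def [abs_def] by (intro continuous_intros) (auto simp: real_neq_upper)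

lemma hp_poisson_antiderivative:
  assumes w: "Im w > 0"
  shows "((\<lambda>t. arctan ((t - Re w) / Im w) / pi) has_real_derivative hp_poisson w t) (at t)"
proof -
  have p: "(t - Re w)\<^sup>2 + (Im w)\<^sup>2 > 0" using w by (simp add: add_nonneg_pos)
  have eq: "(cmod (of_real t - w))\<^sup>2 = (t - Re w)\<^sup>2 + (Im w)\<^sup>2" by (simp add: cmod_power2)
  have "1 + ((t - Re w) / Im w)\<^sup>2 = ((t - Re w)\<^sup>2 + (Im w)\<^sup>2) / (Im w)\<^sup>2"
    using w by (simp add: power_divide add_divide_distrib)
  hence "inverse (1 + ((t - Re w) / Im w)\<^sup>2) * (1 / Im w) / pi = hp_poisson w t"
    unfolding hp_poisson_def eq using w p by (simp add: power2_eq_square)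
  moreover have "((\<lambda>t. arctan ((t - Re w) / Im w) / pi) has_real_derivative inverse (1 + ((t - Re w) / Im w)\<^sup>2) * (1 / Im w) / pi) (at t)"
    by (rule DERIV_cdivide, rule DERIV_chain2[OF DERIV_arctan]) (use w in \<open>auto intro!: derivative_eq_intros\<close>)
  ultimately show ?thesis by simp
qed

lemma hp_poisson_has_integral:
  assumes w: "Im w > 0" and ab: "a \<le> b"
  shows "(hp_poisson w has_integral (arctan ((b - Re w) / Im w) - arctan ((a - Re w) / Im w)) / pi) {a..b}"
proof -
  have "((\<lambda>t. arctan ((t - Re w) / Im w) / pi) has_real_derivative hp_poisson w t) (at t within {a..b})" for t
    by (rule has_field_derivative_at_within[OF hp_poisson_antiderivative[OF w]])
  hence "(hp_poisson w has_integral (arctan ((b - Re w) / Im w) / pi - arctan ((a - Re w) / Im w) / pi)) {a..b}"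
    using ab by (intro fundamental_theorem_of_calculus) (auto simp: has_real_derivative_iff_has_vector_derivative)
  thus ?thesis by (simp add: diff_divide_distrib)
qed

lemma integral_hp_poisson_bounds:
  assumes w: "Im w > 0" and T: "T > 0"
  shows "integral {-T..T} (hp_poisson w) \<le> 1"
proof -
  have "integral {-T..T} (hp_poisson w) = (arctan ((T - Re w) / Im w) - arctan ((-T - Re w) / Im w)) / pi"
    using hp_poisson_has_integral[OF w, of "-T" T] T by (intro integral_unique) auto
  moreover have "arctan ((T - Re w) / Im w) < pi/2" "- (pi/2) < arctan ((-T - Re w) / Im w)"
    by (rule arctan_ubound, rule arctan_lbound)
  ultimately show ?thesis by simp
qed

lemma integral_hp_poisson_tendsto:
  assumes w: "Im w > 0"
  shows "((\<lambda>T. integral {-T..T} (hp_poisson w)) \<longlongrightarrow> 1) at_top"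
proof -
  have "filterlim (\<lambda>T. (T - Re w) / Im w) at_top at_top" "filterlim (\<lambda>T. (-T - Re w) / Im w) at_bot at_top"
    using w by real_asymp+
  hence "((\<lambda>T. (arctan ((T - Re w) / Im w) - arctan ((-T - Re w) / Im w)) / pi) \<longlongrightarrow> (pi/2 - (-(pi/2))) / pi) at_top"
    by (intro tendsto_intros filterlim_compose[OF tendsto_arctan_at_top] filterlim_compose[OF tendsto_arctan_at_bot]) auto
  moreover have "eventually (\<lambda>T. (arctan ((T - Re w) / Im w) - arctan ((-T - Re w) / Im w)) / pi = integral {-T..T} (hp_poisson w)) at_top"
    using eventually_gt_at_top[of 0]
    by eventually_elim (rule integral_unique[symmetric], rule hp_poisson_has_integral[OF w], simp)
  ultimately show ?thesis by (subst (asm) tendsto_cong) auto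
qed

text \<open>A function of bounded type that is continuous up to the line is dominated by the Poisson integral
of its modulus, up to the factor \<open>exp (C Im w)\<close>: in the disc only the point 1, which represents
infinity, can carry singular mass, and the total mass is bounded because the function is a quotient
of bounded functions. \<open>B\<close> stands for any bound of the possibly divergent Poisson integral.\<close>

lemma poisson_majorant_bounded_type:
  assumes cont: "continuous_on {z. Im z \<ge> 0} h" and bt: "bounded_type h"
  obtains C where "C \<ge> 0"
    "\<And>w B. Im w > 0 \<Longrightarrow> (\<And>T. T > 0 \<Longrightarrow> integral {-T..T} (\<lambda>t. hp_poisson w t * cmod (h (of_real t))) \<le> B) \<Longrightarrow>
       cmod (h w) \<le> B * exp (C * Im w)"
proof -
  define cay where "cay = (\<lambda>z. \<i> * (1 + z) / (1 - z) :: complex)"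
  from bt obtain g k w1 where hol: "h holomorphic_on upper_half_plane" "g holomorphic_on upper_half_plane" "k holomorphic_on upper_half_plane"
    and bd: "bounded (g ` upper_half_plane)" "bounded (k ` upper_half_plane)"
    and w1: "w1 \<in> upper_half_plane" "k w1 \<noteq> 0"
    and q: "\<And>z. z \<in> upper_half_plane \<Longrightarrow> k z \<noteq> 0 \<Longrightarrow> h z = g z / k z"
    unfolding bounded_type_def by metis
  obtain Mg Mk where Mg: "\<And>z. z \<in> upper_half_plane \<Longrightarrow> cmod (g z) \<le> Mg" and Mk: "\<And>z. z \<in> upper_half_plane \<Longrightarrow> cmod (k z) \<le> Mk"
    using bd unfolding bounded_iff by auto
  \<comment> \<open>Dividing numerator and denominator by \<open>M\<close> makes both bounded by 1 without changing their quotient.\<close>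
  define M where "M = max (max Mg Mk) 1"
  have M: "M > 0" "Mg \<le> M" "Mk \<le> M" by (auto simp: M_def)
  have uhp: "cay z \<in> upper_half_plane" if "cmod z < 1" for z
  proof -
    have "z \<noteq> 1" using that by auto
    thus ?thesis unfolding upper_half_plane_def cay_def using that Im_cayley[of z]
      by (auto intro!: divide_pos_pos simp: power_less_one_iff abs_square_less_1)
  qed
  have caycl: "Im (cay z) \<ge> 0" if "cmod z \<le> 1" "z \<noteq> 1" for z
    unfolding cay_def Im_cayley[OF that(2)] using that by (auto intro!: divide_nonneg_nonneg simp: power_le_one)
  have holcay: "cay holomorphic_on ball 0 1" unfolding cay_def by (intro holomorphic_intros) auto
  have contcay: "continuous_on (cball 0 1 - {1}) cay" unfolding cay_def by (intro continuous_intros) auto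
  have caysub: "cay ` ball 0 1 \<subseteq> upper_half_plane" using uhp by auto
  have holc: "(\<lambda>z. f (cay z)) holomorphic_on ball 0 1" if "f holomorphic_on upper_half_plane" for f
    by (rule holomorphic_on_compose_gen[OF holcay that caysub, unfolded o_def])
  define H where "H = (\<lambda>z. h (cay z))"
  define K where "K = (\<lambda>z. k (cay z) / of_real M)"
  have H: "H holomorphic_on ball 0 1" unfolding H_def by (rule holc[OF hol(1)])
  have K: "K holomorphic_on ball 0 1" unfolding K_def using M by (intro holomorphic_intros holc hol(3)) auto
  have Hc: "continuous_on (cball 0 1 - {1}) H" unfolding H_def
    by (rule continuous_on_compose2[OF cont contcay]) (use caycl in auto)
  have K1: "cmod (K z) \<le> 1" if "cmod z < 1" for z
    unfolding K_def using Mk[OF uhp[OF that]] M by (simp add: norm_divide)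
  have HK: "cmod (H z * K z) \<le> 1" if "cmod z < 1" for z
  proof (cases "k (cay z) = 0")
    case False
    hence "H z * K z = g (cay z) / of_real M" unfolding H_def K_def using q[OF uhp[OF that] False] by simp
    thus ?thesis using Mg[OF uhp[OF that]] M by (simp add: norm_divide)
  qed (simp add: K_def)
  have w1': "Im w1 > 0" using w1 by (simp add: upper_half_plane_def)
  have z1: "cmod ((w1 - \<i>) / (w1 + \<i>)) < 1" "K ((w1 - \<i>) / (w1 + \<i>)) \<noteq> 0"
    using cayley_inverse_in_disc[OF w1'] cayley_cayley_inverse[of w1] w1' w1(2) M unfolding K_def cay_def by auto
  obtain C r0 where C: "C \<ge> 0" "0 \<le> r0" "r0 < 1"
    "\<And>r. r0 < r \<Longrightarrow> r < 1 \<Longrightarrow> integral {0..2*pi} (\<lambda>\<theta>. ln (1 + cmod (H (of_real r * cis \<theta>)))) \<le> 2 * pi * C"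
    using log_mass_bound_disc[OF H K K1 HK z1] by metis
  show thesis
  proof (rule that[OF C(1)])
    fix w B assume w: "Im w > 0"
      and B: "\<And>T. T > 0 \<Longrightarrow> integral {-T..T} (\<lambda>t. hp_poisson w t * cmod (h (of_real t))) \<le> B"
    let ?z = "(w - \<i>) / (w + \<i>)"
    have z: "cmod ?z < 1" by (rule cayley_inverse_in_disc[OF w])
    have Hz: "H ?z = h w" unfolding H_def cay_def using cayley_cayley_inverse[of w] w by simp
    have Hcis: "H (cis (pi + 2 * arctan t)) = h (of_real t)" for t
      unfolding H_def cay_def cis_two_arctan using cayley_cayley_inverse[of "of_real t"] by simp
    have ch: "continuous_on A (\<lambda>t. h (of_real t))" for A :: "real set"
      by (rule continuous_on_compose2[OF cont]) (auto intro!: continuous_intros)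
    have pI: "(\<lambda>t. hp_poisson w t * cmod (h (of_real t))) integrable_on {-T..T}" for T
      by (intro integrable_continuous_real continuous_intros continuous_on_hp_poisson w ch)
    have B0: "B \<ge> 0"
      using B[of 1] integral_nonneg[OF pI[of 1]] hp_poisson_nonneg[OF w] by fastforce
    \<comment> \<open>With \<open>a = \<eta> + B\<close> the tangent line in \<open>log_majorant_disc\<close> integrates to at most \<open>ln a\<close>.\<close>
    have main: "ln (\<eta> + cmod (h w)) \<le> ln (\<eta> + B) + (Im w + e) * C" if \<eta>: "0 < \<eta>" "\<eta> \<le> 1" and e: "e > 0" for \<eta> e
    proof -
      define a where "a = \<eta> + B"
      have a: "a > 0" using \<eta> B0 by (simp add: a_def)
      have "continuous_on UNIV (disc_poisson ?z)" by (rule continuous_on_disc_poisson[OF z])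
      hence "isCont (disc_poisson ?z) 0" by (simp add: continuous_on_eq_continuous_at)
      then obtain d where d: "d > 0" "\<And>\<theta>. \<bar>\<theta>\<bar> < d \<Longrightarrow> \<bar>disc_poisson ?z \<theta> - Im w\<bar> < e"
        unfolding continuous_at_eps_delta using e disc_poisson_cayley(2)[OF w]
        by (auto simp: dist_real_def)
      have lim0: "((\<lambda>T. pi - 2 * arctan T) \<longlongrightarrow> pi - 2 * (pi/2)) at_top"
        by (intro tendsto_intros tendsto_arctan_at_top)
      have ev: "eventually (\<lambda>T. ln (\<eta> + cmod (h w)) \<le> (ln a - 1) * integral {-T..T} (hp_poisson w) + 1 + (Im w + e) * C) at_top"
      proof -
        have "eventually (\<lambda>T. pi - 2 * arctan T < d) at_top"
          using order_tendstoD(2)[OF lim0, of d] d by simp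
        thus ?thesis using eventually_gt_at_top[of 0]
        proof eventually_elim
          case (elim T)
          define \<beta> where "\<beta> = pi - 2 * arctan T"
          have \<beta>: "0 < \<beta>" "\<beta> < pi" "\<beta> < d" using elim arctan_ubound[of T] unfolding \<beta>_def by auto
          have b2: "2 * pi - \<beta> = pi + 2 * arctan T" unfolding \<beta>_def by simp
          have S: "disc_poisson ?z \<theta> \<le> Im w + e" if "\<theta> \<in> {0..2*pi}" "\<theta> \<notin> {\<beta>..2*pi - \<beta>}" for \<theta>
          proof (cases "\<theta> < \<beta>")
            case True
            thus ?thesis using d(2)[of \<theta>] that \<beta> by (simp add: abs_if split: if_splits)
          next
            case False
            hence "\<bar>\<theta> - 2 * pi\<bar> < d" using that \<beta> by auto
            moreover have "disc_poisson ?z (\<theta> - 2 * pi) = disc_poisson ?z \<theta>"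
              unfolding disc_poisson_def by (simp add: cis_divide[symmetric])
            ultimately show ?thesis using d(2)[of "\<theta> - 2 * pi"] by (simp add: abs_if split: if_splits)
          qed
          have cH: "continuous_on {pi - 2 * arctan T..pi + 2 * arctan T} (\<lambda>\<theta>. H (cis \<theta>))"
          proof (rule continuous_on_compose2[OF Hc])
            show "continuous_on {pi - 2 * arctan T..pi + 2 * arctan T} cis" by (intro continuous_intros)
            show "cis ` {pi - 2 * arctan T..pi + 2 * arctan T} \<subseteq> cball 0 1 - {1}"
            proof safe
              fix \<theta> assume th: "\<theta> \<in> {pi - 2 * arctan T..pi + 2 * arctan T}" "cis \<theta> = 1"
              hence "cos \<theta> = 1" by (simp add: complex_eq_iff)
              then obtain n :: int where "\<theta> = of_int n * (2 * pi)" by (auto simp: cos_one_2pi_int)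
              moreover have "0 < \<theta>" "\<theta> < 2 * pi" using th \<beta> unfolding \<beta>_def by auto
              ultimately have "0 < n" "n < 1" by (auto simp: zero_less_mult_iff)
              thus False by simp
            qed auto
          qed
          let ?f = "\<lambda>\<theta>. ln a - 1 + (\<eta> + cmod (H (cis \<theta>))) / a"
          have "2 * pi * ln (\<eta> + cmod (H ?z)) \<le>
             integral {\<beta>..2*pi - \<beta>} (\<lambda>\<theta>. disc_poisson ?z \<theta> * ?f \<theta>) + (Im w + e) * (2 * pi * C)"
            by (rule log_majorant_disc[OF H Hc C(4) C(2,3) z \<eta> a \<beta>(1,2) S]) (use w e in auto)
          also have "integral {\<beta>..2*pi - \<beta>} (\<lambda>\<theta>. disc_poisson ?z \<theta> * ?f \<theta>)
             = 2 * pi * integral {-T..T} (\<lambda>t. hp_poisson w t * ?f (pi + 2 * arctan t))"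
            unfolding b2 unfolding \<beta>_def
            by (rule integral_disc_to_half_plane[OF w elim(2)]) (use a in \<open>auto intro!: continuous_intros cH\<close>)
          finally have "2 * pi * ln (\<eta> + cmod (h w)) \<le> 2 * pi * (integral {-T..T} (\<lambda>t. hp_poisson w t * ?f (pi + 2 * arctan t)) + (Im w + e) * C)"
            unfolding Hz by (simp add: algebra_simps)
          hence 1: "ln (\<eta> + cmod (h w)) \<le> integral {-T..T} (\<lambda>t. hp_poisson w t * ?f (pi + 2 * arctan t)) + (Im w + e) * C"
            by simp
          let ?om = "integral {-T..T} (hp_poisson w)"
          let ?b = "integral {-T..T} (\<lambda>t. hp_poisson w t * cmod (h (of_real t)))"
          have hpI: "hp_poisson w integrable_on {-T..T}"
            by (intro integrable_continuous_real continuous_on_hp_poisson w)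
          have "((\<lambda>t. hp_poisson w t * (ln a - 1 + \<eta> / a) + hp_poisson w t * cmod (h (of_real t)) / a) has_integral
             ?om * (ln a - 1 + \<eta> / a) + ?b / a) {-T..T}"
            by (intro has_integral_add has_integral_mult_left has_integral_divide integrable_integral hpI pI)
          hence "integral {-T..T} (\<lambda>t. hp_poisson w t * ?f (pi + 2 * arctan t)) = ?om * (ln a - 1 + \<eta> / a) + ?b / a"
            unfolding Hcis by (intro integral_unique) (simp add: algebra_simps add_divide_distrib)
          also have "\<dots> = (ln a - 1) * ?om + (\<eta> * ?om + ?b) / a" by (simp add: algebra_simps add_divide_distrib)
          also have "(\<eta> * ?om + ?b) / a \<le> 1"
          proof -
            have "\<eta> * ?om \<le> \<eta> * 1" using integral_hp_poisson_bounds[OF w elim(2)] \<eta> by (intro mult_left_mono) auto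
            thus ?thesis using B[OF elim(2)] a unfolding a_def by simp
          qed
          finally show ?case using 1 by linarith
        qed
      qed
      have "((\<lambda>T. (ln a - 1) * integral {-T..T} (hp_poisson w) + 1 + (Im w + e) * C) \<longlongrightarrow> (ln a - 1) * 1 + 1 + (Im w + e) * C) at_top"
        by (intro tendsto_intros integral_hp_poisson_tendsto w)
      from tendsto_lowerbound[OF this ev] show ?thesis by (simp add: a_def)
    qed
    have main2: "\<eta> + cmod (h w) \<le> (\<eta> + B) * exp ((Im w + \<eta>) * C)" if "0 < \<eta>" "\<eta> \<le> 1" for \<eta>
    proof -
      have p: "\<eta> + cmod (h w) > 0" "\<eta> + B > 0" using that B0 norm_ge_zero[of "h w"] by linarith+
      have "exp (ln (\<eta> + cmod (h w))) \<le> exp (ln (\<eta> + B) + (Im w + \<eta>) * C)" using main[OF that that(1)] by simp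
      thus ?thesis using p by (simp add: exp_add)
    qed
    have "eventually (\<lambda>\<eta>. \<eta> + cmod (h w) \<le> (\<eta> + B) * exp ((Im w + \<eta>) * C)) (at_right 0)"
      unfolding eventually_at_right[OF zero_less_one] using main2 by (intro exI[of _ 1]) auto
    moreover have "((\<lambda>\<eta>. (\<eta> + B) * exp ((Im w + \<eta>) * C)) \<longlongrightarrow> (0 + B) * exp ((Im w + 0) * C)) (at_right 0)"
      by (intro tendsto_intros)
    moreover have "((\<lambda>\<eta>. \<eta> + cmod (h w)) \<longlongrightarrow> 0 + cmod (h w)) (at_right 0)" by (intro tendsto_intros)
    ultimately have "0 + cmod (h w) \<le> (0 + B) * exp ((Im w + 0) * C)"
      by (intro tendsto_le[of "at_right 0"]) auto
    thus "cmod (h w) \<le> B * exp (C * Im w)" by (simp add: mult.commute)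
  qed
qed

section \<open>Phragmen-Lindelof principles\<close>

text \<open>For functions continuous up to the real line this is the Smirnov class of the half-plane: the growth
condition along the imaginary axis says that the mean type is nonpositive, and it excludes factors
such as \<open>exp (-\<i> a z)\<close> with \<open>a > 0\<close>.\<close>

definition smirnov :: "(complex \<Rightarrow> complex) \<Rightarrow> bool" where
  "smirnov h \<longleftrightarrow> continuous_on {z. Im z \<ge> 0} h \<and> bounded_type h \<and>
     (\<forall>e>0. eventually (\<lambda>y. cmod (h (\<i> * complex_of_real y)) \<le> exp (e * y)) at_top)"

lemma maximum_modulus_at_infinity:
  assumes S: "open S" and f: "f holomorphic_on S" "continuous_on (closure S) f"
    and fr: "\<And>z. z \<in> frontier S \<Longrightarrow> cmod (f z) \<le> M"
    and inf: "\<And>z. z \<in> closure S \<Longrightarrow> R \<le> cmod z \<Longrightarrow> cmod (f z) \<le> M"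
    and z: "z \<in> S"
  shows "cmod (f z) \<le> M"
proof -
  define r where "r = max R (cmod z + 1)"
  show ?thesis
  proof (rule maximum_modulus_frontier[of f "S \<inter> ball 0 r"])
    show "f holomorphic_on interior (S \<inter> ball 0 r)"
      using interior_subset by (intro holomorphic_on_subset[OF f(1)]) blast
    show "continuous_on (closure (S \<inter> ball 0 r)) f"
      by (intro continuous_on_subset[OF f(2)] closure_mono) auto
    show "bounded (S \<inter> ball 0 r)" by (simp add: bounded_Int)
    show "z \<in> S \<inter> ball 0 r" using z by (simp add: r_def)
    fix u assume u: "u \<in> frontier (S \<inter> ball 0 r)"
    have "u \<in> closure S" using u closure_mono[of "S \<inter> ball 0 r" S] by (auto simp: frontier_def)
    moreover have "u \<in> frontier S \<or> u \<in> frontier (ball 0 r)" using u frontier_Int_subset by blast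
    moreover have "r > 0" unfolding r_def using norm_ge_zero[of z] by linarith
    ultimately show "cmod (f u) \<le> M" using fr inf by (auto simp: r_def)
  qed
qed

abbreviation quadrant :: "complex set" where "quadrant \<equiv> {z. Re z > 0 \<and> Im z > 0}"

lemma closure_quadrant_subset: "closure quadrant \<subseteq> {z. Re z \<ge> 0 \<and> Im z \<ge> 0}"
proof (rule closure_minimal)
  show "closed {z. Re z \<ge> 0 \<and> Im z \<ge> 0}"
    by (intro closed_Collect_conj closed_Collect_le continuous_intros)
qed auto

lemma open_quadrant: "open quadrant"
  by (intro open_Collect_conj open_Collect_less continuous_intros)

text \<open>In a sector of opening \<open>\<pi>/2\<close> around the positive axis the function \<open>\<zeta> powr (3/2)\<close> has a real part
comparable to \<open>|\<zeta>| powr (3/2)\<close>. It outgrows every linear function and thus serves as the comparison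
function for functions of exponential type in a quadrant.\<close>

lemma csqrt_cubed_sector:
  assumes "\<bar>Im \<zeta>\<bar> \<le> Re \<zeta>"
  shows "Re (csqrt \<zeta>) ^ 3 / 4 \<le> Re (csqrt \<zeta> ^ 3)" "cmod \<zeta> \<le> 2 * (Re (csqrt \<zeta>))\<^sup>2"
proof -
  define a b where "a = Re (csqrt \<zeta>)" and "b = \<bar>Im (csqrt \<zeta>)\<bar>"
  have a0: "a \<ge> 0" unfolding a_def using csqrt_principal[of \<zeta>] by linarith
  have b0: "b \<ge> 0" by (simp add: b_def)
  have sq: "\<zeta> = (csqrt \<zeta>)\<^sup>2" by simp
  have re: "Re \<zeta> = a\<^sup>2 - b\<^sup>2" by (subst sq) (simp add: a_def b_def power2_eq_square del: power2_csqrt)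
  have im: "\<bar>Im \<zeta>\<bar> = 2 * a * b" using a0 unfolding a_def b_def by (subst sq) (simp add: power2_eq_square abs_mult del: power2_csqrt)
  have c: "2 * a * b + b\<^sup>2 \<le> a\<^sup>2" using assms unfolding re im by simp
  have "b \<le> a"
  proof (rule power2_le_imp_le[OF _ a0])
    have "0 \<le> 2 * a * b" using a0 b0 by simp
    thus "b\<^sup>2 \<le> a\<^sup>2" using c by linarith
  qed
  hence "b * b \<le> a * b" using b0 by (rule mult_right_mono)
  hence c2: "3 * b\<^sup>2 \<le> a\<^sup>2" using c by (simp add: power2_eq_square)
  have "(3/2) * b \<le> a"
  proof (rule power2_le_imp_le[OF _ a0])
    have "((3/2) * b)\<^sup>2 = 9/4 * b\<^sup>2" by (simp add: power2_eq_square)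
    thus "((3/2) * b)\<^sup>2 \<le> a\<^sup>2" using c2 zero_le_power2[of b] by linarith
  qed
  hence "(3/2) * b * b \<le> a * b" using b0 by (rule mult_right_mono)
  hence c3: "4 * b\<^sup>2 \<le> a\<^sup>2" using c by (simp add: power2_eq_square)
  have "a ^ 3 / 4 \<le> a * (a\<^sup>2 - 3 * b\<^sup>2)"
  proof -
    have "a * (a\<^sup>2 / 4) \<le> a * (a\<^sup>2 - 3 * b\<^sup>2)" using c3 a0 by (intro mult_left_mono) auto
    thus ?thesis by (simp add: power3_eq_cube power2_eq_square)
  qed
  also have "a * (a\<^sup>2 - 3 * b\<^sup>2) = Re (csqrt \<zeta> ^ 3)"
    by (simp add: a_def b_def power3_eq_cube power2_eq_square algebra_simps)
  finally show "Re (csqrt \<zeta>) ^ 3 / 4 \<le> Re (csqrt \<zeta> ^ 3)" unfolding a_def .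
  have "cmod \<zeta> = (cmod (csqrt \<zeta>))\<^sup>2" by (subst sq) (simp add: norm_power del: power2_csqrt)
  also have "\<dots> = a\<^sup>2 + b\<^sup>2" unfolding cmod_power2 a_def b_def power2_abs ..
  also have "\<dots> \<le> 2 * a\<^sup>2" using c3 zero_le_power2[of b] by linarith
  finally show "cmod \<zeta> \<le> 2 * (Re (csqrt \<zeta>))\<^sup>2" unfolding a_def .
qed

text \<open>The map \<open>\<zeta> = (1 - \<i>) z + 1\<close> rotates the quadrant into the sector around the positive axis and keeps it
away from the branch point of the square root. Multiplication by \<open>exp (- \<kappa> \<zeta> powr (3/2))\<close> makes the
function decay, and afterwards \<open>\<kappa>\<close> tends to 0.\<close>

lemma phragmen_lindelof_quadrant:
  assumes f: "f holomorphic_on quadrant" "continuous_on {z. Re z \<ge> 0 \<and> Im z \<ge> 0} f"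
    and gr: "\<And>z. Re z \<ge> 0 \<Longrightarrow> Im z \<ge> 0 \<Longrightarrow> cmod (f z) \<le> A * exp (B * cmod z)"
    and re: "\<And>x. x \<ge> 0 \<Longrightarrow> cmod (f (of_real x)) \<le> M"
    and im: "\<And>y. y \<ge> 0 \<Longrightarrow> cmod (f (\<i> * of_real y)) \<le> M"
    and M: "M > 0" and z: "Re z > 0" "Im z > 0"
  shows "cmod (f z) \<le> M"
proof -
  let ?Q = "{z. Re z \<ge> 0 \<and> Im z \<ge> 0}"
  define A' B' where "A' = max A 1" and "B' = max B 1"
  have A'B': "A' > 0" "B' > 0" by (auto simp: A'_def B'_def)
  have gr': "cmod (f z) \<le> A' * exp (B' * cmod z)" if "z \<in> ?Q" for z
  proof -
    have "cmod (f z) \<le> A * exp (B * cmod z)" using gr that by auto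
    also have "\<dots> \<le> A' * exp (B' * cmod z)"
      by (intro mult_mono) (auto simp: A'_def B'_def intro!: mult_right_mono)
    finally show ?thesis .
  qed
  define \<zeta> where "\<zeta> = (\<lambda>z. (1 - \<i>) * z + 1)"
  define s where "s = (\<lambda>z. csqrt (\<zeta> z))"
  have sec: "\<bar>Im (\<zeta> z)\<bar> \<le> Re (\<zeta> z)" "Re (\<zeta> z) \<ge> 1" "cmod z \<le> cmod (\<zeta> z) + 1" if "z \<in> ?Q" for z
  proof -
    show "\<bar>Im (\<zeta> z)\<bar> \<le> Re (\<zeta> z)" "Re (\<zeta> z) \<ge> 1" using that by (auto simp: \<zeta>_def)
    have "cmod z \<le> cmod ((1 - \<i>) * z)" 
    proof -
      have "1 \<le> cmod (1 - \<i>)" by (simp add: cmod_def)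
      thus ?thesis using mult_right_mono[of 1 "cmod (1 - \<i>)" "cmod z"] by (simp add: norm_mult)
    qed
    also have "\<dots> \<le> cmod (\<zeta> z) + 1" using norm_triangle_ineq4[of "\<zeta> z" 1] by (simp add: \<zeta>_def)
    finally show "cmod z \<le> cmod (\<zeta> z) + 1" .
  qed
  have nn: "\<zeta> z \<notin> \<real>\<^sub>\<le>\<^sub>0" if "z \<in> ?Q" for z
    using sec(2)[OF that] by (auto simp: complex_nonpos_Reals_iff)
  have key: "cmod (f z) * exp (- \<kappa> * Re (s z ^ 3)) \<le> M" if k: "\<kappa> > 0" for \<kappa>
  proof -
    have "eventually (\<lambda>a. A' * exp (B' * (2 * a\<^sup>2 + 1)) * exp (- \<kappa> * (a ^ 3 / 4)) \<le> M) at_top"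
    proof -
      have "((\<lambda>a. A' * exp (B' * (2 * a\<^sup>2 + 1)) * exp (- \<kappa> * (a ^ 3 / 4))) \<longlongrightarrow> 0) at_top"
        using k A'B' by real_asymp
      from order_tendstoD(2)[OF this M] show ?thesis by (rule eventually_mono) auto
    qed
    then obtain a0 where a0: "\<And>a. a \<ge> a0 \<Longrightarrow> A' * exp (B' * (2 * a\<^sup>2 + 1)) * exp (- \<kappa> * (a ^ 3 / 4)) \<le> M"
      unfolding eventually_at_top_linorder by blast
    define F where "F = (\<lambda>z. f z * exp (- of_real \<kappa> * s z ^ 3))"
    have nF: "cmod (F z) = cmod (f z) * exp (- \<kappa> * Re (s z ^ 3))" for z
      unfolding F_def by (simp add: norm_mult)
    have s3: "Re (s z ^ 3) \<ge> 0" if "z \<in> ?Q" for z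
    proof -
      have "0 \<le> Re (csqrt (\<zeta> z)) ^ 3 / 4" using csqrt_principal[of "\<zeta> z"] by (auto intro!: zero_le_power)
      thus ?thesis using csqrt_cubed_sector(1)[OF sec(1)[OF that]] unfolding s_def by linarith
    qed
    have "cmod (F z) \<le> M"
    proof (rule maximum_modulus_at_infinity[OF open_quadrant, of F M "2 * (max a0 0)\<^sup>2 + 1"])
      show "F holomorphic_on quadrant" unfolding F_def s_def \<zeta>_def
        by (intro holomorphic_intros f) (use nn in \<open>auto simp: \<zeta>_def\<close>)
      have "s holomorphic_on ?Q" unfolding s_def \<zeta>_def
        by (intro holomorphic_intros) (use nn in \<open>auto simp: \<zeta>_def\<close>)
      hence "continuous_on ?Q F" unfolding F_def
        by (intro continuous_intros f holomorphic_on_imp_continuous_on)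
      thus "continuous_on (closure quadrant) F" using closure_quadrant_subset by (rule continuous_on_subset)
      show "z \<in> quadrant" using z by simp
    next
      fix u assume u: "u \<in> frontier quadrant"
      hence uQ: "u \<in> ?Q" using closure_quadrant_subset by (auto simp: frontier_def)
      have "u \<notin> quadrant" using u open_quadrant by (simp add: frontier_def interior_open)
      hence "Re u = 0 \<or> Im u = 0" using uQ by auto
      hence "cmod (f u) \<le> M"
      proof
        assume "Re u = 0"
        hence "u = \<i> * of_real (Im u)" by (simp add: complex_eq_iff)
        thus ?thesis using im[of "Im u"] uQ by simp
      next
        assume "Im u = 0"
        hence "u = of_real (Re u)" by (simp add: complex_eq_iff)
        thus ?thesis using re[of "Re u"] uQ by simp
      qed
      moreover have "exp (- \<kappa> * Re (s u ^ 3)) \<le> 1" using s3[OF uQ] k by simp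
      ultimately have "cmod (f u) * exp (- \<kappa> * Re (s u ^ 3)) \<le> M * 1" using M by (intro mult_mono) auto
      thus "cmod (F u) \<le> M" unfolding nF by simp
    next
      fix u assume u: "u \<in> closure quadrant" and R: "2 * (max a0 0)\<^sup>2 + 1 \<le> cmod u"
      have uQ: "u \<in> ?Q" using u closure_quadrant_subset by auto
      define a where "a = Re (s u)"
      have a: "a \<ge> 0" unfolding a_def s_def using csqrt_principal[of "\<zeta> u"] by linarith
      have le: "cmod u \<le> 2 * a\<^sup>2 + 1"
        using sec(3)[OF uQ] csqrt_cubed_sector(2)[OF sec(1)[OF uQ]] unfolding a_def s_def by linarith
      have "max a0 0 \<le> a" by (rule power2_le_imp_le[OF _ a]) (use R le in simp)
      hence "a \<ge> a0" by simp
      have "cmod (F u) \<le> A' * exp (B' * cmod u) * exp (- \<kappa> * Re (s u ^ 3))"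
        unfolding nF using gr'[OF uQ] by (intro mult_right_mono) auto
      also have "\<dots> \<le> A' * exp (B' * (2 * a\<^sup>2 + 1)) * exp (- \<kappa> * (a ^ 3 / 4))"
      proof (intro mult_mono)
        show "exp (B' * cmod u) \<le> exp (B' * (2 * a\<^sup>2 + 1))" using le by (auto simp: B'_def intro!: mult_left_mono)
        have "\<kappa> * (a ^ 3 / 4) \<le> \<kappa> * Re (s u ^ 3)"
          using csqrt_cubed_sector(1)[OF sec(1)[OF uQ]] k unfolding a_def s_def by (intro mult_left_mono) auto
        thus "exp (- \<kappa> * Re (s u ^ 3)) \<le> exp (- \<kappa> * (a ^ 3 / 4))" by simp
      qed (auto simp: A'_def)
      also have "\<dots> \<le> M" by (rule a0) fact
      finally show "cmod (F u) \<le> M" .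
    qed
    thus ?thesis unfolding nF .
  qed
  have "((\<lambda>\<kappa>. cmod (f z) * exp (- \<kappa> * Re (s z ^ 3))) \<longlongrightarrow> cmod (f z) * exp (- 0 * Re (s z ^ 3))) (at_right 0)"
    by (intro tendsto_intros)
  moreover have "eventually (\<lambda>\<kappa>. cmod (f z) * exp (- \<kappa> * Re (s z ^ 3)) \<le> M) (at_right 0)"
    using eventually_at_right_less[of "0::real"] by (rule eventually_mono) (rule key)
  ultimately have "cmod (f z) * exp (- 0 * Re (s z ^ 3)) \<le> M" by (rule tendsto_upperbound) simp
  thus ?thesis by simp
qed

lemma open_upper_half_plane: "open upper_half_plane"
  unfolding upper_half_plane_def by (intro open_Collect_less continuous_intros)

lemma closure_upper_half_plane: "closure upper_half_plane \<subseteq> {z. Im z \<ge> 0}"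
  unfolding upper_half_plane_def by (rule closure_minimal) (auto intro!: closed_Collect_le continuous_intros)

lemma norm_one_minus_i_mult:
  assumes "Im z \<ge> 0" "\<kappa> \<ge> 0"
  shows "1 \<le> cmod (1 - \<i> * of_real \<kappa> * z)" "\<kappa> * cmod z \<le> cmod (1 - \<i> * of_real \<kappa> * z)"
proof -
  have "Re (1 - \<i> * of_real \<kappa> * z) \<ge> 1" using assms by simp
  thus "1 \<le> cmod (1 - \<i> * of_real \<kappa> * z)" using complex_Re_le_cmod order_trans by blast
  have "(\<kappa> * cmod z)\<^sup>2 \<le> (1 + \<kappa> * Im z)\<^sup>2 + (\<kappa> * Re z)\<^sup>2"
    using assms unfolding power_mult_distrib cmod_power2 by (simp add: power2_eq_square algebra_simps)
  also have "\<dots> = (cmod (1 - \<i> * of_real \<kappa> * z))\<^sup>2" by (simp add: cmod_power2)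
  finally show "\<kappa> * cmod z \<le> cmod (1 - \<i> * of_real \<kappa> * z)" by (rule power2_le_imp_le) simp
qed

text \<open>The factor \<open>exp (\<i> e z)\<close> absorbs the growth on the imaginary axis, so the quadrant principle applies on
both sides of it and gives boundedness. A bounded function is at most the supremum of its boundary
values, as division by \<open>1 - \<i> \<kappa> z\<close> shows; finally \<open>e\<close> tends to 0.\<close>

lemma phragmen_lindelof_half_plane:
  assumes f: "f holomorphic_on upper_half_plane" "continuous_on {z. Im z \<ge> 0} f"
    and gr: "\<And>z. Im z \<ge> 0 \<Longrightarrow> cmod (f z) \<le> A * exp (B * Im z)"
    and re: "\<And>x. cmod (f (of_real x)) \<le> M"
    and im: "\<And>e. e > 0 \<Longrightarrow> eventually (\<lambda>y. cmod (f (\<i> * of_real y)) \<le> exp (e * y)) at_top"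
    and M: "M > 0" and z: "Im z > 0"
  shows "cmod (f z) \<le> M"
proof -
  let ?H = "{z. Im z \<ge> 0}"
  have divle: "cmod (a / d) \<le> M \<longleftrightarrow> cmod a \<le> M * cmod d" if "cmod d \<ge> 1" for a d :: complex
  proof -
    have "cmod d > 0" using that by linarith
    thus ?thesis by (simp only: norm_divide pos_divide_le_eq)
  qed
  have step: "cmod (f z) * exp (- e * Im z) \<le> M" if e: "e > 0" for e
  proof -
    define g where "g = (\<lambda>z. f z * exp (\<i> * of_real e * z))"
    have ng: "cmod (g z) = cmod (f z) * exp (- e * Im z)" for z unfolding g_def by (simp add: norm_mult)
    have holg: "g holomorphic_on upper_half_plane" unfolding g_def by (intro holomorphic_intros f)
    have contg: "continuous_on ?H g" unfolding g_def by (intro continuous_intros f)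
    have gre: "cmod (g (of_real x)) \<le> M" for x using re[of x] by (simp add: ng)
    obtain y0 where y0: "\<And>y. y \<ge> y0 \<Longrightarrow> cmod (f (\<i> * of_real y)) \<le> exp (e * y)"
      using im[OF e] unfolding eventually_at_top_linorder by blast
    have "continuous_on {0..y0} (\<lambda>y. g (\<i> * of_real y))"
      by (rule continuous_on_compose2[OF contg]) (auto intro!: continuous_intros)
    from compact_imp_bounded[OF compact_continuous_image[OF this compact_Icc]]
    obtain M1 where M1: "\<And>y. y \<in> {0..y0} \<Longrightarrow> cmod (g (\<i> * of_real y)) \<le> M1"
      unfolding bounded_iff by blast
    define M' where "M' = max (max M M1) 1"
    have gim: "cmod (g (\<i> * of_real y)) \<le> M'" if "y \<ge> 0" for y
    proof (cases "y \<le> y0")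
      case True thus ?thesis using M1[of y] that by (simp add: M'_def)
    next
      case False
      hence "cmod (f (\<i> * of_real y)) * exp (- e * y) \<le> exp (e * y) * exp (- e * y)"
        using y0[of y] by (intro mult_right_mono) auto
      thus ?thesis by (simp add: ng M'_def exp_minus)
    qed
    have gre': "cmod (g (of_real x)) \<le> M'" for x using gre[of x] by (simp add: M'_def)
    have M': "M' > 0" by (simp add: M'_def)
    have A0: "A \<ge> 0" using order_trans[OF norm_ge_zero[of "f 0"] gr[of 0]] by simp
    have ggr: "cmod (g z) \<le> A * exp (\<bar>B\<bar> * cmod z)" if "Im z \<ge> 0" for z
    proof -
      have "cmod (g z) \<le> cmod (f z) * 1" unfolding ng using that e by (intro mult_left_mono) auto
      also have "\<dots> \<le> A * exp (B * Im z)" using gr[OF that] by simp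
      also have "\<dots> \<le> A * exp (\<bar>B\<bar> * cmod z)"
      proof -
        have "B * Im z \<le> \<bar>B\<bar> * cmod z"
          using that abs_Im_le_cmod[of z] by (intro mult_mono) auto
        thus ?thesis using A0 by (intro mult_left_mono) auto
      qed
      finally show ?thesis .
    qed
    have bd: "cmod (g z) \<le> M'" if z: "Im z \<ge> 0" for z
    proof -
      have q1: "cmod (g z) \<le> M'" if "Re z > 0" "Im z > 0" for z
      proof (rule phragmen_lindelof_quadrant[of g A "\<bar>B\<bar>"])
        show "g holomorphic_on quadrant" by (rule holomorphic_on_subset[OF holg]) (auto simp: upper_half_plane_def)
        show "continuous_on {z. Re z \<ge> 0 \<and> Im z \<ge> 0} g" by (rule continuous_on_subset[OF contg]) auto
      qed (use ggr gre' gim M' that in auto)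
      have q2: "cmod (g (\<i> * z)) \<le> M'" if "Re z > 0" "Im z > 0" for z
      proof (rule phragmen_lindelof_quadrant[of "\<lambda>z. g (\<i> * z)" A "\<bar>B\<bar>"])
        show "(\<lambda>z. g (\<i> * z)) holomorphic_on quadrant"
          by (rule holomorphic_on_compose_gen[OF _ holg, unfolded o_def]) (auto simp: upper_half_plane_def intro!: holomorphic_intros)
        show "continuous_on {z. Re z \<ge> 0 \<and> Im z \<ge> 0} (\<lambda>z. g (\<i> * z))"
          by (rule continuous_on_compose2[OF contg]) (auto intro!: continuous_intros)
        show "cmod (g (\<i> * z)) \<le> A * exp (\<bar>B\<bar> * cmod z)" if "Re z \<ge> 0" for z
          using ggr[of "\<i> * z"] that by (simp add: norm_mult)
        show "cmod (g (\<i> * (\<i> * of_real y))) \<le> M'" for y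
          using gre'[of "-y"] by (simp add: mult.assoc[symmetric])
      qed (use gim M' that in auto)
      consider "Im z = 0" | "Re z = 0" | "Re z > 0" "Im z > 0" | "Re z < 0" "Im z > 0" using z by linarith
      thus ?thesis
      proof cases
        case 1
        hence "z = of_real (Re z)" by (simp add: complex_eq_iff)
        thus ?thesis using gre'[of "Re z"] by simp
      next
        case 2
        hence "z = \<i> * of_real (Im z)" by (simp add: complex_eq_iff)
        thus ?thesis using gim[OF z] by simp
      next
        case 4
        have "cmod (g (\<i> * (- \<i> * z))) \<le> M'" using 4 by (intro q2) auto
        thus ?thesis by simp
      qed (use q1 in auto)
    qed
    have "cmod (g z) \<le> M * cmod (1 - \<i> * of_real \<kappa> * z)" if k: "\<kappa> > 0" for \<kappa>
    proof -
      note den = norm_one_minus_i_mult[OF _ less_imp_le[OF k]]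
      have den0: "1 - \<i> * of_real \<kappa> * u \<noteq> 0" if "Im u \<ge> 0" for u using den(1)[OF that] by force
      have "cmod (g z / (1 - \<i> * of_real \<kappa> * z)) \<le> M"
      proof (rule maximum_modulus_at_infinity[OF open_upper_half_plane, of "\<lambda>z. g z / (1 - \<i> * of_real \<kappa> * z)" M "M' / (\<kappa> * M)"])
        show "(\<lambda>z. g z / (1 - \<i> * of_real \<kappa> * z)) holomorphic_on upper_half_plane"
          by (intro holomorphic_intros holg) (use den0 in \<open>auto simp: upper_half_plane_def\<close>)
        have "continuous_on ?H (\<lambda>z. g z / (1 - \<i> * of_real \<kappa> * z))"
          by (intro continuous_intros contg) (use den0 in auto)
        thus "continuous_on (closure upper_half_plane) (\<lambda>z. g z / (1 - \<i> * of_real \<kappa> * z))"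
          using closure_upper_half_plane by (rule continuous_on_subset)
        show "z \<in> upper_half_plane" using z by (simp add: upper_half_plane_def)
      next
        fix u assume u: "u \<in> frontier upper_half_plane"
        have "Im u \<ge> 0" "\<not> Im u > 0" using u closure_upper_half_plane open_upper_half_plane
          by (auto simp: frontier_def interior_open upper_half_plane_def)
        hence i0: "Im u = 0" "u = of_real (Re u)" by (auto simp: complex_eq_iff)
        have "cmod (g u) \<le> M" using gre[of "Re u"] i0(2) by simp
        also have "\<dots> \<le> M * cmod (1 - \<i> * of_real \<kappa> * u)" using den(1)[of u] i0 M by simp
        finally show "cmod (g u / (1 - \<i> * of_real \<kappa> * u)) \<le> M"
          using den(1)[of u] i0(1) by (subst divle) auto
      next
        fix u assume u: "u \<in> closure upper_half_plane" and R: "M' / (\<kappa> * M) \<le> cmod u"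
        have iu: "Im u \<ge> 0" using u closure_upper_half_plane by auto
        have "cmod (g u) \<le> M'" by (rule bd[OF iu])
        also have "\<dots> \<le> M * (\<kappa> * cmod u)" using R k M by (simp add: field_simps)
        also have "\<dots> \<le> M * cmod (1 - \<i> * of_real \<kappa> * u)" using den(2)[OF iu] M by simp
        finally show "cmod (g u / (1 - \<i> * of_real \<kappa> * u)) \<le> M"
          using den(1)[OF iu] by (subst divle) auto
      qed
      thus ?thesis using den(1)[of z] z by (subst (asm) divle) auto
    qed
    hence "eventually (\<lambda>\<kappa>. cmod (g z) \<le> M * cmod (1 - \<i> * of_real \<kappa> * z)) (at_right 0)"
      using eventually_at_right_less[of "0::real"] by (auto elim: eventually_mono)
    moreover have "((\<lambda>\<kappa>. M * cmod (1 - \<i> * of_real \<kappa> * z)) \<longlongrightarrow> M * cmod (1 - \<i> * of_real 0 * z)) (at_right 0)"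
      by (intro tendsto_intros)
    ultimately have "cmod (g z) \<le> M * cmod (1 - \<i> * of_real 0 * z)" by (intro tendsto_lowerbound) auto
    thus ?thesis by (simp add: ng)
  qed
  have "eventually (\<lambda>e. cmod (f z) * exp (- e * Im z) \<le> M) (at_right 0)"
    using eventually_at_right_less[of "0::real"] step by (auto elim: eventually_mono)
  moreover have "((\<lambda>e. cmod (f z) * exp (- e * Im z)) \<longlongrightarrow> cmod (f z) * exp (- 0 * Im z)) (at_right 0)"
    by (intro tendsto_intros)
  ultimately have "cmod (f z) * exp (- 0 * Im z) \<le> M" by (intro tendsto_upperbound) auto
  thus ?thesis by simp
qed

section \<open>Vanishing integrals for functions of bounded type\<close>

lemma hp_poisson_lborel:
  assumes w: "Im w > 0"
  shows "integrable lborel (hp_poisson w)" "(LINT t|lborel. hp_poisson w t) = 1"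
proof -
  note d = hp_poisson_antiderivative[OF w]
  have l1: "filterlim (\<lambda>T. (T - Re w) / Im w) at_top at_top" using w by real_asymp
  have l2: "filterlim (\<lambda>T. (T - Re w) / Im w) at_bot at_bot" using w by real_asymp
  have t1: "((\<lambda>t. arctan ((t - Re w) / Im w) / pi) \<longlongrightarrow> (pi/2) / pi) at_top"
    by (intro tendsto_intros filterlim_compose[OF tendsto_arctan_at_top l1]) simp
  have t2: "((\<lambda>t. arctan ((t - Re w) / Im w) / pi) \<longlongrightarrow> (-(pi/2)) / pi) at_bot"
    by (intro tendsto_intros filterlim_compose[OF tendsto_arctan_at_bot l2]) simp
  have cont: "isCont (hp_poisson w) t" for t
    using continuous_on_hp_poisson[OF w, of UNIV] by (simp add: continuous_on_eq_continuous_at)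
  have a: "set_integrable lborel (einterval (-\<infinity>) \<infinity>) (hp_poisson w)"
    by (rule interval_integral_FTC_nonneg(1)[where F = "\<lambda>t. arctan ((t - Re w) / Im w) / pi"])
      (use d cont hp_poisson_nonneg[OF w] t1 t2 in \<open>auto simp: ereal_tendsto_simps\<close>)
  have b: "(LBINT x=-\<infinity>..\<infinity>. hp_poisson w x) = (pi/2) / pi - (-(pi/2)) / pi"
    by (rule interval_integral_FTC_nonneg(2)[where F = "\<lambda>t. arctan ((t - Re w) / Im w) / pi"])
      (use d cont hp_poisson_nonneg[OF w] t1 t2 in \<open>auto simp: ereal_tendsto_simps\<close>)
  show "integrable lborel (hp_poisson w)" using a by (simp add: set_integrable_def)
  show "(LINT t|lborel. hp_poisson w t) = 1"
    using b by (simp add: interval_lebesgue_integral_def set_lebesgue_integral_def)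
qed

lemma hp_poisson_alt: "hp_poisson (Complex x d) t = d / (pi * ((t - x)\<^sup>2 + d\<^sup>2))"
  by (simp add: hp_poisson_def cmod_power2)

lemma nn_integral_hp_poisson: "Im w > 0 \<Longrightarrow> (\<integral>\<^sup>+t. ennreal (hp_poisson w t) \<partial>lborel) = 1"
  using nn_integral_eq_integral[OF hp_poisson_lborel(1)] hp_poisson_lborel(2) hp_poisson_nonneg by simp

lemma hp_poisson_le:
  assumes "Im w > 0" shows "hp_poisson w t \<le> 1 / (pi * Im w)"
proof -
  have "(Im w)\<^sup>2 \<le> (cmod (of_real t - w))\<^sup>2" by (simp add: cmod_power2)
  hence "Im w / (pi * (cmod (of_real t - w))\<^sup>2) \<le> Im w / (pi * (Im w)\<^sup>2)"
    using assms real_neq_upper[OF assms] by (intro divide_left_mono) (auto intro!: mult_pos_pos)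
  thus ?thesis using assms by (simp add: hp_poisson_def power2_eq_square)
qed

lemma boundary_continuous: "continuous_on {z. Im z \<ge> 0} h \<Longrightarrow> continuous_on A (\<lambda>t. h (complex_of_real t))"
  by (rule continuous_on_compose2) (auto intro!: continuous_intros)

lemma boundary_measurable:
  "continuous_on {z. Im z \<ge> 0} h \<Longrightarrow> (\<lambda>t. h (complex_of_real t)) \<in> borel_measurable borel"
  using boundary_continuous[of h UNIV] by (rule borel_measurable_continuous_onI)

lemma poisson_majorant_integrable:
  assumes cont: "continuous_on {z. Im z \<ge> 0} h" and bt: "bounded_type h"
    and int: "integrable lborel (\<lambda>t. h (complex_of_real t))"
  obtains C where "C \<ge> 0"
    "\<And>w. Im w > 0 \<Longrightarrow> ennreal (cmod (h w)) \<le> ennreal (exp (C * Im w)) * (\<integral>\<^sup>+t. ennreal (hp_poisson w t) * ennreal (cmod (h (of_real t))) \<partial>lborel)"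
    "\<And>w. Im w > 0 \<Longrightarrow> cmod (h w) \<le> exp (C * Im w) * ((LINT t|lborel. cmod (h (of_real t))) / (pi * Im w))"
proof -
  obtain C where C: "C \<ge> 0"
    "\<And>w B. Im w > 0 \<Longrightarrow> (\<And>T. T > 0 \<Longrightarrow> integral {-T..T} (\<lambda>t. hp_poisson w t * cmod (h (of_real t))) \<le> B) \<Longrightarrow>
       cmod (h w) \<le> B * exp (C * Im w)"
    using poisson_majorant_bounded_type[OF cont bt] by metis
  have I: "integrable lborel (\<lambda>t. hp_poisson w t * cmod (h (of_real t)))" if w: "Im w > 0" for w
  proof (rule Bochner_Integration.integrable_bound)
    show "integrable lborel (\<lambda>t. 1 / (pi * Im w) * cmod (h (of_real t)))" using int by simp
    show "(\<lambda>t. hp_poisson w t * cmod (h (of_real t))) \<in> borel_measurable lborel"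
      using boundary_measurable[OF cont] unfolding hp_poisson_def by simp
    show "AE t in lborel. norm (hp_poisson w t * cmod (h (of_real t))) \<le> norm (1 / (pi * Im w) * cmod (h (of_real t)))"
    proof (rule AE_I2)
      fix t
      have "hp_poisson w t * cmod (h (of_real t)) \<le> 1 / (pi * Im w) * cmod (h (of_real t))"
        using hp_poisson_le[OF w] by (rule mult_right_mono) simp
      thus "norm (hp_poisson w t * cmod (h (of_real t))) \<le> norm (1 / (pi * Im w) * cmod (h (of_real t)))"
        using hp_poisson_nonneg[OF w, of t] w by (simp add: abs_mult)
    qed
  qed
  have le: "integral {-T..T} (\<lambda>t. hp_poisson w t * cmod (h (of_real t))) \<le> (LINT t|lborel. hp_poisson w t * cmod (h (of_real t)))" if w: "Im w > 0" for w T
  proof -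
    have si: "set_integrable lborel {-T..T} (\<lambda>t. hp_poisson w t * cmod (h (of_real t)))"
      unfolding set_integrable_def by (intro integrable_mult_indicator I w) simp
    have "integral {-T..T} (\<lambda>t. hp_poisson w t * cmod (h (of_real t))) = (LINT t:{-T..T}|lborel. hp_poisson w t * cmod (h (of_real t)))"
      using set_borel_integral_eq_integral(2)[OF si] by simp
    also have "\<dots> \<le> (LINT t|lborel. hp_poisson w t * cmod (h (of_real t)))"
      unfolding set_lebesgue_integral_def
      by (rule integral_mono[OF si[unfolded set_integrable_def] I[OF w]])
        (use hp_poisson_nonneg[OF w] in \<open>auto simp: indicator_def\<close>)
    finally show ?thesis .
  qed
  show thesis
  proof (rule that[OF C(1)])
    fix w assume w: "Im w > 0"
    have *: "cmod (h w) \<le> (LINT t|lborel. hp_poisson w t * cmod (h (of_real t))) * exp (C * Im w)"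
      by (rule C(2)[OF w le[OF w]])
    have "(\<integral>\<^sup>+t. ennreal (hp_poisson w t) * ennreal (cmod (h (of_real t))) \<partial>lborel)
      = (\<integral>\<^sup>+t. ennreal (hp_poisson w t * cmod (h (of_real t))) \<partial>lborel)"
      using hp_poisson_nonneg[OF w] by (simp add: ennreal_mult)
    also have "\<dots> = ennreal (LINT t|lborel. hp_poisson w t * cmod (h (of_real t)))"
      using hp_poisson_nonneg[OF w] by (intro nn_integral_eq_integral I w) auto
    finally show "ennreal (cmod (h w)) \<le> ennreal (exp (C * Im w)) * (\<integral>\<^sup>+t. ennreal (hp_poisson w t) * ennreal (cmod (h (of_real t))) \<partial>lborel)"
      using * by (simp add: ennreal_mult'[symmetric] mult.commute ennreal_leI)
    have "(LINT t|lborel. hp_poisson w t * cmod (h (of_real t))) \<le> (LINT t|lborel. 1 / (pi * Im w) * cmod (h (of_real t)))"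
    proof (intro integral_mono I w)
      show "hp_poisson w t * cmod (h (of_real t)) \<le> 1 / (pi * Im w) * cmod (h (of_real t))" for t
        using hp_poisson_le[OF w] by (rule mult_right_mono) simp
    qed (use int in simp)
    hence "(LINT t|lborel. hp_poisson w t * cmod (h (of_real t))) \<le> (LINT t|lborel. cmod (h (of_real t))) / (pi * Im w)" by simp
    hence "(LINT t|lborel. hp_poisson w t * cmod (h (of_real t))) * exp (C * Im w) \<le> (LINT t|lborel. cmod (h (of_real t))) / (pi * Im w) * exp (C * Im w)"
      by (rule mult_right_mono) simp
    with * show "cmod (h w) \<le> exp (C * Im w) * ((LINT t|lborel. cmod (h (of_real t))) / (pi * Im w))"
      by (simp add: mult.commute)
  qed
qed

lemma bounded_type_holomorphic: "bounded_type h \<Longrightarrow> h holomorphic_on upper_half_plane"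
  by (simp add: bounded_type_def)

text \<open>Tonelli's theorem applied to the Poisson majorant: by the symmetry of the kernel in \<open>x\<close> and \<open>t\<close> its
integral over \<open>x\<close> equals 1.\<close>

lemma integrable_norm_shift:
  assumes cont: "continuous_on {z. Im z \<ge> 0} h"
    and int: "integrable lborel (\<lambda>t. h (complex_of_real t))" and d: "d > 0"
    and C: "\<And>w. Im w > 0 \<Longrightarrow> ennreal (cmod (h w)) \<le> ennreal (exp (C * Im w)) * (\<integral>\<^sup>+t. ennreal (hp_poisson w t) * ennreal (cmod (h (of_real t))) \<partial>lborel)"
  shows "integrable lborel (\<lambda>x. h (Complex x d))"
    "(LINT x|lborel. cmod (h (Complex x d))) \<le> exp (C * d) * (LINT t|lborel. cmod (h (of_real t)))"
proof -
  have "continuous_on UNIV (\<lambda>x. h (Complex x d))"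
    by (rule continuous_on_compose2[OF cont]) (use d in \<open>auto simp: Complex_eq intro!: continuous_intros\<close>)
  hence meas: "(\<lambda>x. h (Complex x d)) \<in> borel_measurable borel" by (rule borel_measurable_continuous_onI)
  define g where "g = (\<lambda>t. ennreal (cmod (h (complex_of_real t))))"
  have mh [measurable]: "g \<in> borel_measurable borel" unfolding g_def using boundary_measurable[OF cont] by simp
  let ?N = "LINT t|lborel. cmod (h (of_real t))"
  have "(\<integral>\<^sup>+x. ennreal (cmod (h (Complex x d))) \<partial>lborel) \<le>
     (\<integral>\<^sup>+x. ennreal (exp (C * d)) * (\<integral>\<^sup>+t. ennreal (hp_poisson (Complex x d) t) * g t \<partial>lborel) \<partial>lborel)"
    using C[of "Complex _ d"] d unfolding g_def by (intro nn_integral_mono) auto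
  also have "\<dots> = ennreal (exp (C * d)) * (\<integral>\<^sup>+x. (\<integral>\<^sup>+t. ennreal (hp_poisson (Complex x d) t) * g t \<partial>lborel) \<partial>lborel)"
    unfolding hp_poisson_alt by (intro nn_integral_cmult) measurable
  also have "(\<integral>\<^sup>+x. (\<integral>\<^sup>+t. ennreal (hp_poisson (Complex x d) t) * g t \<partial>lborel) \<partial>lborel)
    = (\<integral>\<^sup>+t. (\<integral>\<^sup>+x. ennreal (hp_poisson (Complex x d) t) * g t \<partial>lborel) \<partial>lborel)"
    unfolding hp_poisson_alt by (intro lborel_pair.Fubini') measurable
  also have "\<dots> = (\<integral>\<^sup>+t. g t \<partial>lborel)"
  proof (rule nn_integral_cong)
    fix t
    have "hp_poisson (Complex x d) t = hp_poisson (Complex t d) x" for x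
      unfolding hp_poisson_alt by (simp add: power2_commute)
    hence "(\<integral>\<^sup>+x. ennreal (hp_poisson (Complex x d) t) * g t \<partial>lborel)
      = (\<integral>\<^sup>+x. ennreal (hp_poisson (Complex t d) x) * g t \<partial>lborel)" by simp
    also have "\<dots> = (\<integral>\<^sup>+x. ennreal (hp_poisson (Complex t d) x) \<partial>lborel) * g t"
      unfolding hp_poisson_alt by (intro nn_integral_multc) measurable
    also have "\<dots> = g t" using d by (simp add: nn_integral_hp_poisson)
    finally show "(\<integral>\<^sup>+x. ennreal (hp_poisson (Complex x d) t) * g t \<partial>lborel) = g t" .
  qed
  also have "\<dots> = ennreal ?N" unfolding g_def using int by (intro nn_integral_eq_integral) auto
  finally have le: "(\<integral>\<^sup>+x. ennreal (cmod (h (Complex x d))) \<partial>lborel) \<le> ennreal (exp (C * d) * ?N)"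
    by (simp add: ennreal_mult')
  show I: "integrable lborel (\<lambda>x. h (Complex x d))"
    unfolding integrable_iff_bounded using meas le by (auto intro: order_le_less_trans)
  have "(\<integral>\<^sup>+x. ennreal (cmod (h (Complex x d))) \<partial>lborel) = ennreal (LINT x|lborel. cmod (h (Complex x d)))"
    using I by (intro nn_integral_eq_integral) auto
  with le show "(LINT x|lborel. cmod (h (Complex x d))) \<le> exp (C * d) * ?N"
    by (simp add: ennreal_le_iff)
qed

text \<open>Cauchy's theorem on half-discs after damping by \<open>1 / (1 - \<i> \<kappa> z)\<^sup>2\<close>, which makes a bounded function decay
quadratically and has modulus at most 1 in the half-plane; then \<open>\<kappa>\<close> tends to 0.\<close>

lemma integral_eq_0_of_bounded_holomorphic:
  assumes hol: "f holomorphic_on {z. Im z > -d}" and d: "d > 0"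
    and bd: "\<And>z. Im z \<ge> 0 \<Longrightarrow> cmod (f z) \<le> M"
    and int: "integrable lborel (\<lambda>t. f (complex_of_real t))"
  shows "(LINT t|lborel. f (of_real t)) = 0"
proof -
  have M0: "M \<ge> 0" using order_trans[OF norm_ge_zero bd[of 0]] by simp
  have cont: "continuous_on {z. Im z \<ge> 0} f"
    by (rule continuous_on_subset[OF holomorphic_on_imp_continuous_on[OF hol]]) (use d in auto)
  have meas: "(\<lambda>t. f (complex_of_real t)) \<in> borel_measurable borel" by (rule boundary_measurable[OF cont])
  have nz: "1 - \<i> * of_real \<kappa> * z \<noteq> 0" if "\<kappa> \<ge> 0" "Im z \<ge> 0" for \<kappa> z
    using norm_one_minus_i_mult(1)[OF that(2,1)] by force
  have damp_le: "norm (f (of_real t) / (1 - \<i> * of_real \<kappa> * of_real t)\<^sup>2) \<le> norm (f (complex_of_real t))" if k: "\<kappa> \<ge> 0" for \<kappa> t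
  proof -
    have "1 \<le> (cmod (1 - \<i> * of_real \<kappa> * of_real t))\<^sup>2"
      using norm_one_minus_i_mult(1)[of "of_real t" \<kappa>] k by (simp add: one_le_power)
    hence "cmod (f (of_real t)) / (cmod (1 - \<i> * of_real \<kappa> * of_real t))\<^sup>2 \<le> cmod (f (of_real t)) / 1"
      by (intro divide_left_mono) auto
    thus ?thesis by (simp add: norm_divide norm_power)
  qed
  have damp_int: "integrable lborel (\<lambda>t. f (of_real t) / (1 - \<i> * of_real \<kappa> * of_real t)\<^sup>2)" if k: "\<kappa> \<ge> 0" for \<kappa>
  proof (rule Bochner_Integration.integrable_bound[OF int])
    show "(\<lambda>t. f (of_real t) / (1 - \<i> * of_real \<kappa> * of_real t)\<^sup>2) \<in> borel_measurable lborel"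
      using meas by simp
    show "AE t in lborel. norm (f (of_real t) / (1 - \<i> * of_real \<kappa> * of_real t)\<^sup>2) \<le> norm (f (complex_of_real t))"
      by (intro AE_I2 damp_le k)
  qed
  have damp: "(LINT t|lborel. f (of_real t) / (1 - \<i> * of_real \<kappa> * of_real t)\<^sup>2) = 0" if k: "\<kappa> > 0" for \<kappa>
  proof -
    define N where "N = (\<lambda>z. f z / (1 - \<i> * of_real \<kappa> * z)\<^sup>2)"
    define e where "e = min d (1 / \<kappa>)"
    have e: "e > 0" "e \<le> d" "e \<le> 1/\<kappa>" using d k by (auto simp: e_def)
    have nz': "1 - \<i> * of_real \<kappa> * z \<noteq> 0" if "Im z > -e" for z
    proof
      assume "1 - \<i> * of_real \<kappa> * z = 0"
      hence "Re (1 - \<i> * of_real \<kappa> * z) = 0" by simp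
      hence "1 + \<kappa> * Im z = 0" by simp
      moreover have "\<kappa> * Im z > \<kappa> * (-(1/\<kappa>))" using that e k by (intro mult_strict_left_mono) auto
      ultimately show False using k by simp
    qed
    have holN: "N holomorphic_on {z. Im z > -e}" unfolding N_def
      by (intro holomorphic_intros holomorphic_on_subset[OF hol]) (use nz' e in auto)
    have conv: "convex {z. Im z > -e}" by (rule convex_halfspace_Im_gt)
    have N_arc: "cmod (integral {-r..r} (\<lambda>t. N (of_real t))) \<le> M * pi / (\<kappa>\<^sup>2 * r)" if r: "r > 0" for r
    proof -
      let ?g = "linepath (of_real (-r)) (of_real r) +++ part_circlepath 0 r 0 pi"
      have arcim: "Im z \<ge> 0" "cmod z = r" if zp: "z \<in> path_image (part_circlepath 0 r 0 pi)" for z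
      proof -
        obtain x where x: "x \<in> {0..pi}" "z = of_real r * cis x"
          using zp by (auto simp: path_image_part_circlepath cis_conv_exp)
        show "Im z \<ge> 0" "cmod z = r" using x r by (auto simp: norm_mult sin_ge_zero)
      qed
      have "(N has_contour_integral 0) ?g"
      proof (rule Cauchy_theorem_convex_simple[OF holN conv])
        show "valid_path ?g" by (intro valid_path_join) (auto simp: exp_Euler)
        have "path_image ?g \<subseteq> path_image (linepath (of_real (-r)) (of_real r)) \<union> path_image (part_circlepath 0 r 0 pi)"
          by (rule path_image_join_subset)
        moreover have "path_image (linepath (complex_of_real (-r)) (of_real r)) \<subseteq> {z. Im z > -e}"
          using e by (auto simp: path_image_linepath closed_segment_def)
        ultimately show "path_image ?g \<subseteq> {z. Im z > -e}" using arcim(1) e by force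
        show "pathfinish ?g = pathstart ?g" by (simp add: exp_Euler)
      qed
      moreover have "N contour_integrable_on linepath (of_real (-r)) (of_real r)"
        by (intro contour_integrable_continuous_linepath continuous_on_subset[OF holomorphic_on_imp_continuous_on[OF holN]])
          (use e in \<open>auto simp: closed_segment_def\<close>)
      moreover have ia: "N contour_integrable_on part_circlepath 0 r 0 pi"
        by (intro contour_integrable_continuous_part_circlepath continuous_on_subset[OF holomorphic_on_imp_continuous_on[OF holN]])
          (use e arcim in force)
      ultimately have "contour_integral (linepath (of_real (-r)) (of_real r)) N + contour_integral (part_circlepath 0 r 0 pi) N = 0"
        by (subst contour_integral_join[symmetric]) (auto simp: exp_Euler contour_integral_unique)
      moreover have "contour_integral (linepath (of_real (-r)) (of_real r)) N = integral {-r..r} (\<lambda>t. N (of_real t))"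
        using r by (subst contour_integral_linepath_Reals_eq) auto
      ultimately have eq: "integral {-r..r} (\<lambda>t. N (of_real t)) = - contour_integral (part_circlepath 0 r 0 pi) N"
        by (simp add: eq_neg_iff_add_eq_0)
      have "cmod (contour_integral (part_circlepath 0 r 0 pi) N) \<le> M / (\<kappa> * r)\<^sup>2 * r * \<bar>pi - 0\<bar>"
      proof (rule contour_integral_bound_part_circlepath[OF ia])
        fix z assume z: "z \<in> path_image (part_circlepath 0 r 0 pi)"
        have "(\<kappa> * r)\<^sup>2 \<le> (cmod (1 - \<i> * of_real \<kappa> * z))\<^sup>2"
          using norm_one_minus_i_mult(2)[OF arcim(1)[OF z], of \<kappa>] k r arcim(2)[OF z] by (intro power_mono) auto
        thus "cmod (N z) \<le> M / (\<kappa> * r)\<^sup>2" unfolding N_def norm_divide norm_power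
          using bd[OF arcim(1)[OF z]] k r M0 by (intro frac_le) auto
      qed (use M0 r k in auto)
      also have "M / (\<kappa> * r)\<^sup>2 * r * \<bar>pi - 0\<bar> = M * pi / (\<kappa>\<^sup>2 * r)"
        using r k by (simp add: power2_eq_square field_simps)
      finally show ?thesis unfolding eq by simp
    qed
    have Nint: "integrable lborel (\<lambda>t. N (complex_of_real t))" unfolding N_def using damp_int[of \<kappa>] k by simp
    have lim1: "(\<lambda>n. integral {-(real (Suc n))..real (Suc n)} (\<lambda>t. N (of_real t))) \<longlonglongrightarrow> (LINT t|lborel. N (of_real t))"
    proof -
      have "(\<lambda>n. LINT t|lborel. indicator {-(real (Suc n))..real (Suc n)} t *\<^sub>R N (of_real t)) \<longlonglongrightarrow> (LINT t|lborel. N (of_real t))"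
      proof (rule integral_dominated_convergence[where w = "\<lambda>t. cmod (N (of_real t))"])
        show "AE t in lborel. (\<lambda>n. indicator {-(real (Suc n))..real (Suc n)} t *\<^sub>R N (of_real t)) \<longlonglongrightarrow> N (of_real t)"
        proof (rule AE_I2)
          fix t :: real
          have "eventually (\<lambda>n. \<bar>t\<bar> \<le> real (Suc n)) sequentially" by real_asymp
          hence "eventually (\<lambda>n. indicator {-(real (Suc n))..real (Suc n)} t *\<^sub>R N (of_real t) = N (of_real t)) sequentially"
            by eventually_elim (auto simp: indicator_def)
          thus "(\<lambda>n. indicator {-(real (Suc n))..real (Suc n)} t *\<^sub>R N (of_real t)) \<longlonglongrightarrow> N (of_real t)"
            by (rule tendsto_eventually)
        qed
      qed (use Nint in \<open>auto simp: indicator_def\<close>)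
      moreover have "(LINT t|lborel. indicator {-(real (Suc n))..real (Suc n)} t *\<^sub>R N (of_real t)) = integral {-(real (Suc n))..real (Suc n)} (\<lambda>t. N (of_real t))" for n
        using set_borel_integral_eq_integral(2)[of "{-(real (Suc n))..real (Suc n)}" "\<lambda>t. N (of_real t)"] Nint
        unfolding set_integrable_def set_lebesgue_integral_def by (simp add: integrable_mult_indicator)
      ultimately show ?thesis by simp
    qed
    have "(\<lambda>n. integral {-(real (Suc n))..real (Suc n)} (\<lambda>t. N (of_real t))) \<longlonglongrightarrow> 0"
    proof (rule Lim_null_comparison)
      show "eventually (\<lambda>n. norm (integral {-(real (Suc n))..real (Suc n)} (\<lambda>t. N (of_real t))) \<le> M * pi / (\<kappa>\<^sup>2 * real (Suc n))) sequentially"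
        by (intro always_eventually allI N_arc) simp
      show "(\<lambda>n. M * pi / (\<kappa>\<^sup>2 * real (Suc n))) \<longlonglongrightarrow> 0" using k by real_asymp
    qed
    with lim1 have "(LINT t|lborel. N (of_real t)) = 0" using LIMSEQ_unique by blast
    thus ?thesis by (simp add: N_def)
  qed
  have "(\<lambda>n. LINT t|lborel. f (of_real t) / (1 - \<i> * of_real (1 / real (Suc n)) * of_real t)\<^sup>2) \<longlonglongrightarrow> (LINT t|lborel. f (of_real t))"
  proof (rule integral_dominated_convergence[where w = "\<lambda>t. cmod (f (of_real t))"])
    show "AE t in lborel. (\<lambda>n. f (of_real t) / (1 - \<i> * of_real (1 / real (Suc n)) * of_real t)\<^sup>2) \<longlonglongrightarrow> f (complex_of_real t)"
    proof (rule AE_I2)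
      fix t :: real
      have l: "(\<lambda>n. 1 / real (Suc n)) \<longlonglongrightarrow> 0" by real_asymp
      have "(\<lambda>n. f (of_real t) / (1 - \<i> * of_real (1 / real (Suc n)) * of_real t)\<^sup>2) \<longlonglongrightarrow> f (of_real t) / (1 - \<i> * of_real 0 * of_real t)\<^sup>2"
        by (intro tendsto_intros l) auto
      thus "(\<lambda>n. f (of_real t) / (1 - \<i> * of_real (1 / real (Suc n)) * of_real t)\<^sup>2) \<longlonglongrightarrow> f (complex_of_real t)" by simp
    qed
    fix n
    show "AE t in lborel. norm (f (of_real t) / (1 - \<i> * of_real (1 / real (Suc n)) * of_real t)\<^sup>2) \<le> cmod (f (complex_of_real t))"
      by (intro AE_I2 damp_le) simp
  qed (use int meas in auto)
  moreover have "(LINT t|lborel. f (of_real t) / (1 - \<i> * of_real (1 / real (Suc n)) * of_real t)\<^sup>2) = 0" for n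
    by (rule damp) simp
  ultimately have "(\<lambda>n. 0) \<longlonglongrightarrow> (LINT t|lborel. f (of_real t))" by simp
  thus ?thesis using LIMSEQ_unique tendsto_const by blast
qed

text \<open>All integral formulas below are instances of this theorem. On a line \<open>Im z = d\<close> above the real axis
the function is bounded, because the Poisson majorant bounds it up to an exponential factor and the
Phragmen-Lindelof principle removes that factor; hence its integral over that line vanishes. The
\<open>L\<^sup>1\<close> norms on these lines are at most \<open>exp (C d)\<close> times the norm on the real line, so pointwise
convergence as \<open>d \<rightarrow> 0\<close> implies convergence in \<open>L\<^sup>1\<close>.\<close>

theorem smirnov_integral_eq_0:
  assumes Q: "smirnov Q" and int: "integrable lborel (\<lambda>t. Q (complex_of_real t))"
  shows "(LINT t|lborel. Q (of_real t)) = 0"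
proof -
  have cont: "continuous_on {z. Im z \<ge> 0} Q" and bt: "bounded_type Q"
    and gr: "\<And>e. e > 0 \<Longrightarrow> eventually (\<lambda>y. cmod (Q (\<i> * of_real y)) \<le> exp (e * y)) at_top"
    using Q unfolding smirnov_def by auto
  have hol: "Q holomorphic_on upper_half_plane" by (rule bounded_type_holomorphic[OF bt])
  obtain C where C: "C \<ge> 0"
    "\<And>w. Im w > 0 \<Longrightarrow> ennreal (cmod (Q w)) \<le> ennreal (exp (C * Im w)) * (\<integral>\<^sup>+t. ennreal (hp_poisson w t) * ennreal (cmod (Q (of_real t))) \<partial>lborel)"
    "\<And>w. Im w > 0 \<Longrightarrow> cmod (Q w) \<le> exp (C * Im w) * ((LINT t|lborel. cmod (Q (of_real t))) / (pi * Im w))"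
    by (rule poisson_majorant_integrable[OF cont bt int]) blast
  let ?N = "LINT t|lborel. cmod (Q (of_real t))"
  have N0: "?N \<ge> 0" by simp
  have shift0: "(LINT x|lborel. Q (Complex x d)) = 0" if d: "d > 0" for d
  proof -
    define f where "f = (\<lambda>z. Q (z + \<i> * of_real d))"
    have fC: "f (of_real x) = Q (Complex x d)" for x unfolding f_def by (simp add: Complex_eq)
    have holf: "f holomorphic_on {z. Im z > -d}" unfolding f_def
      by (rule holomorphic_on_compose_gen[OF _ hol, unfolded o_def]) (auto simp: upper_half_plane_def intro!: holomorphic_intros)
    have contf: "continuous_on {z. Im z \<ge> 0} f"
      by (rule continuous_on_subset[OF holomorphic_on_imp_continuous_on[OF holf]]) (use d in auto)
    define M where "M = exp (C * d) * (?N / (pi * d)) + 1"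
    have gr1: "cmod (f z) \<le> (exp (C * d) * (?N / (pi * d))) * exp (C * Im z)" if "Im z \<ge> 0" for z
    proof -
      have "cmod (f z) \<le> exp (C * (Im z + d)) * (?N / (pi * (Im z + d)))"
        unfolding f_def using C(3)[of "z + \<i> * of_real d"] that d by simp
      also have "\<dots> \<le> exp (C * (Im z + d)) * (?N / (pi * d))"
        using that d N0 by (intro mult_left_mono divide_left_mono) auto
      finally show ?thesis by (simp add: distrib_left exp_add mult_ac)
    qed
    have bd: "cmod (f z) \<le> M" if "Im z \<ge> 0" for z
    proof (cases "Im z = 0")
      case True
      thus ?thesis using gr1[OF that] by (simp add: M_def)
    next
      case False
      show ?thesis
      proof (rule phragmen_lindelof_half_plane[OF _ contf gr1])
        show "f holomorphic_on upper_half_plane"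
          by (rule holomorphic_on_subset[OF holf]) (use d in \<open>auto simp: upper_half_plane_def\<close>)
        show "cmod (f (of_real x)) \<le> M" for x using gr1[of "of_real x"] by (simp add: M_def)
        show "eventually (\<lambda>y. cmod (f (\<i> * of_real y)) \<le> exp (e * y)) at_top" if e: "e > 0" for e
        proof -
          have "eventually (\<lambda>y. cmod (Q (\<i> * of_real (y + d))) \<le> exp (e/2 * (y + d))) at_top"
          proof (rule eventually_compose_filterlim[OF gr])
            show "filterlim (\<lambda>y. y + d) at_top at_top" by real_asymp
          qed (use e in simp)
          thus ?thesis using eventually_ge_at_top[of d]
          proof eventually_elim
            case (elim y)
            have "e/2 * (y + d) \<le> e * y" using elim(2) e by (simp add: algebra_simps)
            hence "exp (e/2 * (y + d)) \<le> exp (e * y)" by simp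
            moreover have "\<i> * of_real (y + d) = \<i> * of_real y + \<i> * of_real d" by (simp add: distrib_left)
            ultimately show ?case using elim(1) unfolding f_def by (metis order_trans)
          qed
        qed
        show "M > 0" unfolding M_def using N0 d by (intro add_nonneg_pos mult_nonneg_nonneg divide_nonneg_pos) auto
      qed (use that False in auto)
    qed
    have "(LINT t|lborel. f (of_real t)) = 0"
      by (rule integral_eq_0_of_bounded_holomorphic[OF holf d bd])
        (use integrable_norm_shift(1)[OF cont int d C(2)] in \<open>auto simp: fC\<close>)
    thus ?thesis unfolding fC .
  qed
  define d where "d = (\<lambda>n. 1 / real (Suc n))"
  have d0: "d n > 0" for n by (simp add: d_def)
  have dlim: "d \<longlonglongrightarrow> 0" unfolding d_def by real_asymp
  define q where "q = (\<lambda>n x. Q (Complex x (d n)))"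
  have qint: "integrable lborel (q n)" and qle: "(LINT x|lborel. cmod (q n x)) \<le> exp (C * d n) * ?N" for n
    unfolding q_def using integrable_norm_shift[OF cont int d0 C(2)] by auto
  have qlim: "(\<lambda>n. q n x) \<longlonglongrightarrow> Q (of_real x)" for x
  proof -
    have "(\<lambda>n. Complex x (d n)) \<longlonglongrightarrow> Complex x 0" using dlim by (intro tendsto_Complex tendsto_const)
    moreover have "eventually (\<lambda>n. Complex x (d n) \<in> {z. Im z \<ge> 0}) sequentially"
      using d0 by (auto intro!: always_eventually less_imp_le)
    ultimately have "(\<lambda>n. Q (Complex x (d n))) \<longlonglongrightarrow> Q (Complex x 0)"
      by (intro continuous_on_tendsto_compose[OF cont]) auto
    thus ?thesis unfolding q_def by (simp add: complex_of_real_def)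
  qed
  let ?Q = "\<lambda>x. Q (complex_of_real x)"
  let ?D = "\<lambda>n x. cmod (?Q x) + cmod (q n x) - cmod (q n x - ?Q x)"
  \<comment> \<open>Scheffe's argument: \<open>|Q| + |q n| - |q n - Q|\<close> is dominated by \<open>2 |Q|\<close> and tends to \<open>2 |Q|\<close>.\<close>
  have Dlim: "(\<lambda>n. LINT x|lborel. ?D n x) \<longlonglongrightarrow> (LINT x|lborel. 2 * cmod (?Q x))"
  proof (rule integral_dominated_convergence[where w = "\<lambda>x. 2 * cmod (?Q x)"])
    show "AE x in lborel. (\<lambda>n. ?D n x) \<longlonglongrightarrow> 2 * cmod (?Q x)"
    proof (rule AE_I2)
      fix x
      have "(\<lambda>n. ?D n x) \<longlonglongrightarrow> cmod (?Q x) + cmod (?Q x) - cmod (?Q x - ?Q x)"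
        by (intro tendsto_intros qlim)
      thus "(\<lambda>n. ?D n x) \<longlonglongrightarrow> 2 * cmod (?Q x)" by simp
    qed
    fix n show "AE x in lborel. norm (?D n x) \<le> 2 * cmod (?Q x)"
    proof (rule AE_I2)
      fix x
      have "cmod (q n x - ?Q x) \<le> cmod (q n x) + cmod (?Q x)" by (rule norm_triangle_ineq4)
      moreover have "cmod (q n x) \<le> cmod (q n x - ?Q x) + cmod (?Q x)" using norm_triangle_ineq[of "q n x - ?Q x" "?Q x"] by simp
      ultimately show "norm (?D n x) \<le> 2 * cmod (?Q x)" by simp
    qed
    show "?D n \<in> borel_measurable lborel"
      using borel_measurable_integrable[OF qint[of n]] borel_measurable_integrable[OF int] by measurable
  qed (use int in auto)
  have "cmod (LINT x|lborel. ?Q x) \<le> 0"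
  proof (rule LIMSEQ_le_const)
    have "(\<lambda>n. ?N + exp (C * d n) * ?N - (LINT x|lborel. ?D n x)) \<longlonglongrightarrow> ?N + exp (C * 0) * ?N - (LINT x|lborel. 2 * cmod (?Q x))"
      by (intro tendsto_intros dlim Dlim)
    thus "(\<lambda>n. ?N + exp (C * d n) * ?N - (LINT x|lborel. ?D n x)) \<longlonglongrightarrow> 0" by simp
    show "\<exists>N. \<forall>n\<ge>N. cmod (LINT x|lborel. ?Q x) \<le> ?N + exp (C * d n) * ?N - (LINT x|lborel. ?D n x)"
    proof (intro exI allI impI)
      fix n :: nat
      have "(LINT x|lborel. q n x) = 0" unfolding q_def by (rule shift0[OF d0])
      hence "cmod (LINT x|lborel. ?Q x) = cmod ((LINT x|lborel. q n x) - (LINT x|lborel. ?Q x))" by simp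
      also have "(LINT x|lborel. q n x) - (LINT x|lborel. ?Q x) = (LINT x|lborel. q n x - ?Q x)"
        using qint int by simp
      also have "cmod \<dots> \<le> (LINT x|lborel. cmod (q n x - ?Q x))" by (rule integral_norm_bound)
      also have "\<dots> = (LINT x|lborel. cmod (?Q x) + cmod (q n x) - ?D n x)" by simp
      also have "\<dots> = ?N + (LINT x|lborel. cmod (q n x)) - (LINT x|lborel. ?D n x)"
        using qint[of n] int by (subst Bochner_Integration.integral_diff) auto
      also have "\<dots> \<le> ?N + exp (C * d n) * ?N - (LINT x|lborel. ?D n x)" using qle[of n] by simp
      finally show "cmod (LINT x|lborel. ?Q x) \<le> ?N + exp (C * d n) * ?N - (LINT x|lborel. ?D n x)" .
    qed
  qed
  thus ?thesis by simp
qed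

section \<open>Cauchy and Poisson formulas on the real line\<close>

lemma integral_cauchy_schwarz:
  fixes f g :: "real \<Rightarrow> complex"
  assumes f [measurable]: "f \<in> borel_measurable borel" and g [measurable]: "g \<in> borel_measurable borel"
    and f2: "integrable lborel (\<lambda>t. (cmod (f t))\<^sup>2)" and g2: "integrable lborel (\<lambda>t. (cmod (g t))\<^sup>2)"
  shows "integrable lborel (\<lambda>t. f t * g t)"
    "(cmod (LINT t|lborel. f t * g t))\<^sup>2 \<le> (LINT t|lborel. (cmod (f t))\<^sup>2) * (LINT t|lborel. (cmod (g t))\<^sup>2)"
proof -
  show I: "integrable lborel (\<lambda>t. f t * g t)"
  proof (rule Bochner_Integration.integrable_bound)
    show "integrable lborel (\<lambda>t. (cmod (f t))\<^sup>2 + (cmod (g t))\<^sup>2)" using f2 g2 by simp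
    show "AE t in lborel. norm (f t * g t) \<le> norm ((cmod (f t))\<^sup>2 + (cmod (g t))\<^sup>2)"
    proof (rule AE_I2)
      fix t
      have "2 * cmod (f t) * cmod (g t) \<le> (cmod (f t))\<^sup>2 + (cmod (g t))\<^sup>2" by (rule sum_squares_bound)
      moreover have "0 \<le> cmod (f t) * cmod (g t)" by simp
      ultimately have "cmod (f t) * cmod (g t) \<le> (cmod (f t))\<^sup>2 + (cmod (g t))\<^sup>2" by linarith
      thus "norm (f t * g t) \<le> norm ((cmod (f t))\<^sup>2 + (cmod (g t))\<^sup>2)" by (simp add: norm_mult)
    qed
  qed simp
  let ?I = "LINT t|lborel. cmod (f t * g t)"
  let ?A = "LINT t|lborel. (cmod (f t))\<^sup>2" and ?B = "LINT t|lborel. (cmod (g t))\<^sup>2"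
  have "ennreal (?I\<^sup>2) = (ennreal ?I)\<^sup>2" by (simp add: ennreal_power)
  also have "ennreal ?I = (\<integral>\<^sup>+t. ennreal (cmod (f t)) * ennreal (cmod (g t)) \<partial>lborel)"
    by (subst nn_integral_eq_integral[OF integrable_norm[OF I], symmetric]) (auto simp: norm_mult ennreal_mult)
  also have "(\<integral>\<^sup>+t. ennreal (cmod (f t)) * ennreal (cmod (g t)) \<partial>lborel)\<^sup>2 \<le>
    (\<integral>\<^sup>+t. ennreal (cmod (f t)) ^ 2 \<partial>lborel) * (\<integral>\<^sup>+t. ennreal (cmod (g t)) ^ 2 \<partial>lborel)"
    by (rule Cauchy_Schwarz_nn_integral) auto
  also have "(\<integral>\<^sup>+t. ennreal (cmod (f t)) ^ 2 \<partial>lborel) = ennreal ?A"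
    using f2 by (subst nn_integral_eq_integral[symmetric]) (auto simp: ennreal_power)
  also have "(\<integral>\<^sup>+t. ennreal (cmod (g t)) ^ 2 \<partial>lborel) = ennreal ?B"
    using g2 by (subst nn_integral_eq_integral[symmetric]) (auto simp: ennreal_power)
  finally have "ennreal (?I\<^sup>2) \<le> ennreal (?A * ?B)" by (simp add: ennreal_mult)
  hence "?I\<^sup>2 \<le> ?A * ?B" by (subst (asm) ennreal_le_iff) auto
  moreover have "(cmod (LINT t|lborel. f t * g t))\<^sup>2 \<le> ?I\<^sup>2" by (intro power_mono integral_norm_bound) simp
  ultimately show "(cmod (LINT t|lborel. f t * g t))\<^sup>2 \<le> ?A * ?B" by linarith
qed

lemma connected_upper_half_plane: "connected upper_half_plane"
  unfolding upper_half_plane_def by (intro convex_connected convex_halfspace_Im_gt)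

text \<open>Needed because the denominators in the definition of bounded type are merely not identically zero.\<close>

lemma holomorphic_mult_not_identically_zero:
  assumes k: "k1 holomorphic_on upper_half_plane" "k2 holomorphic_on upper_half_plane"
    and a: "a \<in> upper_half_plane" "k1 a \<noteq> 0" and b: "b \<in> upper_half_plane" "k2 b \<noteq> 0"
  shows "\<exists>z\<in>upper_half_plane. k1 z * k2 z \<noteq> 0"
proof (rule ccontr)
  assume "\<not> ?thesis"
  hence z: "k1 z = 0 \<or> k2 z = 0" if "z \<in> upper_half_plane" for z using that by auto
  define U where "U = upper_half_plane \<inter> k1 -` (-{0})"
  have "open U" unfolding U_def
    by (rule continuous_open_preimage[OF holomorphic_on_imp_continuous_on[OF k(1)] open_upper_half_plane]) auto
  hence "k2 b = (\<lambda>_. 0) b"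
    by (rule analytic_continuation_open[OF _ open_upper_half_plane _ connected_upper_half_plane _ k(2), of U])
      (use z a b in \<open>auto simp: U_def\<close>)
  with b show False by simp
qed

lemma bounded_mult_image:
  fixes f g :: "complex \<Rightarrow> complex"
  assumes "bounded (f ` S)" "bounded (g ` S)"
  shows "bounded ((\<lambda>z. f z * g z) ` S)"
proof -
  obtain a b where a: "\<And>z. z \<in> S \<Longrightarrow> cmod (f z) \<le> a" and b: "\<And>z. z \<in> S \<Longrightarrow> cmod (g z) \<le> b"
    using assms unfolding bounded_iff by auto
  show ?thesis unfolding bounded_iff
  proof (intro exI ballI)
    fix w assume "w \<in> (\<lambda>z. f z * g z) ` S"
    then obtain z where z: "z \<in> S" "w = f z * g z" by auto
    have "cmod (f z) * cmod (g z) \<le> \<bar>a\<bar> * \<bar>b\<bar>" using a[OF z(1)] b[OF z(1)] by (intro mult_mono) auto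
    thus "cmod w \<le> \<bar>a\<bar> * \<bar>b\<bar>" using z by (simp add: norm_mult)
  qed
qed

lemma bounded_typeI:
  assumes "h holomorphic_on upper_half_plane"
    "g holomorphic_on upper_half_plane" "bounded (g ` upper_half_plane)"
    "k holomorphic_on upper_half_plane" "bounded (k ` upper_half_plane)"
    "\<exists>z\<in>upper_half_plane. k z \<noteq> 0"
    "\<And>z. z \<in> upper_half_plane \<Longrightarrow> k z \<noteq> 0 \<Longrightarrow> h z = g z / k z"
  shows "bounded_type h"
  unfolding bounded_type_def using assms by blast

lemma bounded_type_bounded:
  assumes "h holomorphic_on upper_half_plane" "\<And>z. Im z > 0 \<Longrightarrow> cmod (h z) \<le> M"
  shows "bounded_type h"
proof (rule bounded_typeI[of h h "\<lambda>_. 1"])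
  show "\<exists>z\<in>upper_half_plane. (1::complex) \<noteq> 0" by (intro bexI[of _ \<i>]) (auto simp: upper_half_plane_def)
qed (use assms in \<open>auto simp: bounded_iff upper_half_plane_def\<close>)

lemma bounded_type_mult:
  assumes "bounded_type f" "bounded_type h"
  shows "bounded_type (\<lambda>z. f z * h z)"
proof -
  from assms(1) obtain g1 k1 a where 1: "f holomorphic_on upper_half_plane" "g1 holomorphic_on upper_half_plane" "k1 holomorphic_on upper_half_plane"
    "bounded (g1 ` upper_half_plane)" "bounded (k1 ` upper_half_plane)" "a \<in> upper_half_plane" "k1 a \<noteq> 0"
    "\<And>z. z \<in> upper_half_plane \<Longrightarrow> k1 z \<noteq> 0 \<Longrightarrow> f z = g1 z / k1 z"
    unfolding bounded_type_def by metis
  from assms(2) obtain g2 k2 b where 2: "h holomorphic_on upper_half_plane" "g2 holomorphic_on upper_half_plane" "k2 holomorphic_on upper_half_plane"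
    "bounded (g2 ` upper_half_plane)" "bounded (k2 ` upper_half_plane)" "b \<in> upper_half_plane" "k2 b \<noteq> 0"
    "\<And>z. z \<in> upper_half_plane \<Longrightarrow> k2 z \<noteq> 0 \<Longrightarrow> h z = g2 z / k2 z"
    unfolding bounded_type_def by metis
  show ?thesis
  proof (rule bounded_typeI[of _ "\<lambda>z. g1 z * g2 z" "\<lambda>z. k1 z * k2 z"])
    show "\<exists>z\<in>upper_half_plane. k1 z * k2 z \<noteq> 0"
      by (rule holomorphic_mult_not_identically_zero[OF 1(3) 2(3) 1(6,7) 2(6,7)])
  qed (use 1 2 in \<open>auto intro!: holomorphic_intros bounded_mult_image\<close>)
qed

lemma bounded_type_add:
  assumes "bounded_type f" "bounded_type h"
  shows "bounded_type (\<lambda>z. f z + h z)"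
proof -
  from assms(1) obtain g1 k1 a where 1: "f holomorphic_on upper_half_plane" "g1 holomorphic_on upper_half_plane" "k1 holomorphic_on upper_half_plane"
    "bounded (g1 ` upper_half_plane)" "bounded (k1 ` upper_half_plane)" "a \<in> upper_half_plane" "k1 a \<noteq> 0"
    "\<And>z. z \<in> upper_half_plane \<Longrightarrow> k1 z \<noteq> 0 \<Longrightarrow> f z = g1 z / k1 z"
    unfolding bounded_type_def by metis
  from assms(2) obtain g2 k2 b where 2: "h holomorphic_on upper_half_plane" "g2 holomorphic_on upper_half_plane" "k2 holomorphic_on upper_half_plane"
    "bounded (g2 ` upper_half_plane)" "bounded (k2 ` upper_half_plane)" "b \<in> upper_half_plane" "k2 b \<noteq> 0"
    "\<And>z. z \<in> upper_half_plane \<Longrightarrow> k2 z \<noteq> 0 \<Longrightarrow> h z = g2 z / k2 z"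
    unfolding bounded_type_def by metis
  show ?thesis
  proof (rule bounded_typeI[of _ "\<lambda>z. g1 z * k2 z + g2 z * k1 z" "\<lambda>z. k1 z * k2 z"])
    show "\<exists>z\<in>upper_half_plane. k1 z * k2 z \<noteq> 0"
      by (rule holomorphic_mult_not_identically_zero[OF 1(3) 2(3) 1(6,7) 2(6,7)])
    show "f z + h z = (g1 z * k2 z + g2 z * k1 z) / (k1 z * k2 z)"
      if "z \<in> upper_half_plane" "k1 z * k2 z \<noteq> 0" for z
      using 1(8)[of z] 2(8)[of z] that by (auto simp: add_divide_distrib)
    show "bounded ((\<lambda>z. g1 z * k2 z + g2 z * k1 z) ` upper_half_plane)"
      by (intro bounded_plus_comp bounded_mult_image 1 2)
  qed (use 1 2 in \<open>auto intro!: holomorphic_intros bounded_mult_image\<close>)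
qed

lemma smirnov_bounded:
  assumes "continuous_on {z. Im z \<ge> 0} h" "h holomorphic_on upper_half_plane" "\<And>z. Im z > 0 \<Longrightarrow> cmod (h z) \<le> M"
  shows "smirnov h"
  unfolding smirnov_def
proof (intro conjI allI impI)
  show "bounded_type h" by (rule bounded_type_bounded[OF assms(2,3)])
  fix e :: real assume "e > 0"
  hence "eventually (\<lambda>y. M \<le> exp (e * y)) at_top" by real_asymp
  thus "eventually (\<lambda>y. cmod (h (\<i> * of_real y)) \<le> exp (e * y)) at_top"
    using eventually_gt_at_top[of 0]
  proof eventually_elim
    case (elim y)
    thus ?case using assms(3)[of "\<i> * of_real y"] by simp
  qed
qed (fact assms)

lemma smirnov_mult:
  assumes "smirnov f" "smirnov h"
  shows "smirnov (\<lambda>z. f z * h z)"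
  unfolding smirnov_def
proof (intro conjI allI impI)
  show "continuous_on {z. Im z \<ge> 0} (\<lambda>z. f z * h z)" "bounded_type (\<lambda>z. f z * h z)"
    using assms by (auto simp: smirnov_def intro!: continuous_intros bounded_type_mult)
  fix e :: real assume "e > 0"
  hence "eventually (\<lambda>y. cmod (f (\<i> * of_real y)) \<le> exp (e/2 * y)) at_top"
    "eventually (\<lambda>y. cmod (h (\<i> * of_real y)) \<le> exp (e/2 * y)) at_top"
    using assms unfolding smirnov_def by (metis half_gt_zero)+
  thus "eventually (\<lambda>y. cmod (f (\<i> * of_real y) * h (\<i> * of_real y)) \<le> exp (e * y)) at_top"
  proof eventually_elim
    case (elim y)
    hence "cmod (f (\<i> * of_real y)) * cmod (h (\<i> * of_real y)) \<le> exp (e/2 * y) * exp (e/2 * y)"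
      by (intro mult_mono) auto
    also have "\<dots> = exp (e * y)" by (simp add: exp_add[symmetric])
    finally show ?case by (simp add: norm_mult)
  qed
qed

lemma smirnov_add:
  assumes "smirnov f" "smirnov h"
  shows "smirnov (\<lambda>z. f z + h z)"
  unfolding smirnov_def
proof (intro conjI allI impI)
  show "continuous_on {z. Im z \<ge> 0} (\<lambda>z. f z + h z)" "bounded_type (\<lambda>z. f z + h z)"
    using assms by (auto simp: smirnov_def intro!: continuous_intros bounded_type_add)
  fix e :: real assume e: "e > 0"
  hence "eventually (\<lambda>y. cmod (f (\<i> * of_real y)) \<le> exp (e/2 * y)) at_top"
    "eventually (\<lambda>y. cmod (h (\<i> * of_real y)) \<le> exp (e/2 * y)) at_top"
    using assms unfolding smirnov_def by (metis half_gt_zero)+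
  moreover have "eventually (\<lambda>y. 2 * exp (e/2 * y) \<le> exp (e * y)) at_top" using e by real_asymp
  ultimately show "eventually (\<lambda>y. cmod (f (\<i> * of_real y) + h (\<i> * of_real y)) \<le> exp (e * y)) at_top"
    by eventually_elim (rule norm_triangle_le, simp)
qed

lemma smirnov_boundary_measurable: "smirnov h \<Longrightarrow> (\<lambda>t. h (complex_of_real t)) \<in> borel_measurable borel"
  by (rule boundary_measurable) (simp add: smirnov_def)

lemma norm_cauchy_factor_le:
  assumes "Im w > 0" "Im z > 0"
  shows "cmod (1 / (z - cnj w)) \<le> 1 / Im w"
proof -
  have "Im w \<le> Im (z - cnj w)" using assms by simp
  also have "\<dots> \<le> cmod (z - cnj w)" using abs_Im_le_cmod[of "z - cnj w"] by linarith
  finally show ?thesis using assms by (simp add: norm_divide frac_le)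
qed

lemma smirnov_cauchy_factor:
  assumes w: "Im w > 0" shows "smirnov (\<lambda>z. 1 / (z - cnj w))"
proof (rule smirnov_bounded)
  have nz: "z - cnj w \<noteq> 0" if "Im z \<ge> 0" for z using that w by (auto simp: complex_eq_iff)
  show "continuous_on {z. Im z \<ge> 0} (\<lambda>z. 1 / (z - cnj w))" by (intro continuous_intros) (use nz in auto)
  show "(\<lambda>z. 1 / (z - cnj w)) holomorphic_on upper_half_plane"
    by (intro holomorphic_intros) (use nz in \<open>auto simp: upper_half_plane_def\<close>)
  show "cmod (1 / (z - cnj w)) \<le> 1 / Im w" if "Im z > 0" for z
    by (rule norm_cauchy_factor_le[OF w that])
qed

lemma smirnov_const: "smirnov (\<lambda>_. c)"
  by (rule smirnov_bounded[of _ "cmod c"]) auto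

text \<open>Dividing out a zero \<open>w\<close> preserves the class: the Blaschke factor \<open>(z - w) / (z - cnj w)\<close> goes to the
denominator of the quotient and \<open>1 / (z - cnj w)\<close> to the numerator.\<close>

lemma smirnov_remove_zero:
  assumes q: "smirnov q" and w: "Im w > 0" and q0: "q w = 0"
  shows "smirnov (\<lambda>z. if z = w then deriv q w else q z / (z - w))" (is "smirnov ?r")
proof -
  have cont: "continuous_on {z. Im z \<ge> 0} q" and bt: "bounded_type q"
    and gr: "\<And>e. e > 0 \<Longrightarrow> eventually (\<lambda>y. cmod (q (\<i> * of_real y)) \<le> exp (e * y)) at_top"
    using q unfolding smirnov_def by auto
  have hol: "q holomorphic_on upper_half_plane" by (rule bounded_type_holomorphic[OF bt])
  have q0': "q z - q w = q z" for z using q0 by simp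
  have holr: "?r holomorphic_on upper_half_plane"
    using pole_lemma_open[OF hol open_upper_half_plane, of w] unfolding q0' .
  have contr: "continuous_on {z. Im z \<ge> 0} ?r"
  proof -
    let ?H = "{z. Im z \<ge> 0}"
    have un: "upper_half_plane \<union> (?H - {w}) = ?H" using w by (auto simp: upper_half_plane_def)
    have "continuous_on (upper_half_plane \<union> (?H - {w})) ?r"
    proof (rule continuous_on_Un_local_open)
      show "openin (top_of_set (upper_half_plane \<union> (?H - {w}))) upper_half_plane"
        by (rule open_subset) (use open_upper_half_plane in auto)
      show "openin (top_of_set (upper_half_plane \<union> (?H - {w}))) (?H - {w})"
        unfolding un by (rule openin_delete) auto
      show "continuous_on upper_half_plane ?r" by (rule holomorphic_on_imp_continuous_on[OF holr])
      have "continuous_on (?H - {w}) (\<lambda>z. q z / (z - w))"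
        by (intro continuous_intros continuous_on_subset[OF cont]) auto
      thus "continuous_on (?H - {w}) ?r" by (rule continuous_on_eq) auto
    qed
    thus ?thesis unfolding un .
  qed
  have btr: "bounded_type ?r"
  proof -
    from bt obtain g k a where 1: "g holomorphic_on upper_half_plane" "k holomorphic_on upper_half_plane"
      "bounded (g ` upper_half_plane)" "bounded (k ` upper_half_plane)" "a \<in> upper_half_plane" "k a \<noteq> 0"
      "\<And>z. z \<in> upper_half_plane \<Longrightarrow> k z \<noteq> 0 \<Longrightarrow> q z = g z / k z"
      unfolding bounded_type_def by metis
    have nz: "z - cnj w \<noteq> 0" if "z \<in> upper_half_plane" for z
      using that w by (auto simp: complex_eq_iff upper_half_plane_def)
    have b1: "bounded ((\<lambda>z. 1 / (z - cnj w)) ` upper_half_plane)"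
      unfolding bounded_iff using norm_cauchy_factor_le[OF w] by (auto simp: upper_half_plane_def)
    have b2: "bounded ((\<lambda>z. (z - w) / (z - cnj w)) ` upper_half_plane)"
    proof -
      have "cmod ((z - w) / (z - cnj w)) \<le> 1" if z: "z \<in> upper_half_plane" for z
      proof -
        have "(Im z - Im w)\<^sup>2 \<le> (Im z + Im w)\<^sup>2"
          using z w by (intro abs_le_square_iff[THEN iffD1]) (auto simp: upper_half_plane_def)
        hence "(cmod (z - w))\<^sup>2 \<le> (cmod (z - cnj w))\<^sup>2" by (simp add: cmod_power2)
        hence "cmod (z - w) \<le> cmod (z - cnj w)" by (rule power2_le_imp_le) simp
        thus ?thesis using nz[OF z] by (simp add: norm_divide)
      qed
      thus ?thesis unfolding bounded_iff by blast
    qed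
    have h1: "(\<lambda>z. 1 / (z - cnj w)) holomorphic_on upper_half_plane"
      and h2: "(\<lambda>z. (z - w) / (z - cnj w)) holomorphic_on upper_half_plane"
      by (intro holomorphic_intros; use nz in auto)+
    define b where "b = w + \<i>"
    have b: "b \<in> upper_half_plane" "(b - w) / (b - cnj w) \<noteq> 0"
      using w nz[of b] by (auto simp: b_def upper_half_plane_def)
    show ?thesis
    proof (rule bounded_typeI[of _ "\<lambda>z. g z * (1 / (z - cnj w))" "\<lambda>z. k z * ((z - w) / (z - cnj w))"])
      show "\<exists>z\<in>upper_half_plane. k z * ((z - w) / (z - cnj w)) \<noteq> 0"
        by (rule holomorphic_mult_not_identically_zero[OF 1(2) h2 1(5,6) b])
      show "?r z = g z * (1 / (z - cnj w)) / (k z * ((z - w) / (z - cnj w)))"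
        if "z \<in> upper_half_plane" "k z * ((z - w) / (z - cnj w)) \<noteq> 0" for z
        using 1(7)[of z] nz[of z] that by auto
    qed (rule holr holomorphic_on_mult[OF 1(1) h1] bounded_mult_image[OF 1(3) b1]
        holomorphic_on_mult[OF 1(2) h2] bounded_mult_image[OF 1(4) b2])+
  qed
  show ?thesis unfolding smirnov_def
  proof (intro conjI contr btr allI impI)
    fix e :: real assume "e > 0"
    from gr[OF this] eventually_ge_at_top[of "Im w + 1"]
    show "eventually (\<lambda>y. cmod (?r (\<i> * of_real y)) \<le> exp (e * y)) at_top"
    proof eventually_elim
      case (elim y)
      have ne: "\<i> * of_real y \<noteq> w" using elim(2) by auto
      have "1 \<le> Im (\<i> * of_real y - w)" using elim(2) by simp
      also have "\<dots> \<le> cmod (\<i> * of_real y - w)" using abs_Im_le_cmod[of "\<i> * of_real y - w"] by linarith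
      finally have "cmod (q (\<i> * of_real y)) / cmod (\<i> * of_real y - w) \<le> cmod (q (\<i> * of_real y)) / 1"
        by (intro divide_left_mono) auto
      thus ?case using elim(1) ne by (simp add: norm_divide)
    qed
  qed
qed

lemma mult_cnj_diff_real: "(of_real t - w) * (of_real t - cnj w) = of_real ((cmod (of_real t - w))\<^sup>2)"
  unfolding complex_norm_square by simp

lemma inverse_cmod_power2_eq: "Im w > 0 \<Longrightarrow> 1 / (cmod (of_real t - w))\<^sup>2 = pi / Im w * hp_poisson w t"
  by (simp add: hp_poisson_def)

lemma inverse_cmod_power2_lborel:
  assumes "Im w > 0"
  shows "integrable lborel (\<lambda>t. 1 / (cmod (of_real t - w))\<^sup>2)" "(LINT t|lborel. 1 / (cmod (of_real t - w))\<^sup>2) = pi / Im w"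
  unfolding inverse_cmod_power2_eq[OF assms] using hp_poisson_lborel[OF assms] by simp_all

lemma cmod_real_minus_cnj: "cmod (of_real t - cnj w) = cmod (of_real t - w)"
  by (metis complex_cnj_diff complex_cnj_complex_of_real complex_mod_cnj)

text \<open>Both parts are vanishing integrals: the first of \<open>q / (z - cnj w)\<close>, the second of
\<open>(q - q w (w - cnj w) / (z - cnj w)) / (z - w)\<close>, whose numerator vanishes at \<open>w\<close> and for which the
subtracted term integrates to \<open>2 \<pi> \<i> q w\<close>.\<close>

lemma smirnov_cauchy_formula:
  fixes q :: "complex \<Rightarrow> complex"
  assumes q: "smirnov q" and w: "Im w > 0" and int: "integrable lborel (\<lambda>t. q (of_real t) / (of_real t - w))"
  shows "(LINT t|lborel. q (of_real t) / (of_real t - cnj w)) = 0"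
    "(LINT t|lborel. q (of_real t) / (of_real t - w)) = 2 * pi * \<i> * q w"
proof -
  have mq [measurable]: "(\<lambda>t. q (complex_of_real t)) \<in> borel_measurable borel" by (rule smirnov_boundary_measurable[OF q])
  have int': "integrable lborel (\<lambda>t. q (of_real t) * (1 / (of_real t - cnj w)))"
    by (rule Bochner_Integration.integrable_bound[OF int]) (auto simp: norm_divide cmod_real_minus_cnj)
  have "(LINT t|lborel. q (of_real t) * (1 / (of_real t - cnj w))) = 0"
    by (rule smirnov_integral_eq_0[OF smirnov_mult[OF q smirnov_cauchy_factor[OF w]] int'])
  thus "(LINT t|lborel. q (of_real t) / (of_real t - cnj w)) = 0" by simp
  define c where "c = q w * (w - cnj w)"
  define N where "N = (\<lambda>z. q z + - c * (1 / (z - cnj w)))"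
  have ww: "w - cnj w \<noteq> 0" using w by (auto simp: complex_eq_iff)
  have N: "smirnov N" unfolding N_def by (intro smirnov_add smirnov_mult q smirnov_const smirnov_cauchy_factor w)
  have N0: "N w = 0" unfolding N_def c_def using ww by simp
  define r where "r = (\<lambda>z. if z = w then deriv N w else N z / (z - w))"
  have r: "smirnov r" unfolding r_def by (rule smirnov_remove_zero[OF N w N0])
  have rt: "r (of_real t) = q (of_real t) / (of_real t - w) - c * of_real (1 / (cmod (of_real t - w))\<^sup>2)" for t
  proof -
    have nw: "of_real t - w \<noteq> 0" "of_real t - cnj w \<noteq> 0" using w by (auto simp: complex_eq_iff)
    have "of_real (1 / (cmod (of_real t - w))\<^sup>2) = 1 / ((of_real t - w) * (of_real t - cnj w))"
      unfolding mult_cnj_diff_real by simp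
    thus ?thesis using nw unfolding r_def N_def by (auto simp: diff_divide_distrib)
  qed
  have I2: "integrable lborel (\<lambda>t. c * of_real (1 / (cmod (of_real t - w))\<^sup>2))"
    using inverse_cmod_power2_lborel(1)[OF w] by (intro integrable_mult_right integrable_of_real)
  have "integrable lborel (\<lambda>t. r (of_real t))" unfolding rt using int I2 by (rule Bochner_Integration.integrable_diff)
  from smirnov_integral_eq_0[OF r this]
  have "(LINT t|lborel. q (of_real t) / (of_real t - w) - c * of_real (1 / (cmod (of_real t - w))\<^sup>2)) = 0"
    unfolding rt .
  hence "(LINT t|lborel. q (of_real t) / (of_real t - w)) = (LINT t|lborel. c * of_real (1 / (cmod (of_real t - w))\<^sup>2))"
    using int I2 by (subst (asm) Bochner_Integration.integral_diff) auto
  also have "\<dots> = c * of_real (LINT t|lborel. 1 / (cmod (of_real t - w))\<^sup>2)"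
    by (simp only: integral_mult_right_zero integral_complex_of_real)
  also have "\<dots> = c * of_real (pi / Im w)" unfolding inverse_cmod_power2_lborel(2)[OF w] ..
  also have "w - cnj w = 2 * \<i> * of_real (Im w)" by (simp add: complex_eq_iff)
  hence "c * of_real (pi / Im w) = 2 * pi * \<i> * q w" unfolding c_def using w by simp
  finally show "(LINT t|lborel. q (of_real t) / (of_real t - w)) = 2 * pi * \<i> * q w" .
qed

lemma smirnov_poisson_formula:
  fixes q :: "complex \<Rightarrow> complex"
  assumes q: "smirnov q" and w: "Im w > 0" and int: "integrable lborel (\<lambda>t. q (of_real t) / of_real ((cmod (of_real t - w))\<^sup>2))"
  shows "(LINT t|lborel. q (of_real t) / of_real ((cmod (of_real t - w))\<^sup>2)) = pi / Im w * q w"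
proof -
  define f where "f = (\<lambda>z. q z * (1 / (z - cnj w)))"
  have f: "smirnov f" unfolding f_def by (intro smirnov_mult q smirnov_cauchy_factor w)
  have ft: "f (of_real t) / (of_real t - w) = q (of_real t) / of_real ((cmod (of_real t - w))\<^sup>2)" for t
  proof -
    have "complex_of_real ((cmod (of_real t - w))\<^sup>2) = (of_real t - w) * (of_real t - cnj w)"
      by (rule mult_cnj_diff_real[symmetric])
    thus ?thesis unfolding f_def by (simp only:) (simp add: mult.commute)
  qed
  have "(LINT t|lborel. f (of_real t) / (of_real t - w)) = 2 * pi * \<i> * f w"
    by (rule smirnov_cauchy_formula(2)[OF f w]) (use int in \<open>simp add: ft\<close>)
  moreover have e: "w - cnj w = 2 * \<i> * of_real (Im w)" by (simp add: complex_eq_iff)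
  have "2 * pi * \<i> * f w = pi / Im w * q w" unfolding f_def e using w by simp
  ultimately show ?thesis unfolding ft by simp
qed

section \<open>Inner functions and their model spaces\<close>

definition inner_function :: "(complex \<Rightarrow> complex) \<Rightarrow> bool" where
  "inner_function \<Phi> \<longleftrightarrow> continuous_on {z. Im z \<ge> 0} \<Phi> \<and> \<Phi> holomorphic_on upper_half_plane \<and>
     (\<forall>z. Im z > 0 \<longrightarrow> cmod (\<Phi> z) < 1) \<and> (\<forall>t. cmod (\<Phi> (complex_of_real t)) = 1)"

text \<open>For the inner function \<open>\<Phi> = E\<^sup>* / E\<close> and \<open>f\<close> in the de Branges space of \<open>E\<close>, the functions \<open>u = f / E\<close> and
\<open>v = f\<^sup>* / E\<close> form such a pair. Intrinsically, \<open>u\<close> runs through the model space of square integrable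
boundary functions orthogonal to \<open>\<Phi>\<close> times the Hardy space, and \<open>v\<close> is its companion under the natural
conjugation.\<close>

definition model_pair :: "(complex \<Rightarrow> complex) \<Rightarrow> (complex \<Rightarrow> complex) \<Rightarrow> (complex \<Rightarrow> complex) \<Rightarrow> bool" where
  "model_pair \<Phi> u v \<longleftrightarrow> smirnov u \<and> smirnov v \<and>
     (\<forall>t. v (complex_of_real t) = \<Phi> (complex_of_real t) * cnj (u (complex_of_real t))) \<and>
     integrable lborel (\<lambda>t. (cmod (u (complex_of_real t)))\<^sup>2)"

lemma inner_smirnov: "inner_function \<Phi> \<Longrightarrow> smirnov \<Phi>"
  by (rule smirnov_bounded[of _ 1]) (auto simp: inner_function_def intro: less_imp_le)

lemma inner_norm: "inner_function \<Phi> \<Longrightarrow> cmod (\<Phi> (complex_of_real t)) = 1"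
  "inner_function \<Phi> \<Longrightarrow> Im z > 0 \<Longrightarrow> cmod (\<Phi> z) < 1"
  by (auto simp: inner_function_def)

lemma inner_cnj: "inner_function \<Phi> \<Longrightarrow> cnj (\<Phi> (complex_of_real t)) * \<Phi> (complex_of_real t) = 1"
  using inner_norm(1)[of \<Phi> t] complex_norm_square[of "\<Phi> (of_real t)"] by (simp add: mult.commute)

lemma model_pair_swap:
  assumes \<Phi>: "inner_function \<Phi>" and uv: "model_pair \<Phi> u v"
  shows "model_pair \<Phi> v u" "cmod (v (of_real t)) = cmod (u (of_real t))"
proof -
  show n: "cmod (v (of_real t)) = cmod (u (of_real t))" for t
    using uv inner_norm(1)[OF \<Phi>] by (simp add: model_pair_def norm_mult)
  have "u (of_real t) = \<Phi> (of_real t) * cnj (v (of_real t))" for t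
    using uv inner_cnj[OF \<Phi>, of t] by (simp add: model_pair_def mult_ac)
  moreover have "integrable lborel (\<lambda>t. (cmod (v (of_real t)))\<^sup>2)"
    using uv unfolding n by (simp add: model_pair_def)
  ultimately show "model_pair \<Phi> v u" using uv unfolding model_pair_def by blast
qed

lemma model_kernel_norm:
  assumes \<Phi>: "inner_function \<Phi>" and w: "Im w > 0"
  shows "integrable lborel (\<lambda>t. (cmod ((1 - \<Phi> w * cnj (\<Phi> (of_real t))) / (of_real t - w)))\<^sup>2)"
    "(LINT t|lborel. (cmod ((1 - \<Phi> w * cnj (\<Phi> (of_real t))) / (of_real t - w)))\<^sup>2) = pi * (1 - (cmod (\<Phi> w))\<^sup>2) / Im w"
proof -
  have mP [measurable]: "(\<lambda>t. \<Phi> (complex_of_real t)) \<in> borel_measurable borel"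
    by (rule smirnov_boundary_measurable[OF inner_smirnov[OF \<Phi>]])
  have IP: "integrable lborel (\<lambda>t. \<Phi> (of_real t) / of_real ((cmod (of_real t - w))\<^sup>2))"
    by (rule Bochner_Integration.integrable_bound[OF inverse_cmod_power2_lborel(1)[OF w]])
      (auto simp: norm_divide norm_power inner_norm(1)[OF \<Phi>])
  have eq: "(cmod ((1 - \<Phi> w * cnj (\<Phi> (of_real t))) / (of_real t - w)))\<^sup>2 =
     (1 + (cmod (\<Phi> w))\<^sup>2) * (1 / (cmod (of_real t - w))\<^sup>2) - 2 * Re (cnj (\<Phi> w) * (\<Phi> (of_real t) / of_real ((cmod (of_real t - w))\<^sup>2)))" for t
  proof -
    have "(cmod (1 - \<Phi> w * cnj (\<Phi> (of_real t))))\<^sup>2 = 1 + (cmod (\<Phi> w))\<^sup>2 * (cmod (\<Phi> (of_real t)))\<^sup>2 - 2 * Re (cnj (\<Phi> w) * \<Phi> (of_real t))"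
      unfolding cmod_power2 by (simp add: power2_eq_square algebra_simps)
    hence "(cmod ((1 - \<Phi> w * cnj (\<Phi> (of_real t))) / (of_real t - w)))\<^sup>2 =
      (1 + (cmod (\<Phi> w))\<^sup>2 - 2 * Re (cnj (\<Phi> w) * \<Phi> (of_real t))) / (cmod (of_real t - w))\<^sup>2"
      by (simp add: norm_divide power_divide inner_norm(1)[OF \<Phi>])
    also have "Re (cnj (\<Phi> w) * (\<Phi> (of_real t) / of_real ((cmod (of_real t - w))\<^sup>2))) = Re (cnj (\<Phi> w) * \<Phi> (of_real t)) / (cmod (of_real t - w))\<^sup>2"
      by (simp only: times_divide_eq_right Re_divide_of_real)
    ultimately show ?thesis by (simp add: diff_divide_distrib)
  qed
  have I2: "integrable lborel (\<lambda>t. Re (cnj (\<Phi> w) * (\<Phi> (of_real t) / of_real ((cmod (of_real t - w))\<^sup>2))))"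
    by (intro integrable_Re integrable_mult_right IP)
  have I1: "integrable lborel (\<lambda>t. (1 + (cmod (\<Phi> w))\<^sup>2) * (1 / (cmod (of_real t - w))\<^sup>2))"
    by (intro integrable_mult_right inverse_cmod_power2_lborel w)
  show "integrable lborel (\<lambda>t. (cmod ((1 - \<Phi> w * cnj (\<Phi> (of_real t))) / (of_real t - w)))\<^sup>2)"
    unfolding eq by (rule Bochner_Integration.integrable_diff[OF I1 integrable_mult_right[OF I2]])
  have "(LINT t|lborel. (cmod ((1 - \<Phi> w * cnj (\<Phi> (of_real t))) / (of_real t - w)))\<^sup>2) =
    (1 + (cmod (\<Phi> w))\<^sup>2) * (LINT t|lborel. 1 / (cmod (of_real t - w))\<^sup>2) - 2 * Re (cnj (\<Phi> w) * (LINT t|lborel. \<Phi> (of_real t) / of_real ((cmod (of_real t - w))\<^sup>2)))"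
  proof -
    have "(LINT t|lborel. Re (cnj (\<Phi> w) * (\<Phi> (of_real t) / of_real ((cmod (of_real t - w))\<^sup>2)))) =
      Re (cnj (\<Phi> w) * (LINT t|lborel. \<Phi> (of_real t) / of_real ((cmod (of_real t - w))\<^sup>2)))"
      using IP by (subst integral_Re) (simp_all only: integrable_mult_right integral_mult_right_zero)
    thus ?thesis unfolding eq
      by (subst Bochner_Integration.integral_diff[OF I1 integrable_mult_right[OF I2]]) (simp only: integral_mult_right_zero)
  qed
  also have "(LINT t|lborel. \<Phi> (of_real t) / of_real ((cmod (of_real t - w))\<^sup>2)) = pi / Im w * \<Phi> w"
    by (rule smirnov_poisson_formula[OF inner_smirnov[OF \<Phi>] w IP])
  also have "cnj (\<Phi> w) * (pi / Im w * \<Phi> w) = of_real (pi / Im w * (cmod (\<Phi> w))\<^sup>2)"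
    by (simp only: of_real_mult complex_norm_square of_real_divide) (simp add: mult_ac)
  also have "(LINT t|lborel. 1 / (cmod (of_real t - w))\<^sup>2) = pi / Im w" by (rule inverse_cmod_power2_lborel(2)[OF w])
  also have "(1 + (cmod (\<Phi> w))\<^sup>2) * (pi / Im w) - 2 * Re (complex_of_real (pi / Im w * (cmod (\<Phi> w))\<^sup>2)) = pi * (1 - (cmod (\<Phi> w))\<^sup>2) / Im w"
    unfolding Re_complex_of_real using w by (simp add: field_simps)
  finally show "(LINT t|lborel. (cmod ((1 - \<Phi> w * cnj (\<Phi> (of_real t))) / (of_real t - w)))\<^sup>2) = pi * (1 - (cmod (\<Phi> w))\<^sup>2) / Im w" .
qed

text \<open>The Cauchy formula for \<open>u\<close> minus \<open>\<Phi> w\<close> times the conjugate of the vanishing Cauchy integral of \<open>v\<close> at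
\<open>cnj w\<close>.\<close>

lemma model_reproducing:
  assumes \<Phi>: "inner_function \<Phi>" and uv: "model_pair \<Phi> u v" and w: "Im w > 0"
  shows "(LINT t|lborel. u (of_real t) * ((1 - \<Phi> w * cnj (\<Phi> (of_real t))) / (of_real t - w))) = 2 * pi * \<i> * u w"
proof -
  have u: "smirnov u" and v: "smirnov v" and vt: "\<And>t. v (of_real t) = \<Phi> (of_real t) * cnj (u (of_real t))"
    and u2: "integrable lborel (\<lambda>t. (cmod (u (of_real t)))\<^sup>2)"
    using uv unfolding model_pair_def by auto
  have mc: "(\<lambda>t. 1 / (complex_of_real t - w)) \<in> borel_measurable borel" by simp
  have c2: "integrable lborel (\<lambda>t. (cmod (1 / (complex_of_real t - w)))\<^sup>2)"
    using inverse_cmod_power2_lborel(1)[OF w] by (simp add: norm_divide power_divide)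
  have Iu: "integrable lborel (\<lambda>t. u (of_real t) / (of_real t - w))"
    using integral_cauchy_schwarz(1)[OF smirnov_boundary_measurable[OF u] mc u2 c2] by simp
  have v2: "integrable lborel (\<lambda>t. (cmod (v (of_real t)))\<^sup>2)" using u2 by (simp add: model_pair_swap(2)[OF \<Phi> uv])
  have Iv: "integrable lborel (\<lambda>t. v (of_real t) / (of_real t - w))"
    using integral_cauchy_schwarz(1)[OF smirnov_boundary_measurable[OF v] mc v2 c2] by simp
  have Iv': "integrable lborel (\<lambda>t. v (of_real t) / (of_real t - cnj w))"
    by (rule Bochner_Integration.integrable_bound[OF Iv]) (use smirnov_boundary_measurable[OF v] in \<open>auto simp: norm_divide cmod_real_minus_cnj\<close>)
  have eq: "cnj (v (of_real t) / (of_real t - cnj w)) = u (of_real t) * cnj (\<Phi> (of_real t)) / (of_real t - w)" for t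
    by (simp add: vt mult.commute)
  have "(LINT t|lborel. cnj (v (of_real t) / (of_real t - cnj w))) = 0"
    using smirnov_cauchy_formula(1)[OF v w Iv] by (simp only: Bochner_Integration.integral_cnj complex_cnj_zero)
  hence z: "(LINT t|lborel. u (of_real t) * cnj (\<Phi> (of_real t)) / (of_real t - w)) = 0" unfolding eq .
  have Iz: "integrable lborel (\<lambda>t. u (of_real t) * cnj (\<Phi> (of_real t)) / (of_real t - w))"
    using integrable_cnj[OF Iv'] unfolding eq .
  have "u (of_real t) * ((1 - \<Phi> w * cnj (\<Phi> (of_real t))) / (of_real t - w)) =
    u (of_real t) / (of_real t - w) - \<Phi> w * (u (of_real t) * cnj (\<Phi> (of_real t)) / (of_real t - w))" for t
    by (simp add: right_diff_distrib diff_divide_distrib mult_ac)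
  hence "(LINT t|lborel. u (of_real t) * ((1 - \<Phi> w * cnj (\<Phi> (of_real t))) / (of_real t - w))) =
    (LINT t|lborel. u (of_real t) / (of_real t - w)) - (LINT t|lborel. \<Phi> w * (u (of_real t) * cnj (\<Phi> (of_real t)) / (of_real t - w)))"
    using Iu Iz by (simp only:) (intro Bochner_Integration.integral_diff integrable_mult_right)
  also have "\<dots> = (LINT t|lborel. u (of_real t) / (of_real t - w))" by (simp only: integral_mult_right_zero z) simp
  also have "\<dots> = 2 * pi * \<i> * u w" by (rule smirnov_cauchy_formula(2)[OF u w Iu])
  finally show ?thesis .
qed

lemma inner_kernel_meas:
  assumes \<Phi>: "inner_function \<Phi>"
  shows "(\<lambda>t. (1 - \<Phi> w * cnj (\<Phi> (complex_of_real t))) / (of_real t - w)) \<in> borel_measurable borel"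
proof -
  have [measurable]: "(\<lambda>t. \<Phi> (complex_of_real t)) \<in> borel_measurable borel"
    by (rule smirnov_boundary_measurable[OF inner_smirnov[OF \<Phi>]])
  have "(\<lambda>t. cnj (\<Phi> (complex_of_real t))) \<in> borel_measurable borel"
    by (rule measurable_compose[OF _ borel_measurable_continuous_onI]) (auto intro!: continuous_intros)
  thus ?thesis by measurable
qed

text \<open>The Cauchy-Schwarz inequality for the reproducing formula; \<open>(1 - |\<Phi> w|\<^sup>2) / (4 \<pi> Im w)\<close> is the squared norm
of the evaluation functional at \<open>w\<close>.\<close>

lemma model_point_bound:
  assumes \<Phi>: "inner_function \<Phi>" and uv: "model_pair \<Phi> u v" and w: "Im w > 0"
  shows "(cmod (u w))\<^sup>2 \<le> (1 - (cmod (\<Phi> w))\<^sup>2) / (4 * pi * Im w) * (LINT t|lborel. (cmod (u (of_real t)))\<^sup>2)"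
proof -
  have u: "smirnov u" and u2: "integrable lborel (\<lambda>t. (cmod (u (of_real t)))\<^sup>2)"
    using uv unfolding model_pair_def by auto
  have "(cmod (2 * pi * \<i> * u w))\<^sup>2 \<le> (LINT t|lborel. (cmod (u (of_real t)))\<^sup>2) * (pi * (1 - (cmod (\<Phi> w))\<^sup>2) / Im w)"
    using integral_cauchy_schwarz(2)[OF smirnov_boundary_measurable[OF u] inner_kernel_meas[OF \<Phi>] u2 model_kernel_norm(1)[OF \<Phi> w]]
    unfolding model_reproducing[OF \<Phi> uv w] model_kernel_norm(2)[OF \<Phi> w] .
  hence "4 * pi\<^sup>2 * (cmod (u w))\<^sup>2 \<le> (LINT t|lborel. (cmod (u (of_real t)))\<^sup>2) * (pi * (1 - (cmod (\<Phi> w))\<^sup>2) / Im w)"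
    by (simp add: norm_mult power_mult_distrib)
  hence "4 * pi\<^sup>2 * (cmod (u w))\<^sup>2 / (4 * pi\<^sup>2) \<le>
    (LINT t|lborel. (cmod (u (of_real t)))\<^sup>2) * (pi * (1 - (cmod (\<Phi> w))\<^sup>2) / Im w) / (4 * pi\<^sup>2)"
    by (rule divide_right_mono) simp
  also have "N * (pi * k / Im w) / (4 * pi\<^sup>2) = k / (4 * pi * Im w) * N" for N k :: real
    using w by (simp add: power2_eq_square field_simps)
  finally show ?thesis by simp
qed

text \<open>The point bound applied to the reproducing kernel at \<open>a\<close>, which is itself a member of the model space.\<close>

lemma inner_schwarz_pick:
  assumes \<Phi>: "inner_function \<Phi>" and a: "Im a > 0" and w: "Im w > 0"
  shows "4 * Im w * Im a * (1 - cmod (\<Phi> a)) / ((cmod (w - cnj a))\<^sup>2 * (1 + cmod (\<Phi> a))) \<le> 1 - (cmod (\<Phi> w))\<^sup>2"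
proof -
  define u where "u = (\<lambda>z. (1 + - cnj (\<Phi> a) * \<Phi> z) * (1 / (z - cnj a)))"
  define N where "N = (\<lambda>z. \<Phi> z + - \<Phi> a)"
  define v where "v = (\<lambda>z. if z = a then deriv N a else N z / (z - a))"
  have u: "smirnov u" unfolding u_def
    by (intro smirnov_mult smirnov_add smirnov_const inner_smirnov \<Phi> smirnov_cauchy_factor a)
  have N: "smirnov N" unfolding N_def by (intro smirnov_add smirnov_const inner_smirnov \<Phi>)
  have v: "smirnov v" unfolding v_def by (rule smirnov_remove_zero[OF N a]) (simp add: N_def)
  have cu: "cnj (u (of_real t)) = (1 - \<Phi> a * cnj (\<Phi> (of_real t))) / (of_real t - a)" for t
    by (simp add: u_def)
  have vt: "v (of_real t) = \<Phi> (of_real t) * cnj (u (of_real t))" for t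
  proof -
    have "\<Phi> (of_real t) * (1 - \<Phi> a * cnj (\<Phi> (of_real t))) = \<Phi> (of_real t) - \<Phi> a * (cnj (\<Phi> (of_real t)) * \<Phi> (of_real t))"
      by (simp add: algebra_simps)
    also have "\<dots> = N (of_real t)" by (simp add: inner_cnj[OF \<Phi>] N_def)
    finally show ?thesis unfolding cu v_def using a by auto
  qed
  have nu: "(cmod (u (of_real t)))\<^sup>2 = (cmod ((1 - \<Phi> a * cnj (\<Phi> (of_real t))) / (of_real t - a)))\<^sup>2" for t
    unfolding cu[symmetric] complex_mod_cnj ..
  have uv: "model_pair \<Phi> u v" unfolding model_pair_def nu
    using u v vt model_kernel_norm(1)[OF \<Phi> a] by blast
  have b: "(cmod (u w))\<^sup>2 \<le> (1 - (cmod (\<Phi> w))\<^sup>2) / (4 * pi * Im w) * (pi * (1 - (cmod (\<Phi> a))\<^sup>2) / Im a)"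
    using model_point_bound[OF \<Phi> uv w] unfolding nu model_kernel_norm(2)[OF \<Phi> a] .
  let ?s = "cmod (\<Phi> a)" and ?D = "(cmod (w - cnj a))\<^sup>2" and ?p = "1 - (cmod (\<Phi> w))\<^sup>2"
  have s: "0 \<le> ?s" "?s < 1" using inner_norm(2)[OF \<Phi> a] by auto
  have D: "?D > 0" using a w by (auto simp: complex_eq_iff)
  have "1 - ?s \<le> cmod (1 - cnj (\<Phi> a) * \<Phi> w)"
  proof -
    have "?s * cmod (\<Phi> w) \<le> ?s * 1" using inner_norm(2)[OF \<Phi> w] s by (intro mult_left_mono) auto
    hence "1 - ?s \<le> cmod 1 - cmod (cnj (\<Phi> a) * \<Phi> w)" by (simp add: norm_mult)
    also have "\<dots> \<le> cmod (1 - cnj (\<Phi> a) * \<Phi> w)" by (rule norm_triangle_ineq2)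
    finally show ?thesis .
  qed
  hence "(1 - ?s)\<^sup>2 \<le> (cmod (1 - cnj (\<Phi> a) * \<Phi> w))\<^sup>2" using s by (intro power_mono) auto
  hence "(1 - ?s)\<^sup>2 / ?D \<le> (cmod (u w))\<^sup>2"
    using D by (simp add: u_def norm_mult norm_divide power_divide divide_right_mono)
  also note b
  also have "?p / (4 * pi * Im w) * (pi * (1 - ?s\<^sup>2) / Im a) = ?p * ((1 - ?s) * (1 + ?s)) / (4 * Im w * Im a)"
    using a w by (simp add: power2_eq_square field_simps)
  finally have "(1 - ?s)\<^sup>2 / ?D * (4 * Im w * Im a) \<le> ?p * ((1 - ?s) * (1 + ?s))"
    using a w by (simp add: pos_le_divide_eq)
  hence "(1 - ?s) * ((1 - ?s) * (4 * Im w * Im a) / ?D) \<le> (1 - ?s) * (?p * (1 + ?s))"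
    by (simp add: power2_eq_square mult_ac)
  hence "(1 - ?s) * (4 * Im w * Im a) / ?D \<le> ?p * (1 + ?s)"
    using s by (subst (asm) mult_le_cancel_left_pos) auto
  hence "(1 - ?s) * (4 * Im w * Im a) / ?D / (1 + ?s) \<le> ?p"
    using add_pos_nonneg[OF zero_less_one s(1)] by (subst pos_divide_le_eq) auto
  thus ?thesis by (simp add: mult_ac)
qed

text \<open>Along the imaginary axis an inner function approaches modulus 1 no faster than \<open>1/y\<close>.\<close>

lemma inner_gap_vertical:
  assumes \<Phi>: "inner_function \<Phi>"
  obtains c where "c > 0" "\<And>y. y \<ge> 1 \<Longrightarrow> c / y \<le> 1 - cmod (\<Phi> (\<i> * of_real y))"
proof -
  let ?s = "cmod (\<Phi> \<i>)"
  have s: "0 \<le> ?s" "?s < 1" using inner_norm(2)[OF \<Phi>, of \<i>] by auto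
  define k where "k = (1 - ?s) / (1 + ?s)"
  have k: "k > 0" unfolding k_def using s by (intro divide_pos_pos add_pos_nonneg) auto
  show thesis
  proof (rule that[of "k / 2"])
    fix y :: real assume y: "y \<ge> 1"
    have "4 * y * 1 * (1 - ?s) / ((cmod (\<i> * of_real y - cnj \<i>))\<^sup>2 * (1 + ?s)) \<le> 1 - (cmod (\<Phi> (\<i> * of_real y)))\<^sup>2"
      using inner_schwarz_pick[OF \<Phi>, of \<i> "\<i> * of_real y"] y by simp
    moreover have "(cmod (\<i> * of_real y - cnj \<i>))\<^sup>2 = (y + 1)\<^sup>2" by (simp add: cmod_power2)
    ultimately have 1: "4 * y / (y + 1)\<^sup>2 * k \<le> 1 - (cmod (\<Phi> (\<i> * of_real y)))\<^sup>2" by (simp add: k_def)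
    have "(y + 1)\<^sup>2 \<le> (2 * y)\<^sup>2" using y by (intro power_mono) auto
    hence "4 * y / (2 * y)\<^sup>2 \<le> 4 * y / (y + 1)\<^sup>2" using y by (intro divide_left_mono) auto
    hence "1 / y \<le> 4 * y / (y + 1)\<^sup>2" using y by (simp add: power2_eq_square)
    hence "1 / y * k \<le> 4 * y / (y + 1)\<^sup>2 * k" using k by (intro mult_right_mono) auto
    also note 1
    also have "1 - (cmod (\<Phi> (\<i> * of_real y)))\<^sup>2 = (1 - cmod (\<Phi> (\<i> * of_real y))) * (1 + cmod (\<Phi> (\<i> * of_real y)))"
      by (simp add: power2_eq_square algebra_simps)
    also have "\<dots> \<le> (1 - cmod (\<Phi> (\<i> * of_real y))) * 2"
      using inner_norm(2)[OF \<Phi>, of "\<i> * of_real y"] y by (intro mult_left_mono) auto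
    finally show "k / 2 / y \<le> 1 - cmod (\<Phi> (\<i> * of_real y))" by simp
  qed (use k in simp)
qed

text \<open>If \<open>y (1 - |\<Phi> (\<i> y)|\<^sup>2)\<close> tends to infinity, the normalized reproducing kernels at \<open>\<i> y\<close> tend weakly to 0:
pointwise the kernel is at most \<open>2 / y\<close>, so its square integral over a bounded interval is of order
\<open>y\<^sup>-\<^sup>2\<close>, which is negligible against its total square integral \<open>\<pi> (1 - |\<Phi>|\<^sup>2) / y\<close>; outside the interval
the square integral of \<open>u\<close> is small.\<close>

lemma model_weakly_null:
  assumes \<Phi>: "inner_function \<Phi>" and uv: "model_pair \<Phi> u v"
    and inf: "filterlim (\<lambda>y. y * (1 - (cmod (\<Phi> (\<i> * of_real y)))\<^sup>2)) at_top at_top"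
  shows "((\<lambda>y. (cmod (u (\<i> * of_real y)))\<^sup>2 * y / (1 - (cmod (\<Phi> (\<i> * of_real y)))\<^sup>2)) \<longlongrightarrow> 0) at_top"
proof (rule tendstoI)
  fix e :: real assume e: "e > 0"
  have u: "smirnov u" and u2: "integrable lborel (\<lambda>t. (cmod (u (of_real t)))\<^sup>2)"
    using uv unfolding model_pair_def by auto
  have mu [measurable]: "(\<lambda>t. u (complex_of_real t)) \<in> borel_measurable borel" by (rule smirnov_boundary_measurable[OF u])
  let ?m = "LINT t|lborel. (cmod (u (of_real t)))\<^sup>2"
  define tail where "tail = (\<lambda>T. LINT t|lborel. (cmod (indicator (-{-T..T}) t * u (of_real t)))\<^sup>2)"
  have "(tail \<longlongrightarrow> (LINT t::real|lborel. (0::real))) at_top" unfolding tail_def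
  proof (rule integral_dominated_convergence_at_top[where w = "\<lambda>t. (cmod (u (of_real t)))\<^sup>2"])
    show "AE t in lborel. ((\<lambda>T. (cmod (indicator (-{-T..T}) t * u (of_real t)))\<^sup>2) \<longlongrightarrow> 0) at_top"
    proof (rule AE_I2)
      fix t :: real
      have "eventually (\<lambda>T. (cmod (indicator (-{-T..T}) t * u (of_real t)))\<^sup>2 = 0) at_top"
        using eventually_ge_at_top[of "\<bar>t\<bar>"] by eventually_elim (auto simp: indicator_def)
      thus "((\<lambda>T. (cmod (indicator (-{-T..T}) t * u (of_real t)))\<^sup>2) \<longlongrightarrow> 0) at_top" by (rule tendsto_eventually)
    qed
    show "eventually (\<lambda>T. AE t in lborel. norm ((cmod (indicator (-{-T..T}) t * u (of_real t)))\<^sup>2) \<le> (cmod (u (of_real t)))\<^sup>2) at_top"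
      by (intro always_eventually allI AE_I2) (auto simp: indicator_def)
  qed (use u2 in auto)
  hence "(tail \<longlongrightarrow> 0) at_top" by simp
  hence "eventually (\<lambda>T. tail T < e * pi / 2) at_top" using e by (intro order_tendstoD(2)) auto
  hence "eventually (\<lambda>T. tail T < e * pi / 2 \<and> T > 0) at_top" using eventually_gt_at_top[of 0] by eventually_elim auto
  then obtain T where T: "tail T < e * pi / 2" "T > 0" by (auto simp: eventually_at_top_linorder)
  have ev: "eventually (\<lambda>y. 16 * T * (?m + 1) / (e * pi\<^sup>2) < y * (1 - (cmod (\<Phi> (\<i> * of_real y)))\<^sup>2)) at_top"
    using inf unfolding filterlim_at_top_dense by blast
  show "eventually (\<lambda>y. dist ((cmod (u (\<i> * of_real y)))\<^sup>2 * y / (1 - (cmod (\<Phi> (\<i> * of_real y)))\<^sup>2)) 0 < e) at_top"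
    using ev eventually_gt_at_top[of 0]
  proof eventually_elim
    case (elim y)
    define w where "w = \<i> * complex_of_real y"
    define g where "g = 1 - (cmod (\<Phi> w))\<^sup>2"
    have w: "Im w > 0" "Im w = y" using elim(2) by (simp_all add: w_def)
    have g: "g > 0" using inner_norm(2)[OF \<Phi> w(1)] by (simp add: g_def power_less_one_iff abs_square_less_1)
    have m0: "?m \<ge> 0" by simp
    define K where "K = (\<lambda>t. (1 - \<Phi> w * cnj (\<Phi> (complex_of_real t))) / (of_real t - w))"
    have mK [measurable]: "K \<in> borel_measurable borel" unfolding K_def by (rule inner_kernel_meas[OF \<Phi>])
    have K2: "integrable lborel (\<lambda>t. (cmod (K t))\<^sup>2)" "(LINT t|lborel. (cmod (K t))\<^sup>2) = pi * g / y"
      unfolding K_def using model_kernel_norm[OF \<Phi> w(1)] by (simp_all add: g_def w(2))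
    have Kb: "(cmod (K t))\<^sup>2 \<le> 4 / y\<^sup>2" for t
    proof -
      have "cmod (1 - \<Phi> w * cnj (\<Phi> (of_real t))) \<le> 1 + cmod (\<Phi> w)"
        using norm_triangle_ineq4[of 1 "\<Phi> w * cnj (\<Phi> (of_real t))"] by (simp add: norm_mult inner_norm(1)[OF \<Phi>])
      hence n: "cmod (1 - \<Phi> w * cnj (\<Phi> (of_real t))) \<le> 2" using inner_norm(2)[OF \<Phi> w(1)] by linarith
      have d: "y \<le> cmod (of_real t - w)" using abs_Im_le_cmod[of "of_real t - w"] w by simp
      have "cmod (K t) \<le> 2 / y" unfolding K_def norm_divide using n d elim(2) by (intro frac_le) auto
      hence "(cmod (K t))\<^sup>2 \<le> (2 / y)\<^sup>2" by (intro power_mono) auto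
      thus ?thesis by (simp add: power_divide)
    qed
    let ?i = "\<lambda>t. indicator {-T..T} t :: complex" and ?o = "\<lambda>t. indicator (-{-T..T}) t :: complex"
    have iK2: "integrable lborel (\<lambda>t. (cmod (?i t * K t))\<^sup>2)"
      by (rule Bochner_Integration.integrable_bound[OF K2(1)]) (auto simp: indicator_def)
    have ou2: "integrable lborel (\<lambda>t. (cmod (?o t * u (of_real t)))\<^sup>2)"
      by (rule Bochner_Integration.integrable_bound[OF u2]) (auto simp: indicator_def)
    have "(LINT t|lborel. (cmod (?i t * K t))\<^sup>2) \<le> (LINT t|lborel. indicator {-T..T} t * (4 / y\<^sup>2))"
    proof (rule integral_mono[OF iK2])
      have "integrable lborel (\<lambda>t. indicator {-T..T} t :: real)"
        by (rule integrable_real_indicator) (auto simp: emeasure_lborel_Icc_eq)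
      thus "integrable lborel (\<lambda>t. indicator {-T..T} t * (4 / y\<^sup>2))" by (rule integrable_mult_left)
      show "(cmod (?i t * K t))\<^sup>2 \<le> indicator {-T..T} t * (4 / y\<^sup>2)" for t
        using Kb by (simp add: indicator_def)
    qed
    also have "\<dots> = 2 * T * (4 / y\<^sup>2)" using T(2) by simp
    finally have iK: "(LINT t|lborel. (cmod (?i t * K t))\<^sup>2) \<le> 8 * T / y\<^sup>2" by simp
    have I1: "integrable lborel (\<lambda>t. u (of_real t) * (?i t * K t))"
      and b1: "(cmod (LINT t|lborel. u (of_real t) * (?i t * K t)))\<^sup>2 \<le> ?m * (LINT t|lborel. (cmod (?i t * K t))\<^sup>2)"
      by (rule integral_cauchy_schwarz[OF mu _ u2 iK2], measurable)+
    have I2: "integrable lborel (\<lambda>t. ?o t * u (of_real t) * K t)"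
      and b2: "(cmod (LINT t|lborel. ?o t * u (of_real t) * K t))\<^sup>2 \<le> tail T * (LINT t|lborel. (cmod (K t))\<^sup>2)"
      unfolding tail_def by (rule integral_cauchy_schwarz[OF _ mK ou2 K2(1)], measurable)+
    have eq: "u (of_real t) * K t = u (of_real t) * (?i t * K t) + ?o t * u (of_real t) * K t" for t
      by (simp add: indicator_def)
    have rep: "(LINT t|lborel. u (of_real t) * K t) = 2 * pi * \<i> * u w"
      unfolding K_def by (rule model_reproducing[OF \<Phi> uv w(1)])
    have dec: "2 * pi * \<i> * u w = (LINT t|lborel. u (of_real t) * (?i t * K t)) + (LINT t|lborel. ?o t * u (of_real t) * K t)"
      unfolding rep[symmetric] Bochner_Integration.integral_add[OF I1 I2, symmetric]
      by (intro Bochner_Integration.integral_cong refl eq)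
    have "(2 * pi * cmod (u w))\<^sup>2 = (cmod ((LINT t|lborel. u (of_real t) * (?i t * K t)) + (LINT t|lborel. ?o t * u (of_real t) * K t)))\<^sup>2"
      unfolding dec[symmetric] by (simp add: norm_mult)
    also have "\<dots> \<le> (cmod (LINT t|lborel. u (of_real t) * (?i t * K t)) + cmod (LINT t|lborel. ?o t * u (of_real t) * K t))\<^sup>2"
      by (intro power_mono norm_triangle_ineq) simp
    also have "\<dots> \<le> 2 * (cmod (LINT t|lborel. u (of_real t) * (?i t * K t)))\<^sup>2 + 2 * (cmod (LINT t|lborel. ?o t * u (of_real t) * K t))\<^sup>2"
      by (smt (verit) sum_squares_bound power2_sum)
    also have "\<dots> \<le> 2 * (?m * (8 * T / y\<^sup>2)) + 2 * (tail T * (pi * g / y))"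
      using b1 b2 mult_left_mono[OF iK m0] unfolding K2(2) by linarith
    finally have "(2 * pi * cmod (u w))\<^sup>2 \<le> 2 * (?m * (8 * T / y\<^sup>2)) + 2 * (tail T * (pi * g / y))" .
    hence "4 * pi\<^sup>2 * (cmod (u w))\<^sup>2 * (y / g) \<le> (2 * (?m * (8 * T / y\<^sup>2)) + 2 * (tail T * (pi * g / y))) * (y / g)"
      using elim(2) g by (intro mult_right_mono) (auto simp: power_mult_distrib)
    also have "\<dots> = 16 * T * ?m / (y * g) + 2 * pi * tail T"
      using elim(2) g by (simp add: power2_eq_square field_simps)
    also have "\<dots> < e * pi\<^sup>2 + e * pi\<^sup>2"
    proof (rule add_strict_mono)
      have "16 * T * ?m < 16 * T * (?m + 1)" using T(2) by simp
      also have "\<dots> < y * g * (e * pi\<^sup>2)"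
        using elim(1) e unfolding w_def[symmetric] g_def[symmetric] by (simp add: pos_divide_less_eq)
      finally show "16 * T * ?m / (y * g) < e * pi\<^sup>2" using elim(2) g by (simp add: pos_divide_less_eq mult.commute)
      have "2 * pi * tail T < 2 * pi * (e * pi / 2)" using T(1) by (intro mult_strict_left_mono) auto
      thus "2 * pi * tail T < e * pi\<^sup>2" by (simp add: power2_eq_square mult_ac)
    qed
    also have "e * pi\<^sup>2 + e * pi\<^sup>2 \<le> 4 * pi\<^sup>2 * e" using mult_pos_pos[OF e, of "pi\<^sup>2"] by simp
    finally have "4 * pi\<^sup>2 * ((cmod (u w))\<^sup>2 * y / g) < 4 * pi\<^sup>2 * e" by (simp add: mult_ac)
    hence "(cmod (u w))\<^sup>2 * y / g < e" by (subst (asm) mult_less_cancel_left_pos) auto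
    moreover have "(cmod (u w))\<^sup>2 * y / g \<ge> 0" using elim(2) g by simp
    ultimately have "\<bar>(cmod (u w))\<^sup>2 * y / g - 0\<bar> < e" by (simp only: diff_zero abs_of_nonneg)
    thus ?case unfolding w_def g_def dist_real_def .
  qed
qed

section \<open>Poisson means and the sampling points\<close>

text \<open>The base point \<open>- \<rho>\<close> and the shift by \<open>\<pi>\<close> place the peak of the kernel, located at \<open>s = 0\<close>, in the
middle of the interval \<open>[0, 2 \<pi>]\<close> on which the disc kernel is integrated.\<close>

lemma disc_poisson_negative_real:
  assumes "0 \<le> \<rho>" "\<rho> < 1"
  shows "disc_poisson (- of_real \<rho>) (2 * s + pi) = (1 - \<rho>\<^sup>2) / (cmod (1 - of_real \<rho> * cis (2 * s)))\<^sup>2"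
    "(cmod (1 - of_real \<rho> * cis (2 * s)))\<^sup>2 = (1 - \<rho>)\<^sup>2 + 4 * \<rho> * (sin s)\<^sup>2"
proof -
  have "(cmod (cis (2 * s + pi) - - of_real \<rho>))\<^sup>2 = (cmod (1 - of_real \<rho> * cis (2 * s)))\<^sup>2"
  proof -
    have "cis (2 * s + pi) = - cis (2 * s)" by (simp add: cis_mult[symmetric])
    moreover have "(\<rho> - cos (2 * s))\<^sup>2 + (sin (2 * s))\<^sup>2 = (1 - \<rho> * cos (2 * s))\<^sup>2 + (\<rho> * sin (2 * s))\<^sup>2"
      using sin_cos_squared_add[of "2 * s"] by algebra
    ultimately show ?thesis by (simp add: cmod_power2)
  qed
  thus "disc_poisson (- of_real \<rho>) (2 * s + pi) = (1 - \<rho>\<^sup>2) / (cmod (1 - of_real \<rho> * cis (2 * s)))\<^sup>2"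
    unfolding disc_poisson_def using assms by simp
  have "(cmod (1 - of_real \<rho> * cis (2 * s)))\<^sup>2 = (1 - \<rho> * cos (2 * s))\<^sup>2 + (\<rho> * sin (2 * s))\<^sup>2"
    by (simp add: cmod_power2)
  also have "\<dots> = 1 - 2 * \<rho> * cos (2 * s) + \<rho>\<^sup>2 * ((cos (2 * s))\<^sup>2 + (sin (2 * s))\<^sup>2)"
    by algebra
  also have "(cos (2 * s))\<^sup>2 + (sin (2 * s))\<^sup>2 = 1" by simp
  also have "cos (2 * s) = 1 - 2 * (sin s)\<^sup>2" by (rule cos_double_sin)
  finally show "(cmod (1 - of_real \<rho> * cis (2 * s)))\<^sup>2 = (1 - \<rho>)\<^sup>2 + 4 * \<rho> * (sin s)\<^sup>2"
    by (simp add: power2_eq_square algebra_simps)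
qed

lemma has_integral_norm_bound_integral:
  fixes f :: "real \<Rightarrow> real"
  assumes "(f has_integral I) S" "(g has_integral J) S" "\<And>x. x \<in> S \<Longrightarrow> norm (f x) \<le> g x"
  shows "norm I \<le> J"
  using Henstock_Kurzweil_Integration.integral_norm_bound_integral[of f S g] assms
  by (auto simp: has_integral_iff)

text \<open>Substituting \<open>s = \<phi> t - c\<close> turns the integral over \<open>[a, b]\<close> into one against an approximate identity on
\<open>[-\<pi>/2, \<pi>/2]\<close> of total mass \<open>\<pi>\<close>; the Jacobian produces the factor \<open>1 / \<phi>'\<close> at the peak.\<close>

lemma poisson_concentration:
  fixes \<phi> \<phi>' q :: "real \<Rightarrow> real"
  assumes deriv: "\<And>t. (\<phi> has_real_derivative \<phi>' t) (at t)" and cont: "continuous_on UNIV \<phi>'" and pos: "\<And>t. \<phi>' t > 0"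
    and q: "continuous_on UNIV q" and ab: "a < x0" "x0 < b"
    and ends: "\<phi> a = c - pi/2" "\<phi> b = c + pi/2" "\<phi> x0 = c"
  shows "((\<lambda>\<rho>. integral {a..b} (\<lambda>t. q t * disc_poisson (- of_real \<rho>) (2 * (\<phi> t - c) + pi))) \<longlongrightarrow> pi * q x0 / \<phi>' x0) (at_left 1)"
proof -
  have mono: "\<phi> s < \<phi> t" if "s < t" for s t
    by (rule DERIV_pos_imp_increasing[OF that]) (use deriv pos in blast)
  have contphi: "continuous_on A \<phi>" for A
    by (meson DERIV_isCont continuous_at_imp_continuous_on deriv)
  have cphi': "continuous_on A \<phi>'" and cq: "continuous_on A q" for A
    using cont q continuous_on_subset by blast+
  define r where "r = (\<lambda>t. q t / \<phi>' t)"
  have contr: "continuous_on A r" for A unfolding r_def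
    by (intro continuous_intros cphi' cq) (use pos less_imp_neq in fastforce)
  let ?P = "\<lambda>\<rho> t. disc_poisson (- of_real \<rho>) (2 * (\<phi> t - c) + pi)"
  have range: "- (pi/2) \<le> \<phi> t - c \<and> \<phi> t - c \<le> pi/2" if "t \<in> {a..b}" for t
    using that mono[of a t] mono[of t b] ends by (cases "t = a"; cases "t = b") auto
  have HI: "((\<lambda>t. \<phi>' t * ?P \<rho> t) has_integral pi) {a..b}" if \<rho>: "0 \<le> \<rho>" "\<rho> < 1" for \<rho>
  proof -
    have n: "cmod (- of_real \<rho>) < 1" using \<rho> by simp
    have "((\<lambda>t. (2 * \<phi>' t) *\<^sub>R disc_poisson (- of_real \<rho>) (2 * (\<phi> t - c) + pi)) has_integral
      integral {2 * (\<phi> a - c) + pi..2 * (\<phi> b - c) + pi} (disc_poisson (- of_real \<rho>))) {a..b}"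
    proof (rule has_integral_substitution[where c = 0 and d = "2*pi"])
      show "(\<lambda>t. 2 * (\<phi> t - c) + pi) ` {a..b} \<subseteq> {0..2*pi}" using range by fastforce
      show "continuous_on {0..2*pi} (disc_poisson (- of_real \<rho>))" by (rule continuous_on_disc_poisson[OF n])
      show "((\<lambda>t. 2 * (\<phi> t - c) + pi) has_real_derivative 2 * \<phi>' x) (at x within {a..b})" for x
        using has_field_derivative_at_within[OF deriv[of x], of "{a..b}"] by (auto intro!: derivative_eq_intros)
    qed (use ab ends in auto)
    moreover have "integral {2 * (\<phi> a - c) + pi..2 * (\<phi> b - c) + pi} (disc_poisson (- of_real \<rho>)) = 2 * pi"
      using disc_poisson_has_integral[OF n] ends by (simp add: integral_unique)
    ultimately have "((\<lambda>t. (1/2) * (2 * \<phi>' t * ?P \<rho> t)) has_integral (1/2) * (2 * pi)) {a..b}"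
      by (intro has_integral_mult_right) simp
    thus ?thesis by simp
  qed
  have HD: "(\<phi>' has_integral pi) {a..b}"
  proof -
    have "(\<phi>' has_integral (\<phi> b - \<phi> a)) {a..b}"
      using deriv ab by (intro fundamental_theorem_of_calculus) (auto simp: has_real_derivative_iff_has_vector_derivative[symmetric] intro: has_field_derivative_at_within)
    thus ?thesis using ends by simp
  qed
  show ?thesis
  proof (rule tendstoI)
    fix e :: real assume e: "e > 0"
    define e' where "e' = e / (2 * pi)"
    have e': "e' > 0" using e by (simp add: e'_def)
    have "isCont r x0" using contr[of UNIV] by (simp add: continuous_on_eq_continuous_at)
    then obtain d where d: "d > 0" "\<And>t. \<bar>t - x0\<bar> < d \<Longrightarrow> \<bar>r t - r x0\<bar> < e'"
      unfolding continuous_at_eps_delta using e' by (auto simp: dist_real_def)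
    have "compact ((\<lambda>t. r t - r x0) ` {a..b})" by (intro compact_continuous_image continuous_intros contr) auto
    from compact_imp_bounded[OF this] obtain R where R: "\<And>t. t \<in> {a..b} \<Longrightarrow> \<bar>r t - r x0\<bar> \<le> R"
      unfolding bounded_iff real_norm_def by blast
    have R0: "R \<ge> 0" using R[of x0] ab by simp
    define K where "K = {a..b} - ball x0 d"
    obtain m where m: "m > 0" "\<And>t. t \<in> K \<Longrightarrow> m \<le> (sin (\<phi> t - c))\<^sup>2"
    proof (cases "K = {}")
      case True thus thesis using that[of 1] by simp
    next
      case False
      have "compact K" unfolding K_def by (intro compact_diff) auto
      moreover have "continuous_on K (\<lambda>t. (sin (\<phi> t - c))\<^sup>2)" by (intro continuous_intros contphi)
      ultimately obtain t0 where t0: "t0 \<in> K" "\<And>t. t \<in> K \<Longrightarrow> (sin (\<phi> t0 - c))\<^sup>2 \<le> (sin (\<phi> t - c))\<^sup>2"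
        using continuous_attains_inf[OF _ False] by blast
      have "sin (\<phi> t0 - c) \<noteq> 0"
      proof
        assume s0: "sin (\<phi> t0 - c) = 0"
        have "t0 \<in> {a..b}" "t0 \<noteq> x0" using t0(1) d(1) by (auto simp: K_def)
        hence "\<phi> t0 - c \<noteq> 0" using mono[of t0 x0] mono[of x0 t0] ends(3) by (cases "t0 < x0") auto
        moreover have "- pi < \<phi> t0 - c" "\<phi> t0 - c < pi" using range[OF \<open>t0 \<in> {a..b}\<close>] pi_gt_zero by linarith+
        ultimately show False using s0 by (simp add: sin_zero_pi_iff abs_less_iff)
      qed
      thus thesis using that[of "(sin (\<phi> t0 - c))\<^sup>2"] t0 by simp
    qed
    have "((\<lambda>\<rho>. R * ((1 - \<rho>\<^sup>2) / (4 * \<rho> * m)) * pi) \<longlongrightarrow> R * ((1 - 1\<^sup>2) / (4 * 1 * m)) * pi) (at_left (1::real))"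
      using m by (intro tendsto_intros) auto
    hence "((\<lambda>\<rho>. R * ((1 - \<rho>\<^sup>2) / (4 * \<rho> * m)) * pi) \<longlongrightarrow> 0) (at_left (1::real))" by simp
    hence "eventually (\<lambda>\<rho>. R * ((1 - \<rho>\<^sup>2) / (4 * \<rho> * m)) * pi < e/2) (at_left 1)"
      using e by (intro order_tendstoD(2)) auto
    moreover have "eventually (\<lambda>\<rho>::real. 0 < \<rho> \<and> \<rho> < 1) (at_left 1)"
      using eventually_at_left_real[of 0 1] by (auto elim: eventually_mono)
    ultimately show "eventually (\<lambda>\<rho>. dist (integral {a..b} (\<lambda>t. q t * ?P \<rho> t)) (pi * q x0 / \<phi>' x0) < e) (at_left 1)"
    proof eventually_elim
      case (elim \<rho>)
      have n: "cmod (- of_real \<rho>) < 1" using elim by simp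
      have cP: "continuous_on {a..b} (?P \<rho>)"
        by (rule continuous_on_compose2[OF continuous_on_disc_poisson[OF n, of UNIV]]) (auto intro!: continuous_intros contphi)
      have qP: "((\<lambda>t. q t * ?P \<rho> t) has_integral integral {a..b} (\<lambda>t. q t * ?P \<rho> t)) {a..b}"
        by (intro integrable_integral integrable_continuous_real continuous_intros cq cP)
      have "((\<lambda>t. q t * ?P \<rho> t - r x0 * (\<phi>' t * ?P \<rho> t)) has_integral integral {a..b} (\<lambda>t. q t * ?P \<rho> t) - r x0 * pi) {a..b}"
        using elim by (intro has_integral_diff qP has_integral_mult_right HI) auto
      moreover have "((\<lambda>t. e' * (\<phi>' t * ?P \<rho> t) + R * ((1 - \<rho>\<^sup>2) / (4 * \<rho> * m)) * \<phi>' t) has_integral e' * pi + R * ((1 - \<rho>\<^sup>2) / (4 * \<rho> * m)) * pi) {a..b}"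
        using elim by (intro has_integral_add has_integral_mult_right HI HD) auto
      ultimately have "norm (integral {a..b} (\<lambda>t. q t * ?P \<rho> t) - r x0 * pi) \<le> e' * pi + R * ((1 - \<rho>\<^sup>2) / (4 * \<rho> * m)) * pi"
      proof (rule has_integral_norm_bound_integral)
        fix t assume t: "t \<in> {a..b}"
        have P0: "?P \<rho> t \<ge> 0" by (rule disc_poisson_nonneg[OF n])
        have R': "0 \<le> R * ((1 - \<rho>\<^sup>2) / (4 * \<rho> * m)) * \<phi>' t" using R0 elim m pos[of t] by (simp add: power_le_one)
        have eq: "q t * ?P \<rho> t - r x0 * (\<phi>' t * ?P \<rho> t) = (r t - r x0) * (\<phi>' t * ?P \<rho> t)"
          using pos[of t] by (simp add: r_def algebra_simps)
        have n1: "norm (q t * ?P \<rho> t - r x0 * (\<phi>' t * ?P \<rho> t)) = \<bar>r t - r x0\<bar> * (\<phi>' t * ?P \<rho> t)"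
          unfolding eq using P0 pos[of t] by (simp add: abs_mult)
        show "norm (q t * ?P \<rho> t - r x0 * (\<phi>' t * ?P \<rho> t)) \<le> e' * (\<phi>' t * ?P \<rho> t) + R * ((1 - \<rho>\<^sup>2) / (4 * \<rho> * m)) * \<phi>' t"
        proof (cases "\<bar>t - x0\<bar> < d")
          case True
          have "\<bar>r t - r x0\<bar> * (\<phi>' t * ?P \<rho> t) \<le> e' * (\<phi>' t * ?P \<rho> t)"
            using d(2)[OF True] P0 pos[of t] by (intro mult_right_mono) auto
          thus ?thesis unfolding n1 using R' by linarith
        next
          case False
          hence tK: "t \<in> K" using t by (auto simp: K_def dist_real_def abs_minus_commute)
          have "4 * \<rho> * m \<le> (1 - \<rho>)\<^sup>2 + 4 * \<rho> * (sin (\<phi> t - c))\<^sup>2"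
            using m(2)[OF tK] elim by (intro add_increasing mult_left_mono) auto
          hence "(1 - \<rho>\<^sup>2) / ((1 - \<rho>)\<^sup>2 + 4 * \<rho> * (sin (\<phi> t - c))\<^sup>2) \<le> (1 - \<rho>\<^sup>2) / (4 * \<rho> * m)"
            using elim m(1) by (intro divide_left_mono) (auto simp: power_le_one intro!: mult_pos_pos add_pos_nonneg)
          hence Pb: "?P \<rho> t \<le> (1 - \<rho>\<^sup>2) / (4 * \<rho> * m)"
            using disc_poisson_negative_real[of \<rho> "\<phi> t - c"] elim by simp
          have "\<bar>r t - r x0\<bar> * (\<phi>' t * ?P \<rho> t) \<le> R * (\<phi>' t * ((1 - \<rho>\<^sup>2) / (4 * \<rho> * m)))"
            using R[OF t] Pb P0 pos[of t] R0 by (intro mult_mono mult_left_mono) auto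
          moreover have "0 \<le> e' * (\<phi>' t * ?P \<rho> t)" using e' P0 pos[of t] by simp
          ultimately show ?thesis unfolding n1 by (simp add: mult_ac)
        qed
      qed
      also have "e' * pi = e/2" by (simp add: e'_def)
      finally have "\<bar>integral {a..b} (\<lambda>t. q t * ?P \<rho> t) - r x0 * pi\<bar> < e"
        using elim(1) unfolding real_norm_def by linarith
      thus ?case by (simp add: dist_real_def r_def mult.commute)
    qed
  qed
qed


lemma sampling_points_between:
  fixes \<phi> :: "real \<Rightarrow> real" and \<Lambda> :: "int \<Rightarrow> real"
  assumes mono: "strict_mono \<phi>" and cont: "continuous_on UNIV \<phi>" and \<Lambda>: "\<And>n. \<phi> (\<Lambda> n) = of_int n * pi + \<alpha>"
  obtains \<tau> :: "int \<Rightarrow> real" where "\<And>n. \<phi> (\<tau> n) = of_int n * pi + \<alpha> + pi/2"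
proof -
  have "\<exists>t. \<phi> t = of_int n * pi + \<alpha> + pi/2" for n
  proof -
    have "\<phi> (\<Lambda> n) \<le> of_int n * pi + \<alpha> + pi/2" "of_int n * pi + \<alpha> + pi/2 \<le> \<phi> (\<Lambda> (n + 1))"
      by (simp_all add: \<Lambda> algebra_simps)
    moreover have "\<Lambda> n \<le> \<Lambda> (n + 1)"
      using strict_mono_less_eq[OF mono, of "\<Lambda> n" "\<Lambda> (n+1)"] by (simp add: \<Lambda> algebra_simps)
    ultimately show ?thesis
      using IVT'[of \<phi> "\<Lambda> n" _ "\<Lambda> (n+1)"] continuous_on_subset[OF cont] by blast
  qed
  thus thesis using that by metis
qed

text \<open>On the line \<open>u v = \<Phi> |u|\<^sup>2\<close>. The integral of \<open>u v B\<close> vanishes for bounded analytic \<open>B\<close>, and with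
\<open>B = \<rho> \<omega> \<Psi> / (1 - \<rho> \<omega> \<Phi> \<Psi>)\<close>, \<open>\<omega> = exp (-2 \<i> \<alpha>)\<close>, this says that the integral of \<open>|u|\<^sup>2\<close> against the
Poisson kernel \<open>P \<rho>\<close> in the variable \<open>2 (\<phi> - \<alpha>)\<close> equals \<open>m\<close> for every \<open>\<rho> < 1\<close>. As \<open>\<rho> \<rightarrow> 1\<close> the mass
concentrates at the points \<open>\<Lambda> n\<close> with weights \<open>\<nu> n\<close>, which yields the first inequality.

Mass may escape to infinity. To bound the loss, the same integral is taken with the weight
\<open>Y\<^sup>2 / (t\<^sup>2 + Y\<^sup>2)\<close>: as this weight vanishes at infinity, no weighted mass is lost, and the Poisson formula
at \<open>\<i> Y\<close> evaluates the analytic part. The term subtracted in the second inequality bounds that value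
uniformly in \<open>\<rho>\<close>.\<close>

lemma sampling_bounds:
  fixes \<phi> \<phi>' :: "real \<Rightarrow> real" and \<Lambda> :: "int \<Rightarrow> real"
  assumes \<Phi>: "inner_function \<Phi>" and \<Psi>: "inner_function \<Psi>" and uv: "model_pair \<Phi> u v"
    and deriv: "\<And>t. (\<phi> has_real_derivative \<phi>' t) (at t)" and cont: "continuous_on UNIV \<phi>'" and pos: "\<And>t. \<phi>' t > 0"
    and phase: "\<And>t. \<Phi> (of_real t) * \<Psi> (of_real t) = cis (2 * \<phi> t)"
    and \<Lambda>: "\<And>n. \<phi> (\<Lambda> n) = of_int n * pi + \<alpha>"
  defines "m \<equiv> LINT t|lborel. (cmod (u (of_real t)))\<^sup>2"
    and "\<nu> \<equiv> \<lambda>n. pi * (cmod (u (of_real (\<Lambda> n))))\<^sup>2 / \<phi>' (\<Lambda> n)"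
  shows "finite A \<Longrightarrow> sum \<nu> A \<le> m"
    and "(\<And>A. finite A \<Longrightarrow> sum \<nu> A \<le> B) \<Longrightarrow> Y > 0 \<Longrightarrow>
      (LINT t|lborel. (cmod (u (of_real t)))\<^sup>2 * (Y\<^sup>2 / (t\<^sup>2 + Y\<^sup>2))) -
      2 * pi * Y * (cmod (u (\<i> * of_real Y)) * cmod (v (\<i> * of_real Y)) * cmod (\<Psi> (\<i> * of_real Y)) /
        (1 - cmod (\<Phi> (\<i> * of_real Y)) * cmod (\<Psi> (\<i> * of_real Y)))) \<le> B"
proof -
  have u: "smirnov u" and v: "smirnov v" and vt: "\<And>t. v (of_real t) = \<Phi> (of_real t) * cnj (u (of_real t))"
    and u2: "integrable lborel (\<lambda>t. (cmod (u (of_real t)))\<^sup>2)"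
    using uv unfolding model_pair_def by auto
  define p where "p = (\<lambda>t. (cmod (u (complex_of_real t)))\<^sup>2)"
  have pint: "integrable lborel p" and pm: "(LINT t|lborel. p t) = m" and p0: "\<And>t. p t \<ge> 0"
    using u2 by (simp_all add: p_def m_def)
  have pcont: "continuous_on A p" for A unfolding p_def
    using u by (intro continuous_intros boundary_continuous) (simp add: smirnov_def)
  have pmeas [measurable]: "p \<in> borel_measurable borel" using pcont[of UNIV] by (rule borel_measurable_continuous_onI)
  have \<phi>meas [measurable]: "\<phi> \<in> borel_measurable borel"
    by (intro borel_measurable_continuous_onI continuous_at_imp_continuous_on) (use deriv DERIV_isCont in blast)
  have mono: "strict_mono \<phi>"
    unfolding strict_mono_def using DERIV_pos_imp_increasing deriv pos by metis
  have contphi: "continuous_on UNIV \<phi>"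
    by (intro continuous_at_imp_continuous_on) (use deriv DERIV_isCont in blast)
  define \<omega> where "\<omega> = cis (- (2 * \<alpha>))"
  have \<omega>1: "cmod \<omega> = 1" by (simp add: \<omega>_def)
  define P where "P = (\<lambda>\<rho> t. disc_poisson (- of_real \<rho>) (2 * (\<phi> t - \<alpha>) + pi))"
  have P0: "P \<rho> t \<ge> 0" if "0 \<le> \<rho>" "\<rho> < 1" for \<rho> t unfolding P_def using that by (intro disc_poisson_nonneg) simp
  \<comment> \<open>On the line \<open>X \<rho> = p s / (1 - s)\<close>, where \<open>P \<rho> = 1 + 2 Re (s / (1 - s))\<close>.\<close>
  define X where "X = (\<lambda>\<rho> z. u z * v z * (\<Psi> z * (of_real \<rho> * \<omega>) / (1 - of_real \<rho> * \<omega> * (\<Phi> z * \<Psi> z))))"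
  have den: "1 - \<rho> \<le> cmod (1 - of_real \<rho> * \<omega> * (\<Phi> z * \<Psi> z))"
    "1 - cmod (\<Phi> z) * cmod (\<Psi> z) \<le> cmod (1 - of_real \<rho> * \<omega> * (\<Phi> z * \<Psi> z))"
    if \<rho>: "0 \<le> \<rho>" "\<rho> < 1" and z: "Im z \<ge> 0" for \<rho> z
  proof -
    have "cmod (\<Phi> z) \<le> 1 \<and> cmod (\<Psi> z) \<le> 1"
    proof (cases "Im z = 0")
      case True
      hence "z = of_real (Re z)" by (simp add: complex_eq_iff)
      thus ?thesis using inner_norm(1)[OF \<Phi>, of "Re z"] inner_norm(1)[OF \<Psi>, of "Re z"] by simp
    qed (use inner_norm(2)[OF \<Phi>, of z] inner_norm(2)[OF \<Psi>, of z] z in simp)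
    hence "cmod (\<Phi> z) * cmod (\<Psi> z) \<le> 1 * 1" by (intro mult_mono) auto
    hence le: "cmod (\<Phi> z) * cmod (\<Psi> z) \<le> 1" by simp
    have n: "cmod (of_real \<rho> * \<omega> * (\<Phi> z * \<Psi> z)) = \<rho> * (cmod (\<Phi> z) * cmod (\<Psi> z))"
      using \<rho> by (simp add: norm_mult \<omega>1)
    have "1 - \<rho> * (cmod (\<Phi> z) * cmod (\<Psi> z)) \<le> cmod (1 - of_real \<rho> * \<omega> * (\<Phi> z * \<Psi> z))"
      using norm_triangle_ineq2[of 1 "of_real \<rho> * \<omega> * (\<Phi> z * \<Psi> z)"] unfolding n by simp
    moreover have "\<rho> * (cmod (\<Phi> z) * cmod (\<Psi> z)) \<le> \<rho> * 1" using \<rho> le by (intro mult_left_mono) auto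
    moreover have "\<rho> * (cmod (\<Phi> z) * cmod (\<Psi> z)) \<le> 1 * (cmod (\<Phi> z) * cmod (\<Psi> z))" using \<rho> by (intro mult_right_mono) auto
    ultimately show "1 - \<rho> \<le> cmod (1 - of_real \<rho> * \<omega> * (\<Phi> z * \<Psi> z))"
      "1 - cmod (\<Phi> z) * cmod (\<Psi> z) \<le> cmod (1 - of_real \<rho> * \<omega> * (\<Phi> z * \<Psi> z))" by linarith+
  qed
  have den0: "1 - of_real \<rho> * \<omega> * (\<Phi> z * \<Psi> z) \<noteq> 0" if \<rho>: "0 \<le> \<rho>" "\<rho> < 1" and z: "Im z \<ge> 0" for \<rho> z
    using den(1)[OF that] \<rho> by force
  have Xs: "smirnov (X \<rho>)" if \<rho>: "0 \<le> \<rho>" "\<rho> < 1" for \<rho>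
    unfolding X_def
  proof (intro smirnov_mult u v smirnov_bounded)
    have c: "continuous_on {z. Im z \<ge> 0} \<Phi>" "continuous_on {z. Im z \<ge> 0} \<Psi>" "\<Phi> holomorphic_on upper_half_plane" "\<Psi> holomorphic_on upper_half_plane"
      using \<Phi> \<Psi> unfolding inner_function_def by auto
    show "continuous_on {z. Im z \<ge> 0} (\<lambda>z. \<Psi> z * (of_real \<rho> * \<omega>) / (1 - of_real \<rho> * \<omega> * (\<Phi> z * \<Psi> z)))"
      by (intro continuous_intros c) (use den0[OF \<rho>] in auto)
    show "(\<lambda>z. \<Psi> z * (of_real \<rho> * \<omega>) / (1 - of_real \<rho> * \<omega> * (\<Phi> z * \<Psi> z))) holomorphic_on upper_half_plane"
      by (intro holomorphic_intros c) (use den0[OF \<rho>] in \<open>auto simp: upper_half_plane_def\<close>)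
    fix z assume z: "Im z > 0"
    have "cmod (\<Psi> z) * \<rho> \<le> 1 * 1" using inner_norm(2)[OF \<Psi> z] \<rho> by (intro mult_mono) auto
    moreover have "1 - \<rho> \<le> cmod (1 - of_real \<rho> * \<omega> * (\<Phi> z * \<Psi> z))" using den(1)[OF \<rho>] z by simp
    ultimately have "(cmod (\<Psi> z) * \<rho>) / cmod (1 - of_real \<rho> * \<omega> * (\<Phi> z * \<Psi> z)) \<le> 1 / (1 - \<rho>)"
      using \<rho> by (intro frac_le) auto
    thus "cmod (\<Psi> z * (of_real \<rho> * \<omega>) / (1 - of_real \<rho> * \<omega> * (\<Phi> z * \<Psi> z))) \<le> 1 / (1 - \<rho>)"
      using \<rho> by (simp add: norm_divide norm_mult \<omega>1)
  qed
  define s where "s = (\<lambda>\<rho> t. of_real \<rho> * cis (2 * (\<phi> t - \<alpha>)))"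
  have s_eq: "of_real \<rho> * \<omega> * (\<Phi> (of_real t) * \<Psi> (of_real t)) = s \<rho> t" for \<rho> t
  proof -
    have "\<omega> * cis (2 * \<phi> t) = cis (2 * (\<phi> t - \<alpha>))" unfolding \<omega>_def cis_mult by (simp add: algebra_simps)
    thus ?thesis unfolding phase s_def by (simp add: mult.assoc)
  qed
  have Xt: "X \<rho> (of_real t) = of_real (p t) * (s \<rho> t / (1 - s \<rho> t))" for \<rho> t
  proof -
    have "X \<rho> (of_real t) = u (of_real t) * cnj (u (of_real t)) * (of_real \<rho> * \<omega> * (\<Phi> (of_real t) * \<Psi> (of_real t)) / (1 - of_real \<rho> * \<omega> * (\<Phi> (of_real t) * \<Psi> (of_real t))))"
      unfolding X_def vt by (simp add: mult_ac)
    thus ?thesis unfolding s_eq p_def complex_norm_square .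
  qed
  have sden: "cmod (s \<rho> t / (1 - s \<rho> t)) \<le> 1 / (1 - \<rho>)" if \<rho>: "0 \<le> \<rho>" "\<rho> < 1" for \<rho> t
  proof -
    have "1 - \<rho> \<le> cmod (1 - s \<rho> t)" using den(1)[OF \<rho>, of "of_real t"] unfolding s_eq by simp
    thus ?thesis unfolding norm_divide using \<rho> by (intro frac_le) (auto simp: s_def norm_mult)
  qed
  have P_eq: "P \<rho> t = 1 + 2 * Re (s \<rho> t / (1 - s \<rho> t))" if \<rho>: "0 \<le> \<rho>" "\<rho> < 1" for \<rho> t
  proof -
    have ne: "1 - s \<rho> t \<noteq> 0" using den0[OF \<rho>, of "of_real t"] unfolding s_eq by simp
    have "P \<rho> t = (1 - \<rho>\<^sup>2) / (cmod (1 - s \<rho> t))\<^sup>2"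
      unfolding P_def s_def by (rule disc_poisson_negative_real(1)[OF \<rho>])
    moreover have "\<rho>\<^sup>2 = (cmod (s \<rho> t))\<^sup>2" by (simp add: s_def norm_mult)
    moreover have "1 - (cmod (s \<rho> t))\<^sup>2 = (cmod (1 - s \<rho> t))\<^sup>2 + 2 * Re (s \<rho> t * cnj (1 - s \<rho> t))"
      unfolding cmod_power2 by (simp add: power2_eq_square algebra_simps)
    moreover have "Re (s \<rho> t / (1 - s \<rho> t)) = Re (s \<rho> t * cnj (1 - s \<rho> t)) / (cmod (1 - s \<rho> t))\<^sup>2"
      by (subst complex_div_cnj) simp
    ultimately show ?thesis using ne by (simp add: add_divide_distrib)
  qed
  have Xint: "integrable lborel (\<lambda>t. X \<rho> (of_real t))" if \<rho>: "0 \<le> \<rho>" "\<rho> < 1" for \<rho>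
  proof (rule Bochner_Integration.integrable_bound)
    show "integrable lborel (\<lambda>t. p t * (1 / (1 - \<rho>)))" by (intro integrable_mult_left pint)
    show "(\<lambda>t. X \<rho> (of_real t)) \<in> borel_measurable lborel" using smirnov_boundary_measurable[OF Xs[OF \<rho>]] by simp
    show "AE t in lborel. norm (X \<rho> (of_real t)) \<le> norm (p t * (1 / (1 - \<rho>)))"
    proof (rule AE_I2)
      fix t
      have "p t * cmod (s \<rho> t / (1 - s \<rho> t)) \<le> p t * (1 / (1 - \<rho>))" using sden[OF \<rho>] p0 by (intro mult_left_mono) auto
      thus "norm (X \<rho> (of_real t)) \<le> norm (p t * (1 / (1 - \<rho>)))" unfolding Xt norm_mult using p0[of t] \<rho> by simp
    qed
  qed
  have pP: "p t * P \<rho> t = p t + 2 * Re (X \<rho> (of_real t))" if "0 \<le> \<rho>" "\<rho> < 1" for \<rho> t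
  proof -
    have "Re (of_real a * b) = a * Re b" for a :: real and b :: complex by simp
    thus ?thesis unfolding P_eq[OF that] Xt by (simp only: distrib_left mult_1_right mult.left_commute)
  qed
  have pPint: "integrable lborel (\<lambda>t. p t * P \<rho> t)" and mass: "(LINT t|lborel. p t * P \<rho> t) = m" if \<rho>: "0 \<le> \<rho>" "\<rho> < 1" for \<rho>
  proof -
    have i: "integrable lborel (\<lambda>t. 2 * Re (X \<rho> (of_real t)))" by (intro integrable_mult_right integrable_Re Xint \<rho>)
    show "integrable lborel (\<lambda>t. p t * P \<rho> t)" unfolding pP[OF \<rho>] by (rule Bochner_Integration.integrable_add[OF pint i])
    have "(LINT t|lborel. p t * P \<rho> t) = m + 2 * Re (LINT t|lborel. X \<rho> (of_real t))"
      unfolding pP[OF \<rho>] Bochner_Integration.integral_add[OF pint i] using Xint[OF \<rho>] pm by simp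
    thus "(LINT t|lborel. p t * P \<rho> t) = m" using smirnov_integral_eq_0[OF Xs[OF \<rho>] Xint[OF \<rho>]] by simp
  qed
  \<comment> \<open>The intervals \<open>J n\<close> between consecutive minima of the kernel each contain one sampling point and cover the line.\<close>
  obtain \<tau> where \<tau>: "\<And>n. \<phi> (\<tau> n) = of_int n * pi + \<alpha> + pi/2"
    using sampling_points_between[OF mono contphi \<Lambda>] by metis
  have \<tau>\<Lambda>: "\<tau> (n - 1) < \<Lambda> n" "\<Lambda> n < \<tau> n" for n
    using strict_mono_less[OF mono, of "\<tau> (n-1)" "\<Lambda> n"] strict_mono_less[OF mono, of "\<Lambda> n" "\<tau> n"] by (auto simp: \<tau> \<Lambda> algebra_simps)
  define J where "J = (\<lambda>n. {\<tau> (n - 1)..\<tau> n})"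
  have lim: "((\<lambda>\<rho>. LINT t|lborel. indicator (J n) t * (p t * P \<rho> t)) \<longlongrightarrow> \<nu> n) (at_left 1)" for n
  proof -
    let ?c = "of_int n * pi + \<alpha>"
    have per: "disc_poisson (- of_real \<rho>) (2 * (\<phi> t - ?c) + pi) = P \<rho> t" for \<rho> t
    proof -
      have "cis (2 * (\<phi> t - \<alpha>) + pi) = cis (2 * (\<phi> t - ?c) + pi) * cis (2 * pi * of_int n)"
        unfolding cis_mult by (simp add: algebra_simps)
      hence "cis (2 * (\<phi> t - \<alpha>) + pi) = cis (2 * (\<phi> t - ?c) + pi)" by (simp add: cis_multiple_2pi)
      thus ?thesis unfolding P_def disc_poisson_def by simp
    qed
    have "((\<lambda>\<rho>. integral {\<tau> (n-1)..\<tau> n} (\<lambda>t. p t * disc_poisson (- of_real \<rho>) (2 * (\<phi> t - ?c) + pi))) \<longlongrightarrow> pi * p (\<Lambda> n) / \<phi>' (\<Lambda> n)) (at_left 1)"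
      by (rule poisson_concentration[OF deriv cont pos pcont \<tau>\<Lambda>]) (simp_all add: \<tau> \<Lambda> algebra_simps)
    hence l: "((\<lambda>\<rho>. integral (J n) (\<lambda>t. p t * P \<rho> t)) \<longlongrightarrow> \<nu> n) (at_left 1)"
      unfolding per J_def \<nu>_def p_def .
    have "eventually (\<lambda>\<rho>::real. 0 < \<rho> \<and> \<rho> < 1) (at_left 1)"
      using eventually_at_left_real[of 0 1] by (auto elim: eventually_mono)
    hence "eventually (\<lambda>\<rho>. integral (J n) (\<lambda>t. p t * P \<rho> t) = (LINT t|lborel. indicator (J n) t * (p t * P \<rho> t))) (at_left 1)"
    proof eventually_elim
      case (elim \<rho>)
      have "set_integrable lborel (J n) (\<lambda>t. p t * P \<rho> t)"
        unfolding set_integrable_def using pPint[of \<rho>] elim by (intro integrable_mult_indicator) (auto simp: J_def)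
      from set_borel_integral_eq_integral(2)[OF this] show ?case by (simp add: set_lebesgue_integral_def)
    qed
    from tendsto_cong[OF this] l show ?thesis by simp
  qed
  have Jint: "integrable lborel (\<lambda>t. indicator (J n) t * (p t * P \<rho> t))" if "0 \<le> \<rho>" "\<rho> < 1" for n \<rho>
    using integrable_mult_indicator[OF _ pPint[OF that], of "J n"] by (simp add: J_def)
  have ev01: "eventually (\<lambda>\<rho>::real. 0 < \<rho> \<and> \<rho> < 1) (at_left 1)"
    using eventually_at_left_real[of 0 1] by (auto elim: eventually_mono)
  show "sum \<nu> A \<le> m" if A: "finite A"
  proof (rule tendsto_upperbound)
    show "((\<lambda>\<rho>. \<Sum>n\<in>A. LINT t|lborel. indicator (J n) t * (p t * P \<rho> t)) \<longlongrightarrow> sum \<nu> A) (at_left 1)"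
      by (intro tendsto_sum lim)
    show "eventually (\<lambda>\<rho>. (\<Sum>n\<in>A. LINT t|lborel. indicator (J n) t * (p t * P \<rho> t)) \<le> m) (at_left 1)"
      using ev01
    proof eventually_elim
      case (elim \<rho>)
      hence \<rho>: "0 \<le> \<rho>" "\<rho> < 1" by auto
      have "(\<Sum>n\<in>A. LINT t|lborel. indicator (J n) t * (p t * P \<rho> t)) = (LINT t|lborel. (\<Sum>n\<in>A. indicator (J n) t * (p t * P \<rho> t)))"
        by (rule Bochner_Integration.integral_sum[symmetric]) (rule Jint[OF \<rho>])
      also have "\<dots> \<le> (LINT t|lborel. p t * P \<rho> t)"
      proof (rule integral_mono_AE)
        show "integrable lborel (\<lambda>t. \<Sum>n\<in>A. indicator (J n) t * (p t * P \<rho> t))" by (intro Bochner_Integration.integrable_sum Jint \<rho>)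
        show "integrable lborel (\<lambda>t. p t * P \<rho> t)" by (rule pPint[OF \<rho>])
        have "AE t in lborel. t \<notin> \<tau> ` A"
          by (rule AE_not_in) (use A in \<open>auto intro!: finite_imp_null_set_lborel\<close>)
        thus "AE t in lborel. (\<Sum>n\<in>A. indicator (J n) t * (p t * P \<rho> t)) \<le> p t * P \<rho> t"
        proof eventually_elim
          case (elim t)
          have pP0: "p t * P \<rho> t \<ge> 0" using p0 P0[OF \<rho>] by simp
          have uniq: "n = k" if n: "n \<in> A" "t \<in> J n" and k: "k \<in> A" "t \<in> J k" for n k
          proof -
            have "t \<noteq> \<tau> n" "t \<noteq> \<tau> k" using elim n k by auto
            hence "\<tau> (n - 1) \<le> t" "t < \<tau> n" "\<tau> (k - 1) \<le> t" "t < \<tau> k" using n k by (auto simp: J_def)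
            hence "\<tau> (n - 1) < \<tau> k" "\<tau> (k - 1) < \<tau> n" by linarith+
            hence "\<phi> (\<tau> (n - 1)) < \<phi> (\<tau> k)" "\<phi> (\<tau> (k - 1)) < \<phi> (\<tau> n)" using strict_mono_less[OF mono] by auto
            hence "of_int (n - 1) * pi < of_int k * pi" "of_int (k - 1) * pi < of_int n * pi" unfolding \<tau> by linarith+
            hence "n - 1 < k" "k - 1 < n" by (simp_all only: mult_less_cancel_right_pos[OF pi_gt_zero] of_int_less_iff)
            thus ?thesis by simp
          qed
          show ?case
          proof (cases "\<exists>n\<in>A. t \<in> J n")
            case True
            then obtain n where n: "n \<in> A" "t \<in> J n" by blast
            have "(\<Sum>k\<in>A. indicator (J k) t * (p t * P \<rho> t)) = (\<Sum>k\<in>A. if k = n then p t * P \<rho> t else 0)"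
              using uniq n by (intro sum.cong) (auto simp: indicator_def)
            also have "\<dots> = p t * P \<rho> t" using n A by (simp add: sum.delta)
            finally show ?thesis by simp
          next
            case False
            hence "(\<Sum>k\<in>A. indicator (J k) t * (p t * P \<rho> t)) = 0" by (intro sum.neutral) auto
            thus ?thesis using pP0 by simp
          qed
        qed
      qed
      also have "\<dots> = m" by (rule mass[OF \<rho>])
      finally show ?case .
    qed
  qed simp
  assume B: "\<And>A. finite A \<Longrightarrow> sum \<nu> A \<le> B" and Y: "Y > 0"
  define W where "W = (\<lambda>t. Y\<^sup>2 / (t\<^sup>2 + Y\<^sup>2))"
  define w where "w = \<i> * complex_of_real Y"
  have w: "Im w > 0" "Im w = Y" using Y by (simp_all add: w_def)
  have W01: "0 \<le> W t" "W t \<le> 1" for t using Y by (simp_all add: W_def add_nonneg_pos)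
  have Wmeas [measurable]: "W \<in> borel_measurable borel" unfolding W_def by measurable
  have Wint: "integrable lborel (\<lambda>t. f t * W t)" if "integrable lborel f" for f :: "real \<Rightarrow> real"
  proof (rule Bochner_Integration.integrable_bound[OF that])
    show "(\<lambda>t. f t * W t) \<in> borel_measurable lborel" using borel_measurable_integrable[OF that] by simp
    show "AE t in lborel. norm (f t * W t) \<le> norm (f t)"
    proof (rule AE_I2)
      fix t
      have "\<bar>f t\<bar> * W t \<le> \<bar>f t\<bar> * 1" using W01 by (intro mult_left_mono) auto
      thus "norm (f t * W t) \<le> norm (f t)" using W01[of t] by (simp add: abs_mult)
    qed
  qed
  define D where "D = cmod (u w) * cmod (v w) * cmod (\<Psi> w) / (1 - cmod (\<Phi> w) * cmod (\<Psi> w))"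
  have m0: "m \<ge> 0" using p0 unfolding pm[symmetric] by simp
  have lower: "(LINT t|lborel. p t * W t) - 2 * pi * Y * D \<le> (LINT t|lborel. p t * P \<rho> t * W t)" if \<rho>: "0 \<le> \<rho>" "\<rho> < 1" for \<rho>
  proof -
    have Weq: "of_real (W t) * c = Y\<^sup>2 * (c / of_real ((cmod (of_real t - w))\<^sup>2))" for t and c :: complex
      by (simp add: W_def w_def cmod_power2)
    have XW: "integrable lborel (\<lambda>t. X \<rho> (of_real t) / of_real ((cmod (of_real t - w))\<^sup>2))"
    proof (rule Bochner_Integration.integrable_bound)
      show "integrable lborel (\<lambda>t. X \<rho> (of_real t) * of_real (1 / Y\<^sup>2))" by (intro integrable_mult_left Xint \<rho>)
      have [measurable]: "(\<lambda>t. X \<rho> (of_real t)) \<in> borel_measurable borel" by (rule smirnov_boundary_measurable[OF Xs[OF \<rho>]])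
      show "(\<lambda>t. X \<rho> (of_real t) / of_real ((cmod (of_real t - w))\<^sup>2)) \<in> borel_measurable lborel" by measurable
      show "AE t in lborel. norm (X \<rho> (of_real t) / of_real ((cmod (of_real t - w))\<^sup>2)) \<le> norm (X \<rho> (of_real t) * of_real (1 / Y\<^sup>2))"
      proof (rule AE_I2)
        fix t
        have "Y\<^sup>2 \<le> (cmod (of_real t - w))\<^sup>2" by (simp add: cmod_power2 w_def)
        hence "cmod (X \<rho> (of_real t)) / (cmod (of_real t - w))\<^sup>2 \<le> cmod (X \<rho> (of_real t)) / Y\<^sup>2"
          using Y real_neq_upper[OF w(1), of t] by (intro divide_left_mono) auto
        thus "norm (X \<rho> (of_real t) / of_real ((cmod (of_real t - w))\<^sup>2)) \<le> norm (X \<rho> (of_real t) * of_real (1 / Y\<^sup>2))"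
          by (simp add: norm_divide norm_mult norm_power)
      qed
    qed
    have rX: "W t * Re (X \<rho> (of_real t)) = Re (Y\<^sup>2 * (X \<rho> (of_real t) / of_real ((cmod (of_real t - w))\<^sup>2)))" for t
      unfolding Weq[symmetric] by simp
    have i: "integrable lborel (\<lambda>t. 2 * (W t * Re (X \<rho> (of_real t))))"
      unfolding rX by (intro integrable_mult_right integrable_Re XW)
    have "p t * P \<rho> t * W t = p t * W t + 2 * (W t * Re (X \<rho> (of_real t)))" for t
      unfolding pP[OF \<rho>] by (simp add: algebra_simps)
    hence "(LINT t|lborel. p t * P \<rho> t * W t) = (LINT t|lborel. p t * W t) + (LINT t|lborel. 2 * (W t * Re (X \<rho> (of_real t))))"
      using Bochner_Integration.integral_add[OF Wint[OF pint] i] by simp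
    also have "(LINT t|lborel. 2 * (W t * Re (X \<rho> (of_real t)))) = 2 * Re (Y\<^sup>2 * (LINT t|lborel. X \<rho> (of_real t) / of_real ((cmod (of_real t - w))\<^sup>2)))"
      unfolding rX using XW by (simp only: integral_mult_right_zero integral_Re integrable_mult_right)
    also have "(LINT t|lborel. X \<rho> (of_real t) / of_real ((cmod (of_real t - w))\<^sup>2)) = pi / Im w * X \<rho> w"
      by (rule smirnov_poisson_formula[OF Xs[OF \<rho>] w(1) XW])
    also have "complex_of_real (Y\<^sup>2) * (pi / Im w * X \<rho> w) = of_real (pi * Y) * X \<rho> w"
      unfolding w(2) using Y by (simp add: power2_eq_square)
    also have "2 * Re (of_real (pi * Y) * X \<rho> w) = 2 * pi * Y * Re (X \<rho> w)" by simp
    finally have eq: "(LINT t|lborel. p t * P \<rho> t * W t) = (LINT t|lborel. p t * W t) + 2 * pi * Y * Re (X \<rho> w)" .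
    have gap: "1 - cmod (\<Phi> w) * cmod (\<Psi> w) > 0"
    proof -
      have "cmod (\<Phi> w) * cmod (\<Psi> w) \<le> cmod (\<Phi> w) * 1" using inner_norm(2)[OF \<Psi> w(1)] by (intro mult_left_mono) auto
      thus ?thesis using inner_norm(2)[OF \<Phi> w(1)] by simp
    qed
    have "cmod (X \<rho> w) = cmod (u w) * cmod (v w) * (cmod (\<Psi> w) * \<rho> / cmod (1 - of_real \<rho> * \<omega> * (\<Phi> w * \<Psi> w)))"
      unfolding X_def using \<rho> by (simp add: norm_mult norm_divide \<omega>1)
    also have "\<dots> \<le> cmod (u w) * cmod (v w) * (cmod (\<Psi> w) / (1 - cmod (\<Phi> w) * cmod (\<Psi> w)))"
    proof (intro mult_left_mono frac_le)
      show "cmod (\<Psi> w) * \<rho> \<le> cmod (\<Psi> w)" using \<rho> by (simp add: mult_left_le)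
      show "1 - cmod (\<Phi> w) * cmod (\<Psi> w) \<le> cmod (1 - of_real \<rho> * \<omega> * (\<Phi> w * \<Psi> w))" using den(2)[OF \<rho>] w(1) by simp
    qed (use gap in auto)
    finally have "cmod (X \<rho> w) \<le> D" by (simp add: D_def)
    hence "- D \<le> Re (X \<rho> w)" using abs_Re_le_cmod[of "X \<rho> w"] by linarith
    hence "2 * pi * Y * (- D) \<le> 2 * pi * Y * Re (X \<rho> w)" using Y by (intro mult_left_mono) auto
    thus ?thesis unfolding eq by simp
  qed
  have "(LINT t|lborel. p t * W t) - 2 * pi * Y * D \<le> B + e * m" if e: "e > 0" for e
  proof -
    have "(W \<longlongrightarrow> 0) at_top" unfolding W_def by real_asymp
    hence "eventually (\<lambda>t. W t < e) at_top" using e by (rule order_tendstoD(2))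
    then obtain T where T: "\<And>t. t \<ge> T \<Longrightarrow> W t < e" unfolding eventually_at_top_linorder by blast
    define T' where "T' = max T 0"
    have T': "W t \<le> e" if "\<bar>t\<bar> \<ge> T'" for t
    proof -
      have "W t = W \<bar>t\<bar>" by (simp add: W_def)
      thus ?thesis using T[of "\<bar>t\<bar>"] that by (simp add: T'_def)
    qed
    \<comment> \<open>Large enough that the intervals \<open>J n\<close> with \<open>|n| \<le> N\<close> cover \<open>[-T', T']\<close>; outside the weight is at most \<open>e\<close>.\<close>
    define N where "N = \<lceil>(\<bar>\<phi> T'\<bar> + \<bar>\<phi> (- T')\<bar> + \<bar>\<alpha>\<bar>) / pi\<rceil>"
    have Npi: "\<bar>\<phi> T'\<bar> + \<bar>\<phi> (- T')\<bar> + \<bar>\<alpha>\<bar> \<le> of_int N * pi"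
    proof -
      have "(\<bar>\<phi> T'\<bar> + \<bar>\<phi> (- T')\<bar> + \<bar>\<alpha>\<bar>) / pi \<le> of_int N" unfolding N_def by (rule le_of_int_ceiling)
      thus ?thesis by (simp add: pos_divide_le_eq)
    qed
    define Z where "Z = {-N..N}"
    have cover: "W t \<le> (\<Sum>n\<in>Z. indicator (J n) t) + e" for t
    proof (cases "\<bar>t\<bar> \<ge> T'")
      case True
      have "0 \<le> (\<Sum>n\<in>Z. indicator (J n) t :: real)" by (intro sum_nonneg) auto
      thus ?thesis using T'[OF True] by linarith
    next
      case False
      hence "- T' < t" "t < T'" by auto
      hence ph: "\<phi> (- T') < \<phi> t" "\<phi> t < \<phi> T'" using strict_mono_less[OF mono] by auto
      define n where "n = \<lfloor>(\<phi> t - \<alpha>) / pi + 1/2\<rfloor>"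
      have "of_int n \<le> (\<phi> t - \<alpha>) / pi + 1/2" "(\<phi> t - \<alpha>) / pi + 1/2 < of_int n + 1" unfolding n_def by linarith+
      hence n1: "of_int n * pi \<le> \<phi> t - \<alpha> + pi/2" "\<phi> t - \<alpha> + pi/2 < (of_int n + 1) * pi"
        by (simp_all add: field_simps)
      have "\<phi> (\<tau> (n - 1)) \<le> \<phi> t" "\<phi> t \<le> \<phi> (\<tau> n)" unfolding \<tau> using n1 by (simp_all add: algebra_simps)
      hence tJ: "t \<in> J n" unfolding J_def using strict_mono_less_eq[OF mono] by auto
      have "of_int n * pi < (of_int N + 1) * pi" "(- of_int N - 1) * pi < of_int n * pi"
        using n1 ph Npi pi_gt_zero by (simp_all add: algebra_simps abs_if split: if_splits)
      hence "of_int n < (of_int N + 1 :: real)" "(- of_int N - 1 :: real) < of_int n"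
        by (simp_all only: mult_less_cancel_right_pos[OF pi_gt_zero])
      hence nZ: "n \<in> Z" unfolding Z_def by auto
      have "indicator (J n) t \<le> (\<Sum>n\<in>Z. indicator (J n) t :: real)"
        by (rule member_le_sum[OF nZ]) (auto simp: Z_def)
      thus ?thesis using tJ W01(2)[of t] e by (simp add: indicator_def)
    qed
    have ub: "(LINT t|lborel. p t * P \<rho> t * W t) \<le> (\<Sum>n\<in>Z. LINT t|lborel. indicator (J n) t * (p t * P \<rho> t)) + e * m" if \<rho>: "0 \<le> \<rho>" "\<rho> < 1" for \<rho>
    proof -
      have I: "integrable lborel (\<lambda>t. \<Sum>n\<in>Z. indicator (J n) t * (p t * P \<rho> t))" by (intro Bochner_Integration.integrable_sum Jint \<rho>)
      have I2: "integrable lborel (\<lambda>t. e * (p t * P \<rho> t))" by (intro integrable_mult_right pPint \<rho>)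
      have "(LINT t|lborel. p t * P \<rho> t * W t) \<le> (LINT t|lborel. (\<Sum>n\<in>Z. indicator (J n) t * (p t * P \<rho> t)) + e * (p t * P \<rho> t))"
      proof (rule integral_mono[OF Wint[OF pPint[OF \<rho>]] Bochner_Integration.integrable_add[OF I I2]])
        fix t
        have "p t * P \<rho> t * W t \<le> p t * P \<rho> t * ((\<Sum>n\<in>Z. indicator (J n) t) + e)"
          using cover p0 P0[OF \<rho>] by (intro mult_left_mono) auto
        thus "p t * P \<rho> t * W t \<le> (\<Sum>n\<in>Z. indicator (J n) t * (p t * P \<rho> t)) + e * (p t * P \<rho> t)"
          by (simp add: distrib_left sum_distrib_left mult_ac)
      qed
      also have "\<dots> = (\<Sum>n\<in>Z. LINT t|lborel. indicator (J n) t * (p t * P \<rho> t)) + e * m"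
        unfolding Bochner_Integration.integral_add[OF I I2]
        using mass[OF \<rho>] by (simp add: Bochner_Integration.integral_sum[OF Jint[OF \<rho>]])
      finally show ?thesis .
    qed
    have "(LINT t|lborel. p t * W t) - 2 * pi * Y * D \<le> sum \<nu> Z + e * m"
    proof (rule tendsto_lowerbound)
      show "((\<lambda>\<rho>. (\<Sum>n\<in>Z. LINT t|lborel. indicator (J n) t * (p t * P \<rho> t)) + e * m) \<longlongrightarrow> sum \<nu> Z + e * m) (at_left 1)"
        by (intro tendsto_intros lim)
      show "eventually (\<lambda>\<rho>. (LINT t|lborel. p t * W t) - 2 * pi * Y * D \<le> (\<Sum>n\<in>Z. LINT t|lborel. indicator (J n) t * (p t * P \<rho> t)) + e * m) (at_left 1)"
        using ev01 by eventually_elim (rule order_trans[OF lower ub]; simp)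
    qed simp
    moreover have "sum \<nu> Z \<le> B" by (rule B) (simp add: Z_def)
    ultimately show ?thesis by linarith
  qed
  hence "eventually (\<lambda>e. (LINT t|lborel. p t * W t) - 2 * pi * Y * D \<le> B + e * m) (at_right 0)"
    using eventually_at_right_less[of "0::real"] by (auto elim: eventually_mono)
  moreover have "((\<lambda>e. B + e * m) \<longlongrightarrow> B + 0 * m) (at_right 0)" by (intro tendsto_intros)
  ultimately have "(LINT t|lborel. p t * W t) - 2 * pi * Y * D \<le> B + 0 * m" by (intro tendsto_lowerbound) auto
  thus "(LINT t|lborel. (cmod (u (of_real t)))\<^sup>2 * (Y\<^sup>2 / (t\<^sup>2 + Y\<^sup>2))) -
      2 * pi * Y * (cmod (u (\<i> * of_real Y)) * cmod (v (\<i> * of_real Y)) * cmod (\<Psi> (\<i> * of_real Y)) /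
        (1 - cmod (\<Phi> (\<i> * of_real Y)) * cmod (\<Psi> (\<i> * of_real Y)))) \<le> B"
    unfolding p_def W_def D_def w_def by simp
qed

text \<open>The defect term of \<open>sampling_bounds\<close> is smaller than the total mass by a factor that depends on \<open>\<Phi>\<close> and
\<open>\<Psi>\<close> only. Let \<open>a\<close> and \<open>b\<close> be \<open>1 - |\<Phi>|\<close> and \<open>1 - |\<Psi>|\<close> at \<open>\<i> y\<close>; the point bounds for \<open>u\<close> and \<open>v\<close> give the
defect ratio \<open>a / (a + b (1 - a))\<close>. If \<open>a y\<close> stays bounded along a sequence, then \<open>b \<ge> c / y\<close> keeps this ratio
below some \<open>\<theta> < 1\<close>. Otherwise the kernels are weakly null and the defect of each single \<open>u\<close> tends to 0. In the
first case there may be a true loss of mass, namely when a multiple of the function with zeros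
\<open>\<Lambda>\<close> lies in the larger space attached to \<open>\<Phi> \<Psi>\<close>.\<close>

lemma model_sampling:
  fixes \<phi> \<phi>' :: "real \<Rightarrow> real" and \<Lambda> :: "int \<Rightarrow> real"
  assumes \<Phi>: "inner_function \<Phi>" and \<Psi>: "inner_function \<Psi>"
    and deriv: "\<And>t. (\<phi> has_real_derivative \<phi>' t) (at t)" and cont: "continuous_on UNIV \<phi>'" and pos: "\<And>t. \<phi>' t > 0"
    and phase: "\<And>t. \<Phi> (of_real t) * \<Psi> (of_real t) = cis (2 * \<phi> t)"
    and \<Lambda>: "\<And>n. \<phi> (\<Lambda> n) = of_int n * pi + \<alpha>"
  obtains \<delta> where "\<delta> > 0"
    "\<And>u v B. model_pair \<Phi> u v \<Longrightarrow> (\<And>A. finite A \<Longrightarrow> (\<Sum>n\<in>A. pi * (cmod (u (of_real (\<Lambda> n))))\<^sup>2 / \<phi>' (\<Lambda> n)) \<le> B) \<Longrightarrow>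
      \<delta> * (LINT t|lborel. (cmod (u (of_real t)))\<^sup>2) \<le> B"
proof -
  define g where "g = (\<lambda>y. 1 - (cmod (\<Phi> (\<i> * of_real y)))\<^sup>2)"
  define S where "S = (\<lambda>u Y. LINT t|lborel. (cmod (u (complex_of_real t)))\<^sup>2 * (Y\<^sup>2 / (t\<^sup>2 + Y\<^sup>2)))"
  define D where "D = (\<lambda>u v y. 2 * pi * y * (cmod (u (\<i> * of_real y)) * cmod (v (\<i> * of_real y)) * cmod (\<Psi> (\<i> * of_real y)) /
        (1 - cmod (\<Phi> (\<i> * of_real y)) * cmod (\<Psi> (\<i> * of_real y)))))"
  have main: "S u y - D u v y \<le> B"
    if "model_pair \<Phi> u v" "\<And>A. finite A \<Longrightarrow> (\<Sum>n\<in>A. pi * (cmod (u (of_real (\<Lambda> n))))\<^sup>2 / \<phi>' (\<Lambda> n)) \<le> B" "y > 0" for u v B y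
    unfolding S_def D_def by (rule sampling_bounds(2)[OF \<Phi> \<Psi> that(1) deriv cont pos phase \<Lambda> that(2,3)])
  have Slim: "((S u) \<longlongrightarrow> (LINT t|lborel. (cmod (u (of_real t)))\<^sup>2)) at_top" if uv: "model_pair \<Phi> u v" for u v
    unfolding S_def
  proof (rule integral_dominated_convergence_at_top[where w = "\<lambda>t. (cmod (u (of_real t)))\<^sup>2"])
    have [measurable]: "(\<lambda>t. u (complex_of_real t)) \<in> borel_measurable borel"
      using uv smirnov_boundary_measurable by (auto simp: model_pair_def)
    show "(\<lambda>t. (cmod (u (of_real t)))\<^sup>2) \<in> borel_measurable lborel" by measurable
    show "(\<lambda>t. (cmod (u (of_real t)))\<^sup>2 * (Y\<^sup>2 / (t\<^sup>2 + Y\<^sup>2))) \<in> borel_measurable lborel" for Y :: real by measurable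
    show "integrable lborel (\<lambda>t. (cmod (u (of_real t)))\<^sup>2)" using uv by (simp add: model_pair_def)
    show "AE t in lborel. ((\<lambda>Y. (cmod (u (of_real t)))\<^sup>2 * (Y\<^sup>2 / (t\<^sup>2 + Y\<^sup>2))) \<longlongrightarrow> (cmod (u (of_real t)))\<^sup>2) at_top"
    proof (rule AE_I2)
      fix t :: real
      have "((\<lambda>Y. Y\<^sup>2 / (t\<^sup>2 + Y\<^sup>2)) \<longlongrightarrow> 1) at_top" by real_asymp
      hence "((\<lambda>Y. (cmod (u (of_real t)))\<^sup>2 * (Y\<^sup>2 / (t\<^sup>2 + Y\<^sup>2))) \<longlongrightarrow> (cmod (u (of_real t)))\<^sup>2 * 1) at_top"
        by (intro tendsto_intros)
      thus "((\<lambda>Y. (cmod (u (of_real t)))\<^sup>2 * (Y\<^sup>2 / (t\<^sup>2 + Y\<^sup>2))) \<longlongrightarrow> (cmod (u (of_real t)))\<^sup>2) at_top" by simp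
    qed
    show "eventually (\<lambda>Y. AE t in lborel. norm ((cmod (u (of_real t)))\<^sup>2 * (Y\<^sup>2 / (t\<^sup>2 + Y\<^sup>2))) \<le> (cmod (u (of_real t)))\<^sup>2) at_top"
      using eventually_gt_at_top[of 0]
    proof eventually_elim
      case (elim Y)
      show ?case
      proof (rule AE_I2)
        fix t
        have "Y\<^sup>2 / (t\<^sup>2 + Y\<^sup>2) \<le> 1" "0 \<le> Y\<^sup>2 / (t\<^sup>2 + Y\<^sup>2)" using elim by (simp_all add: add_nonneg_pos)
        hence "(cmod (u (of_real t)))\<^sup>2 * (Y\<^sup>2 / (t\<^sup>2 + Y\<^sup>2)) \<le> (cmod (u (of_real t)))\<^sup>2 * 1" by (intro mult_left_mono) auto
        thus "norm ((cmod (u (of_real t)))\<^sup>2 * (Y\<^sup>2 / (t\<^sup>2 + Y\<^sup>2))) \<le> (cmod (u (of_real t)))\<^sup>2"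
          using \<open>0 \<le> Y\<^sup>2 / (t\<^sup>2 + Y\<^sup>2)\<close> by (simp add: abs_mult)
      qed
    qed
  qed
  have pos_y: "g y > 0" "cmod (\<Phi> (\<i> * of_real y)) < 1" "cmod (\<Psi> (\<i> * of_real y)) < 1"
    "g y \<le> 2 * (1 - cmod (\<Phi> (\<i> * of_real y)))"
    "1 - cmod (\<Phi> (\<i> * of_real y)) \<le> 1 - cmod (\<Phi> (\<i> * of_real y)) * cmod (\<Psi> (\<i> * of_real y))" if "y > 0" for y
  proof -
    let ?a = "cmod (\<Phi> (\<i> * of_real y))" and ?b = "cmod (\<Psi> (\<i> * of_real y))"
    show a: "?a < 1" and b: "?b < 1" using inner_norm(2)[OF \<Phi>, of "\<i> * of_real y"] inner_norm(2)[OF \<Psi>, of "\<i> * of_real y"] that by auto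
    have fac: "g y = (1 - ?a) * (1 + ?a)" by (simp add: g_def power2_eq_square algebra_simps)
    show "g y > 0" unfolding fac using a by (intro mult_pos_pos add_pos_nonneg) auto
    have "(1 - ?a) * (1 + ?a) \<le> (1 - ?a) * 2" using a by (intro mult_left_mono) auto
    thus "g y \<le> 2 * (1 - ?a)" unfolding fac by simp
    have "?a * ?b \<le> ?a * 1" using b by (intro mult_left_mono) auto
    thus "1 - ?a \<le> 1 - ?a * ?b" by simp
  qed
  have pb: "(cmod (u (\<i> * of_real y)))\<^sup>2 \<le> g y / (4 * pi * y) * (LINT t|lborel. (cmod (u (of_real t)))\<^sup>2)"
    "(cmod (v (\<i> * of_real y)))\<^sup>2 \<le> g y / (4 * pi * y) * (LINT t|lborel. (cmod (u (of_real t)))\<^sup>2)"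
    if uv: "model_pair \<Phi> u v" and y: "y > 0" for u v y
    using model_point_bound[OF \<Phi> uv, of "\<i> * of_real y"] model_point_bound[OF \<Phi> model_pair_swap(1)[OF \<Phi> uv], of "\<i> * of_real y"] y
    by (simp_all add: g_def model_pair_swap(2)[OF \<Phi> uv])
  show thesis
  proof (cases "filterlim (\<lambda>y. y * g y) at_top at_top")
    case True
    show thesis
    proof (rule that[of 1])
      fix u v B
      assume uv: "model_pair \<Phi> u v" and B: "\<And>A. finite A \<Longrightarrow> (\<Sum>n\<in>A. pi * (cmod (u (of_real (\<Lambda> n))))\<^sup>2 / \<phi>' (\<Lambda> n)) \<le> B"
      let ?m = "LINT t|lborel. (cmod (u (of_real t)))\<^sup>2"
      define e where "e = (\<lambda>y. (cmod (u (\<i> * of_real y)))\<^sup>2 * y / g y)"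
      have e: "(e \<longlongrightarrow> 0) at_top" unfolding e_def g_def by (rule model_weakly_null[OF \<Phi> uv True[unfolded g_def]])
      have "eventually (\<lambda>y. S u y - sqrt (4 * pi * ?m * e y) \<le> B) at_top"
        using eventually_gt_at_top[of 0]
      proof eventually_elim
        case (elim y)
        let ?u = "cmod (u (\<i> * of_real y))" and ?v = "cmod (v (\<i> * of_real y))"
          and ?a = "cmod (\<Phi> (\<i> * of_real y))" and ?b = "cmod (\<Psi> (\<i> * of_real y))"
        have gy: "g y > 0" by (rule pos_y(1)[OF elim])
        have "g y / 2 \<le> 1 - ?a" using pos_y(4)[OF elim] by simp
        hence gap: "g y / 2 \<le> 1 - ?a * ?b" using pos_y(5)[OF elim] by (rule order_trans)
        have "D u v y \<le> sqrt (4 * pi * ?m * e y)"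
        proof (rule real_le_rsqrt)
          have "?u * ?v * ?b / (1 - ?a * ?b) \<le> ?u * ?v / (g y / 2)"
          proof (rule frac_le)
            show "?u * ?v * ?b \<le> ?u * ?v" using pos_y(3)[OF elim] by (simp add: mult_left_le)
          qed (use gap gy in auto)
          hence "D u v y \<le> 2 * pi * y * (?u * ?v / (g y / 2))" unfolding D_def using elim by (intro mult_left_mono) auto
          moreover have "0 \<le> D u v y" unfolding D_def using elim gap gy by (intro mult_nonneg_nonneg divide_nonneg_nonneg) auto
          ultimately have "(D u v y)\<^sup>2 \<le> (2 * pi * y * (?u * ?v / (g y / 2)))\<^sup>2" by (rule power_mono)
          also have "\<dots> = 16 * pi\<^sup>2 * y\<^sup>2 / (g y)\<^sup>2 * ?u\<^sup>2 * ?v\<^sup>2"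
            by (simp add: power2_eq_square)
          also have "\<dots> \<le> 16 * pi\<^sup>2 * y\<^sup>2 / (g y)\<^sup>2 * ?u\<^sup>2 * (g y / (4 * pi * y) * ?m)"
            by (intro mult_left_mono pb(2)[OF uv elim]) auto
          also have "\<dots> = 4 * pi * ?m * e y"
            unfolding e_def using elim gy by (simp add: power2_eq_square field_simps)
          finally show "(D u v y)\<^sup>2 \<le> 4 * pi * ?m * e y" .
        qed
        thus ?case using main[OF uv B elim] by linarith
      qed
      moreover have "((\<lambda>y. S u y - sqrt (4 * pi * ?m * e y)) \<longlongrightarrow> ?m - sqrt (4 * pi * ?m * 0)) at_top"
        by (intro tendsto_intros Slim[OF uv] e)
      ultimately have "?m - sqrt (4 * pi * ?m * 0) \<le> B" by (intro tendsto_upperbound) auto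
      thus "1 * ?m \<le> B" by simp
    qed simp
  next
    case False
    then obtain M where M: "\<not> eventually (\<lambda>y. M < y * g y) at_top" unfolding filterlim_at_top_dense by blast
    obtain c where c: "c > 0" "\<And>y. y \<ge> 1 \<Longrightarrow> c / y \<le> 1 - cmod (\<Psi> (\<i> * of_real y))"
      using inner_gap_vertical[OF \<Psi>] by metis
    have Mpos: "M > 0"
    proof (rule ccontr)
      assume nM: "\<not> M > 0"
      have "eventually (\<lambda>y. M < y * g y) at_top"
      proof (rule eventually_mono[OF eventually_gt_at_top[of 0]])
        fix y :: real assume y: "0 < y"
        have "0 < y * g y" using pos_y(1)[OF y] y by simp
        thus "M < y * g y" using nM by linarith
      qed
      with M show False by simp
    qed
    define \<theta> where "\<theta> = M / (M + c / 2)"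
    have \<theta>: "0 < \<theta>" "\<theta> < 1" unfolding \<theta>_def using Mpos c(1) by (auto simp: field_simps)
    show thesis
    proof (rule that[of "1 - \<theta>"])
      show "1 - \<theta> > 0" using \<theta> by simp
      fix u v B
      assume uv: "model_pair \<Phi> u v" and B: "\<And>A. finite A \<Longrightarrow> (\<Sum>n\<in>A. pi * (cmod (u (of_real (\<Lambda> n))))\<^sup>2 / \<phi>' (\<Lambda> n)) \<le> B"
      let ?m = "LINT t|lborel. (cmod (u (of_real t)))\<^sup>2"
      have m0: "?m \<ge> 0" by simp
      have key: "S u y \<le> B + \<theta> * ?m" if y: "y \<ge> max 1 (2 * M)" and yM: "y * g y \<le> M" for y
      proof -
        have y0: "y > 0" "y \<ge> 1" "y \<ge> 2 * M" using y by auto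
        let ?u = "cmod (u (\<i> * of_real y))" and ?v = "cmod (v (\<i> * of_real y))"
          and ?a = "1 - cmod (\<Phi> (\<i> * of_real y))" and ?b = "1 - cmod (\<Psi> (\<i> * of_real y))"
        define G where "G = 1 - cmod (\<Phi> (\<i> * of_real y)) * cmod (\<Psi> (\<i> * of_real y))"
        have gy: "g y > 0" "g y \<le> 2 * ?a" "?a > 0" using pos_y[OF y0(1)] by auto
        have ag: "?a \<le> g y"
        proof -
          have "g y = ?a * (1 + cmod (\<Phi> (\<i> * of_real y)))" by (simp add: g_def power2_eq_square algebra_simps)
          thus ?thesis using gy(3) mult_left_mono[of 1 "1 + cmod (\<Phi> (\<i> * of_real y))" ?a] by simp
        qed
        have "?a * y \<le> g y * y" using ag y0 by (intro mult_right_mono) auto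
        also have "\<dots> \<le> M" using yM by (simp only: mult.commute)
        finally have aM: "?a \<le> M / y" by (subst pos_le_divide_eq[OF y0(1)])
        have Geq: "G = ?a + ?b * (1 - ?a)" unfolding G_def by (simp add: algebra_simps)
        have "M / y \<le> 1/2" using y0(3) by (subst pos_divide_le_eq[OF y0(1)]) simp
        hence "?a \<le> 1/2" using aM by linarith
        hence half: "1/2 \<le> 1 - ?a" by simp
        have "c / y * (1/2) \<le> ?b * (1 - ?a)" using c(2)[OF y0(2)] half c(1) y0 pos_y(3)[OF y0(1)] by (intro mult_mono) auto
        hence Glow: "?a + c / (2 * y) \<le> G" unfolding Geq by simp
        have Gpos: "G > 0" 
        proof -
          have "c / (2 * y) > 0" using c(1) y0 by simp
          thus ?thesis using Glow gy(3) by linarith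
        qed
        have "?a / G \<le> \<theta>"
        proof -
          have "?a * (c / 2) \<le> M / y * (c / 2)" using aM c(1) by (intro mult_right_mono) auto
          hence "?a * (M + c / 2) \<le> M * (?a + c / (2 * y))" by (simp add: algebra_simps)
          also have "\<dots> \<le> M * G" using Glow Mpos by (intro mult_left_mono) auto
          finally show ?thesis unfolding \<theta>_def using Gpos Mpos c(1)
            by (subst pos_divide_le_eq, simp, subst times_divide_eq_left, subst pos_le_divide_eq) auto
        qed
        have "2 * (?u * ?v) \<le> ?u\<^sup>2 + ?v\<^sup>2" using sum_squares_bound[of ?u ?v] by simp
        hence uv': "?u * ?v \<le> g y / (4 * pi * y) * ?m" using pb[OF uv y0(1)] by linarith
        have "?u * ?v * cmod (\<Psi> (\<i> * of_real y)) \<le> ?u * ?v * 1" using pos_y(3)[OF y0(1)] by (intro mult_left_mono) auto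
        hence "?u * ?v * cmod (\<Psi> (\<i> * of_real y)) \<le> 2 * ?a / (4 * pi * y) * ?m"
          using uv' mult_right_mono[OF divide_right_mono[OF gy(2), of "4 * pi * y"] m0] y0 by simp
        hence "?u * ?v * cmod (\<Psi> (\<i> * of_real y)) / G \<le> 2 * ?a / (4 * pi * y) * ?m / G" using Gpos by (intro divide_right_mono) auto
        hence "D u v y \<le> 2 * pi * y * (2 * ?a / (4 * pi * y) * ?m / G)"
          unfolding D_def G_def[symmetric] using y0 by (intro mult_left_mono) auto
        also have "\<dots> = ?a / G * ?m"
        proof -
          have "2 * pi * y * (2 * x / (4 * pi * y) * z / G) = x / G * z" for x z :: real using y0 by simp
          thus ?thesis .
        qed
        also have "\<dots> \<le> \<theta> * ?m" using \<open>?a / G \<le> \<theta>\<close> m0 by (rule mult_right_mono)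
        finally show ?thesis using main[OF uv B y0(1)] by linarith
      qed
      show "(1 - \<theta>) * ?m \<le> B"
      proof (rule ccontr)
        assume "\<not> ?thesis"
        hence "B + \<theta> * ?m < ?m" by (simp add: algebra_simps)
        hence "eventually (\<lambda>y. B + \<theta> * ?m < S u y) at_top" by (rule order_tendstoD(1)[OF Slim[OF uv]])
        hence "eventually (\<lambda>y. M < y * g y) at_top" using eventually_ge_at_top[of "max 1 (2 * M)"]
        proof eventually_elim
          case (elim y)
          show ?case using key[OF elim(2)] elim(1) by (meson not_le)
        qed
        with M show False by simp
      qed
    qed
  qed
qed

text \<open>Differentiation of \<open>|\<Phi>|\<^sup>2\<close> in the direction \<open>\<i>\<close>, using \<open>cnj \<Phi> = 1 / \<Phi>\<close> on the line.\<close>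

lemma inner_boundary_derivative:
  assumes \<Phi>: "inner_function \<Phi>" and hol: "\<Phi> holomorphic_on U" "open U" "of_real x \<in> U"
  shows "((\<lambda>y. (1 - (cmod (\<Phi> (Complex x y)))\<^sup>2) / y) \<longlongrightarrow> 2 * Im (deriv \<Phi> (of_real x) / \<Phi> (of_real x))) (at_right 0)"
proof -
  let ?x = "complex_of_real x"
  let ?d = "deriv \<Phi> ?x"
  have fd: "(\<Phi> has_field_derivative ?d) (at ?x)" using holomorphic_derivI[OF hol(1,2,3)] .
  have w: "((\<lambda>y. \<Phi> (Complex x y)) has_vector_derivative \<i> * ?d) (at 0)"
  proof -
    have "((\<lambda>y. \<Phi> (?x + \<i> * y)) has_field_derivative ?d * \<i>) (at (of_real 0))"
      by (rule DERIV_chain2[of \<Phi>]) (use fd in \<open>auto intro!: derivative_eq_intros\<close>)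
    from has_vector_derivative_real_field[OF this, of UNIV]
    show ?thesis by (simp add: Complex_eq mult.commute)
  qed
  have v: "((\<lambda>y. Re (\<Phi> (Complex x y))) has_real_derivative Re (\<i> * ?d)) (at 0)" "((\<lambda>y. Im (\<Phi> (Complex x y))) has_real_derivative Im (\<i> * ?d)) (at 0)"
    unfolding has_real_derivative_iff_has_vector_derivative
    by (rule bounded_linear.has_vector_derivative[OF bounded_linear_Re w], rule bounded_linear.has_vector_derivative[OF bounded_linear_Im w])
  have c0: "Complex x 0 = ?x" by (simp add: complex_of_real_def)
  have "((\<lambda>y. (cmod (\<Phi> (Complex x y)))\<^sup>2) has_real_derivative 2 * (Re (\<Phi> ?x) * Re (\<i> * ?d) + Im (\<Phi> ?x) * Im (\<i> * ?d))) (at 0)"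
    unfolding cmod_power2 by (rule derivative_eq_intros v refl)+ (simp add: c0)
  hence "((\<lambda>y. ((cmod (\<Phi> (Complex x (0 + y))))\<^sup>2 - (cmod (\<Phi> (Complex x 0)))\<^sup>2) / y) \<longlongrightarrow> 2 * (Re (\<Phi> ?x) * Re (\<i> * ?d) + Im (\<Phi> ?x) * Im (\<i> * ?d))) (at 0)"
    unfolding DERIV_def .
  hence "((\<lambda>y. - (((cmod (\<Phi> (Complex x y)))\<^sup>2 - 1) / y)) \<longlongrightarrow> - (2 * (Re (\<Phi> ?x) * Re (\<i> * ?d) + Im (\<Phi> ?x) * Im (\<i> * ?d)))) (at 0)"
    unfolding c0 inner_norm(1)[OF \<Phi>] by (intro tendsto_minus) simp
  moreover have "- (2 * (Re (\<Phi> ?x) * Re (\<i> * ?d) + Im (\<Phi> ?x) * Im (\<i> * ?d))) = 2 * Im (?d / \<Phi> ?x)"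
    by (subst complex_div_cnj) (simp add: inner_norm(1)[OF \<Phi>])
  moreover have "- (((cmod (\<Phi> (Complex x y)))\<^sup>2 - 1) / y) = (1 - (cmod (\<Phi> (Complex x y)))\<^sup>2) / y" for y
    by (simp add: minus_divide_left)
  ultimately have "((\<lambda>y. (1 - (cmod (\<Phi> (Complex x y)))\<^sup>2) / y) \<longlongrightarrow> 2 * Im (?d / \<Phi> ?x)) (at 0)" by simp
  thus ?thesis by (rule filterlim_mono[OF _ order_refl at_le]) simp
qed

text \<open>A boundary point lemma of Hopf type: by the Schwarz-Pick estimate \<open>1 - |\<Phi>|\<^sup>2\<close> grows at least linearly with
the distance to the line.\<close>

lemma inner_boundary_derivative_pos:
  assumes \<Phi>: "inner_function \<Phi>" and hol: "\<Phi> holomorphic_on U" "open U" "of_real x \<in> U"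
  shows "Im (deriv \<Phi> (of_real x) / \<Phi> (of_real x)) > 0"
proof -
  define a where "a = Complex x 1"
  let ?s = "cmod (\<Phi> a)"
  have a: "Im a > 0" by (simp add: a_def)
  have s: "0 \<le> ?s" "?s < 1" using inner_norm(2)[OF \<Phi> a] by auto
  define k where "k = (1 - ?s) / (1 + ?s)"
  have k: "k > 0" unfolding k_def using s by (intro divide_pos_pos add_pos_nonneg) auto
  have "eventually (\<lambda>y. k \<le> (1 - (cmod (\<Phi> (Complex x y)))\<^sup>2) / y) (at_right 0)"
    unfolding eventually_at_right[OF zero_less_one]
  proof (intro exI[of _ 1] conjI allI impI)
    fix y :: real assume y: "0 < y" "y < 1"
    have "4 * y * 1 * (1 - ?s) / ((cmod (Complex x y - cnj a))\<^sup>2 * (1 + ?s)) \<le> 1 - (cmod (\<Phi> (Complex x y)))\<^sup>2"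
      using inner_schwarz_pick[OF \<Phi> a, of "Complex x y"] y by (simp add: a_def)
    moreover have "(cmod (Complex x y - cnj a))\<^sup>2 = (y + 1)\<^sup>2" by (simp add: cmod_power2 a_def)
    ultimately have 1: "4 * y / (y + 1)\<^sup>2 * k \<le> 1 - (cmod (\<Phi> (Complex x y)))\<^sup>2" by (simp add: k_def)
    have "(y + 1)\<^sup>2 \<le> 2\<^sup>2" using y by (intro power_mono) auto
    hence "4 * y / 4 \<le> 4 * y / (y + 1)\<^sup>2" using y by (intro divide_left_mono) auto
    hence "y * k \<le> 4 * y / (y + 1)\<^sup>2 * k" using k by (intro mult_right_mono) auto
    with 1 have "y * k \<le> 1 - (cmod (\<Phi> (Complex x y)))\<^sup>2" by linarith
    thus "k \<le> (1 - (cmod (\<Phi> (Complex x y)))\<^sup>2) / y" using y by (simp add: pos_le_divide_eq mult.commute)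
  qed simp
  from tendsto_lowerbound[OF inner_boundary_derivative[OF assms] this]
  have "k \<le> 2 * Im (deriv \<Phi> (of_real x) / \<Phi> (of_real x))" by simp
  thus ?thesis using k by linarith
qed

section \<open>De Branges spaces: phase, kernel on the diagonal, point evaluations\<close>

definition inner_of :: "(complex \<Rightarrow> complex) \<Rightarrow> complex \<Rightarrow> complex" where
  "inner_of E z = conj_reflect E z / E z"

text \<open>The derivative of every phase function of \<open>E\<close>, expressed without choosing one: on the line
\<open>E\<^sup>* / E = exp (2 \<i> \<phi>)\<close>.\<close>

definition phase_density :: "(complex \<Rightarrow> complex) \<Rightarrow> real \<Rightarrow> real" where
  "phase_density E x = Im (deriv (inner_of E) (of_real x) / inner_of E (of_real x)) / 2"

text \<open>The value \<open>K(x, x)\<close> of the reproducing kernel.\<close>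

definition kernel_diagonal :: "(complex \<Rightarrow> complex) \<Rightarrow> real \<Rightarrow> real" where
  "kernel_diagonal E x = (cmod (E (of_real x)))\<^sup>2 * phase_density E x / pi"

text \<open>Hermite-Biehler functions without real zeros, for which \<open>E\<^sup>* / E\<close> is analytic across the real line.\<close>

locale regular_hb =
  fixes E :: "complex \<Rightarrow> complex"
  assumes hb: "E \<in> hermite_biehler" and no_real_zeros: "\<And>x::real. E (complex_of_real x) \<noteq> 0"
begin

lemma E_holomorphic: "E holomorphic_on UNIV"
  using hb by (simp add: hermite_biehler_def)

lemma conj_reflect_holomorphic:
  assumes "f holomorphic_on UNIV"
  shows "conj_reflect f holomorphic_on UNIV"
proof -
  have "f holomorphic_on cnj ` UNIV" by (rule holomorphic_on_subset[OF assms]) simp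
  from holomorphic_on_compose_cnj_cnj[OF this] show ?thesis by (simp add: conj_reflect_def o_def)
qed

lemma E_nonzero: "Im z \<ge> 0 \<Longrightarrow> E z \<noteq> 0"
proof (cases "Im z = 0")
  case True
  hence "z = of_real (Re z)" by (simp add: complex_eq_iff)
  thus ?thesis using no_real_zeros[of "Re z"] by simp
next
  case False
  assume "Im z \<ge> 0"
  hence "cmod (E (cnj z)) < cmod (E z)" using False hb by (auto simp: hermite_biehler_def upper_half_plane_def)
  thus ?thesis by auto
qed

definition regular_set :: "complex set" where "regular_set = {z. E z \<noteq> 0}"

lemma open_regular_set: "open regular_set"
  unfolding regular_set_def by (rule open_Collect_neq) (auto intro: holomorphic_on_imp_continuous_on E_holomorphic)

lemma regular_set_closed_half_plane: "Im z \<ge> 0 \<Longrightarrow> z \<in> regular_set"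
  using E_nonzero by (simp add: regular_set_def)

lemma quotient_holomorphic:
  assumes "f holomorphic_on UNIV"
  shows "(\<lambda>z. f z / E z) holomorphic_on regular_set"
  by (rule holomorphic_on_divide[OF holomorphic_on_subset[OF assms] holomorphic_on_subset[OF E_holomorphic]])
    (auto simp: regular_set_def)

lemma inner_holomorphic: "inner_of E holomorphic_on regular_set"
  unfolding inner_of_def by (rule quotient_holomorphic[OF conj_reflect_holomorphic[OF E_holomorphic]])

lemma inner_E: "inner_function (inner_of E)"
  unfolding inner_function_def
proof (intro conjI allI impI)
  show "continuous_on {z. Im z \<ge> 0} (inner_of E)"
    by (rule continuous_on_subset[OF holomorphic_on_imp_continuous_on[OF inner_holomorphic]]) (use regular_set_closed_half_plane in auto)
  show "inner_of E holomorphic_on upper_half_plane"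
    by (rule holomorphic_on_subset[OF inner_holomorphic]) (use regular_set_closed_half_plane in \<open>auto simp: upper_half_plane_def\<close>)
  fix z assume z: "Im z > 0"
  hence "cmod (E (cnj z)) < cmod (E z)" using hb by (auto simp: hermite_biehler_def upper_half_plane_def)
  thus "cmod (inner_of E z) < 1" using E_nonzero[of z] z by (simp add: inner_of_def conj_reflect_def norm_divide)
next
  fix t show "cmod (inner_of E (of_real t)) = 1"
    using no_real_zeros by (simp add: inner_of_def conj_reflect_def norm_divide)
qed

lemma phase_density_pos: "phase_density E x > 0"
  unfolding phase_density_def
  using inner_boundary_derivative_pos[OF inner_E inner_holomorphic open_regular_set regular_set_closed_half_plane, of x] by simp

lemma phase_density_limit:
  "((\<lambda>y. (1 - (cmod (inner_of E (Complex x y)))\<^sup>2) / y) \<longlongrightarrow> 4 * phase_density E x) (at_right 0)"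
  using inner_boundary_derivative[OF inner_E inner_holomorphic open_regular_set regular_set_closed_half_plane, of x] by (simp add: phase_density_def)

lemma continuous_phase_density: "continuous_on UNIV (phase_density E)"
proof -
  have c: "continuous_on UNIV (\<lambda>x. f (complex_of_real x))" if "f holomorphic_on regular_set" for f
    by (rule continuous_on_compose2[OF holomorphic_on_imp_continuous_on[OF that]]) (use regular_set_closed_half_plane in \<open>auto intro!: continuous_intros\<close>)
  have nz: "inner_of E (complex_of_real x) \<noteq> 0" for x using inner_norm(1)[OF inner_E, of x] by force
  show ?thesis unfolding phase_density_def [abs_def]
    by (intro continuous_intros c inner_holomorphic holomorphic_deriv[OF inner_holomorphic open_regular_set]) (use nz in auto)
qed

lemma inner_of_phase:
  assumes "phase_function E \<phi>"
  shows "inner_of E (of_real x) = cis (2 * \<phi> x)"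
proof -
  let ?r = "complex_of_real (cmod (E (of_real x)))"
  have e: "E (of_real x) = ?r * exp (- \<i> * of_real (\<phi> x))" using assms by (simp add: phase_function_def)
  have E: "E (of_real x) = ?r * cis (- \<phi> x)"
    by (subst e) (simp add: cis_conv_exp)
  have "inner_of E (of_real x) = cnj (E (of_real x)) / E (of_real x)" by (simp add: inner_of_def conj_reflect_def)
  also have "\<dots> = (?r * cis (\<phi> x)) / (?r * cis (- \<phi> x))" by (subst (1 2) E) (simp add: cis_cnj)
  also have "\<dots> = cis (\<phi> x) / cis (- \<phi> x)" using no_real_zeros[of x] by simp
  also have "\<dots> = cis (2 * \<phi> x)" unfolding cis_divide by simp
  finally show ?thesis .
qed

text \<open>Near \<open>x\<close> continuity of \<open>\<phi>\<close> confines \<open>2 (\<phi> t - \<phi> x)\<close> to the range of the principal logarithm, so that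
\<open>\<phi>\<close> is half the imaginary part of an analytic logarithm of \<open>E\<^sup>* / E\<close>.\<close>

lemma phase_derivative:
  assumes ph: "phase_function E \<phi>"
  shows "(\<phi> has_real_derivative phase_density E x) (at x)"
proof -
  let ?\<Phi> = "inner_of E" and ?x = "complex_of_real x"
  have nz: "?\<Phi> ?x \<noteq> 0" using inner_norm(1)[OF inner_E, of x] by force
  have fd: "(?\<Phi> has_field_derivative deriv ?\<Phi> ?x) (at ?x)"
    by (rule holomorphic_derivI[OF inner_holomorphic open_regular_set regular_set_closed_half_plane]) simp
  define L where "L = (\<lambda>z. Ln (?\<Phi> z / ?\<Phi> ?x))"
  have dq: "((\<lambda>z. ?\<Phi> z / ?\<Phi> ?x) has_field_derivative deriv ?\<Phi> ?x / ?\<Phi> ?x) (at ?x)"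
    by (rule DERIV_cdivide[OF fd])
  have "(Ln has_field_derivative inverse (?\<Phi> ?x / ?\<Phi> ?x)) (at (?\<Phi> ?x / ?\<Phi> ?x))"
    by (rule has_field_derivative_Ln) (use nz in simp)
  from DERIV_chain2[OF this dq] have "(L has_field_derivative deriv ?\<Phi> ?x / ?\<Phi> ?x) (at ?x)"
    unfolding L_def using nz by simp
  from bounded_linear.has_vector_derivative[OF bounded_linear_Im has_vector_derivative_real_field[OF this, of UNIV]]
  have "((\<lambda>t. Im (L (of_real t))) has_real_derivative Im (deriv ?\<Phi> ?x / ?\<Phi> ?x)) (at x)"
    by (simp add: has_real_derivative_iff_has_vector_derivative)
  from DERIV_add[OF DERIV_const[of "\<phi> x"] DERIV_cdivide[OF this, of 2]]
  have d: "((\<lambda>t. \<phi> x + Im (L (of_real t)) / 2) has_real_derivative phase_density E x) (at x)"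
    by (simp add: phase_density_def)
  have "isCont \<phi> x" using ph by (auto simp: phase_function_def continuous_on_eq_continuous_at)
  from this[unfolded continuous_at_eps_delta dist_real_def, rule_format, OF pi_half_gt_zero]
  obtain r where r: "r > 0" "\<And>t. \<bar>t - x\<bar> < r \<Longrightarrow> \<bar>\<phi> t - \<phi> x\<bar> < pi / 2" by blast
  show ?thesis
  proof (rule has_field_derivative_transform_within[OF d r(1)])
    fix t assume "dist t x < r"
    hence b: "\<bar>\<phi> t - \<phi> x\<bar> < pi / 2" using r(2) by (simp add: dist_real_def)
    have "?\<Phi> (of_real t) / ?\<Phi> ?x = cis (2 * (\<phi> t - \<phi> x))"
      unfolding inner_of_phase[OF ph] cis_divide by (simp add: algebra_simps)
    moreover have "Ln (cis (2 * (\<phi> t - \<phi> x))) = of_real (2 * (\<phi> t - \<phi> x)) * \<i>"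
    proof (rule Ln_cis)
      have "- pi < 2 * (\<phi> t - \<phi> x)" "2 * (\<phi> t - \<phi> x) \<le> pi"  using b by argo+
      thus "2 * (\<phi> t - \<phi> x) \<in> {-pi<..pi}" by (simp only: greaterThanAtMost_iff)
    qed
    ultimately have "Im (L (of_real t)) = 2 * (\<phi> t - \<phi> x)" unfolding L_def by simp
    thus "\<phi> x + Im (L (of_real t)) / 2 = \<phi> t" by (simp add: field_simps)
  qed simp
qed

definition kernel_numerator :: "real \<Rightarrow> complex \<Rightarrow> complex" where
  "kernel_numerator x z = cnj (E (of_real x)) * E z - E (of_real x) * conj_reflect E z"

lemma kernel_numerator_holomorphic: "kernel_numerator x holomorphic_on UNIV"
  unfolding kernel_numerator_def [abs_def]
  by (intro holomorphic_intros E_holomorphic conj_reflect_holomorphic)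

lemma kernel_numerator_zero: "kernel_numerator x (of_real x) = 0"
  by (simp add: kernel_numerator_def conj_reflect_def)

lemma kernel_numerator_eq:
  "E z \<noteq> 0 \<Longrightarrow> kernel_numerator x z = (cnj (E (of_real x)) - E (of_real x) * inner_of E z) * E z"
  by (simp add: kernel_numerator_def inner_of_def algebra_simps)

lemma kernel_numerator_deriv:
  "Re (- deriv (kernel_numerator x) (of_real x) / (2 * pi * \<i>)) = kernel_diagonal E x"
proof -
  let ?x = "complex_of_real x" and ?\<Phi> = "inner_of E"
  let ?E = "E ?x"
  have fP: "(?\<Phi> has_field_derivative deriv ?\<Phi> ?x) (at ?x)"
    by (rule holomorphic_derivI[OF inner_holomorphic open_regular_set regular_set_closed_half_plane]) simp
  have fE: "(E has_field_derivative deriv E ?x) (at ?x)"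
    by (rule holomorphic_derivI[OF E_holomorphic open_UNIV]) simp
  have nz: "?\<Phi> ?x \<noteq> 0" using inner_norm(1)[OF inner_E, of x] by force
  have P: "?\<Phi> ?x = cnj ?E / ?E" by (simp add: inner_of_def conj_reflect_def)
  have z: "cnj ?E - ?E * ?\<Phi> ?x = 0" unfolding P using no_real_zeros[of x] by simp
  have "((\<lambda>z. (cnj ?E - ?E * ?\<Phi> z) * E z) has_field_derivative - (?E * deriv ?\<Phi> ?x) * E ?x) (at ?x)"
    using z by (auto intro!: derivative_eq_intros fP fE)
  hence "(kernel_numerator x has_field_derivative - (?E * deriv ?\<Phi> ?x) * E ?x) (at ?x)"
    by (rule has_field_derivative_transform_within_open[OF _ open_regular_set]) (use regular_set_closed_half_plane kernel_numerator_eq in \<open>auto simp: regular_set_def\<close>)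
  hence "deriv (kernel_numerator x) ?x = - (?E * ?E * deriv ?\<Phi> ?x)" by (simp add: DERIV_imp_deriv)
  moreover have "?E * ?E = of_real ((cmod ?E)\<^sup>2) / ?\<Phi> ?x"
    unfolding P complex_norm_square using no_real_zeros[of x] by simp
  ultimately have D: "deriv (kernel_numerator x) ?x = - (of_real ((cmod ?E)\<^sup>2) * (deriv ?\<Phi> ?x / ?\<Phi> ?x))" by simp
  have "- (- (of_real a * v)) / (2 * pi * \<i>) = of_real (a / (2 * pi)) * (v / \<i>)" for a and v :: complex
    by (simp only: minus_minus of_real_divide times_divide_times_eq)
  hence "- deriv (kernel_numerator x) ?x / (2 * pi * \<i>) = of_real ((cmod ?E)\<^sup>2 / (2 * pi)) * ((deriv ?\<Phi> ?x / ?\<Phi> ?x) / \<i>)"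
    unfolding D .
  also have "(deriv ?\<Phi> ?x / ?\<Phi> ?x) / \<i> = - \<i> * (deriv ?\<Phi> ?x / ?\<Phi> ?x)" by (simp add: divide_inverse)
  finally have "Re (- deriv (kernel_numerator x) ?x / (2 * pi * \<i>)) = (cmod ?E)\<^sup>2 / (2 * pi) * Im (deriv ?\<Phi> ?x / ?\<Phi> ?x)"
    by (simp only: Re_complex_of_real Im_complex_of_real times_complex.sel) simp
  thus ?thesis by (simp add: kernel_diagonal_def phase_density_def)
qed

lemma de_branges_kernel_diagonal:
  "Re (de_branges_kernel E (of_real x) (of_real x)) = kernel_diagonal E x"
proof -
  let ?x = "complex_of_real x"
  have fN: "(kernel_numerator x has_field_derivative deriv (kernel_numerator x) ?x) (at ?x)"
    by (rule holomorphic_derivI[OF kernel_numerator_holomorphic open_UNIV]) simp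
  hence "((\<lambda>z. kernel_numerator x z / (z - ?x)) \<longlongrightarrow> deriv (kernel_numerator x) ?x) (at ?x)"
    by (simp add: has_field_derivative_iff kernel_numerator_zero)
  hence "((\<lambda>z. - (kernel_numerator x z / (z - ?x)) / (2 * pi * \<i>)) \<longlongrightarrow> - deriv (kernel_numerator x) ?x / (2 * pi * \<i>)) (at ?x)"
    by (intro tendsto_intros) auto
  moreover have "- (kernel_numerator x z / (z - ?x)) / (2 * pi * \<i>) = de_branges_quotient E ?x z" for z
  proof -
    have "2 * pi * \<i> * (?x - z) = - ((z - ?x) * (2 * pi * \<i>))" by (simp add: algebra_simps)
    moreover have "- (a / b) / c = a / (- (b * c))" for a b c :: complex by simp
    ultimately show ?thesis unfolding de_branges_quotient_def kernel_numerator_def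
      by (simp only: complex_cnj_complex_of_real)
  qed
  ultimately have "(de_branges_quotient E ?x \<longlongrightarrow> - deriv (kernel_numerator x) ?x / (2 * pi * \<i>)) (at ?x)" by simp
  hence "Lim (at ?x) (de_branges_quotient E ?x) = - deriv (kernel_numerator x) ?x / (2 * pi * \<i>)"
    by (intro tendsto_Lim) auto
  thus ?thesis unfolding de_branges_kernel_def using kernel_numerator_deriv by simp
qed

lemma kernel_diagonal_pos: "kernel_diagonal E x > 0"
  unfolding kernel_diagonal_def using phase_density_pos[of x] no_real_zeros[of x] by simp

lemma smirnov_of_mean_type:
  assumes f: "f holomorphic_on UNIV" "bounded_type (\<lambda>z. f z / E z)" "mean_type (\<lambda>z. f z / E z) \<le> 0"
  shows "smirnov (\<lambda>z. f z / E z)"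
  unfolding smirnov_def
proof (intro conjI allI impI)
  show "continuous_on {z. Im z \<ge> 0} (\<lambda>z. f z / E z)"
    by (rule continuous_on_subset[OF holomorphic_on_imp_continuous_on[OF quotient_holomorphic[OF f(1)]]]) (use regular_set_closed_half_plane in auto)
  fix e :: real assume e: "e > 0"
  let ?h = "\<lambda>y. f (\<i> * complex_of_real y) / E (\<i> * complex_of_real y)"
  have "mean_type (\<lambda>z. f z / E z) < ereal e" using f(3) e by (auto intro: order_le_less_trans)
  hence "eventually (\<lambda>y. (if ?h y = 0 then - \<infinity> else ereal (ln (cmod (?h y)) / y)) < ereal e) at_top"
    unfolding mean_type_def by (rule Limsup_lessD)
  thus "eventually (\<lambda>y. cmod (?h y) \<le> exp (e * y)) at_top"
    using eventually_gt_at_top[of 0]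
  proof eventually_elim
    case (elim y)
    show ?case
    proof (cases "?h y = 0")
      case False
      hence "ln (cmod (?h y)) / y < e" using elim(1) by simp
      hence "ln (cmod (?h y)) < e * y" using elim(2) by (simp only: pos_divide_less_eq)
      hence "exp (ln (cmod (?h y))) \<le> exp (e * y)" by simp
      moreover have "cmod (?h y) > 0" using False by (simp only: zero_less_norm_iff not_False_eq_True)
      ultimately show ?thesis by (simp only: exp_ln)
    next
      case True thus ?thesis by (simp only: norm_zero exp_ge_zero)
    qed
  qed
qed (fact f)

lemma de_branges_model_pair:
  assumes "f \<in> de_branges_space E"
  shows "model_pair (inner_of E) (\<lambda>z. f z / E z) (\<lambda>z. conj_reflect f z / E z)"
  unfolding model_pair_def
proof (intro conjI allI)
  have f: "f holomorphic_on UNIV" using assms by (simp add: de_branges_space_def)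
  show "smirnov (\<lambda>z. f z / E z)" "smirnov (\<lambda>z. conj_reflect f z / E z)"
    using assms by (auto simp: de_branges_space_def intro!: smirnov_of_mean_type conj_reflect_holomorphic)
  show "integrable lborel (\<lambda>t. (cmod (f (of_real t) / E (of_real t)))\<^sup>2)"
    using assms by (simp add: de_branges_space_def)
  fix t
  show "conj_reflect f (of_real t) / E (of_real t) = inner_of E (of_real t) * cnj (f (of_real t) / E (of_real t))"
    using no_real_zeros[of t] by (simp add: inner_of_def conj_reflect_def)
qed

lemma de_branges_norm_square:
  "(de_branges_norm E f)\<^sup>2 = (LINT t|lborel. (cmod (f (of_real t) / E (of_real t)))\<^sup>2)"
  unfolding de_branges_norm_def by (rule real_sqrt_pow2) simp

text \<open>The limit of the point bound as the point approaches \<open>x\<close> from above.\<close>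

lemma point_evaluation_bound:
  assumes f: "f \<in> de_branges_space E"
  shows "(cmod (f (of_real x)))\<^sup>2 \<le> kernel_diagonal E x * (de_branges_norm E f)\<^sup>2"
proof -
  let ?u = "\<lambda>z. f z / E z" and ?x = "complex_of_real x"
  let ?m = "LINT t|lborel. (cmod (?u (of_real t)))\<^sup>2"
  have uv: "model_pair (inner_of E) ?u (\<lambda>z. conj_reflect f z / E z)" by (rule de_branges_model_pair[OF f])
  have "eventually (\<lambda>y. (cmod (?u (Complex x y)))\<^sup>2 \<le> (1 - (cmod (inner_of E (Complex x y)))\<^sup>2) / y / (4 * pi) * ?m) (at_right 0)"
    using eventually_at_right_less[of "0::real"]
  proof eventually_elim
    case (elim y)
    thus ?case using model_point_bound[OF inner_E uv, of "Complex x y"] by (simp add: mult_ac)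
  qed
  moreover have "((\<lambda>y. (1 - (cmod (inner_of E (Complex x y)))\<^sup>2) / y / (4 * pi) * ?m) \<longlongrightarrow> 4 * phase_density E x / (4 * pi) * ?m) (at_right 0)"
    by (intro tendsto_intros phase_density_limit) auto
  moreover have "((\<lambda>y. (cmod (?u (Complex x y)))\<^sup>2) \<longlongrightarrow> (cmod (?u ?x))\<^sup>2) (at_right 0)"
  proof -
    have c: "isCont ?u ?x"
      by (rule continuous_on_interior[OF holomorphic_on_imp_continuous_on[OF quotient_holomorphic]])
        (use f open_regular_set regular_set_closed_half_plane in \<open>auto simp: interior_open de_branges_space_def\<close>)
    have "((\<lambda>y. Complex x y) \<longlongrightarrow> Complex x 0) (at_right 0)" by (intro tendsto_Complex tendsto_const tendsto_ident_at)
    hence "((\<lambda>y. Complex x y) \<longlongrightarrow> ?x) (at_right 0)" by (simp add: complex_of_real_def)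
    from tendsto_power[OF tendsto_norm[OF isCont_tendsto_compose[OF c this]]] show ?thesis .
  qed
  ultimately have "(cmod (?u ?x))\<^sup>2 \<le> 4 * phase_density E x / (4 * pi) * ?m" by (intro tendsto_le[of "at_right 0"]) auto
  hence "(cmod (E ?x))\<^sup>2 * (cmod (?u ?x))\<^sup>2 \<le> (cmod (E ?x))\<^sup>2 * (4 * phase_density E x / (4 * pi) * ?m)"
    by (rule mult_left_mono) simp
  moreover have "(cmod (E ?x))\<^sup>2 * (cmod (?u ?x))\<^sup>2 = (cmod (f ?x))\<^sup>2"
    using no_real_zeros[of x] by (simp add: norm_divide power_divide)
  ultimately show ?thesis unfolding de_branges_norm_square kernel_diagonal_def by (simp add: mult_ac)
qed

lemma bounded_imp_mean_type:
  assumes "\<And>y. y \<ge> 1 \<Longrightarrow> cmod (h (\<i> * of_real y)) \<le> M"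
  shows "mean_type h \<le> 0"
proof -
  have "Limsup at_top (\<lambda>y::real. if h (\<i> * of_real y) = 0 then - \<infinity> else ereal (ln (cmod (h (\<i> * of_real y))) / y)) \<le>
     Limsup at_top (\<lambda>y::real. ereal (ln (max M 1) / y))"
  proof (rule Limsup_mono)
    show "eventually (\<lambda>y::real. (if h (\<i> * of_real y) = 0 then - \<infinity> else ereal (ln (cmod (h (\<i> * of_real y))) / y)) \<le> ereal (ln (max M 1) / y)) at_top"
      using eventually_ge_at_top[of 1]
    proof eventually_elim
      case (elim y)
      show ?case
      proof (cases "h (\<i> * of_real y) = 0")
        case False
        have "ln (cmod (h (\<i> * of_real y))) \<le> ln (max M 1)"
          using assms[OF elim] False by (subst ln_le_cancel_iff) auto
        hence "ln (cmod (h (\<i> * of_real y))) / y \<le> ln (max M 1) / y" using elim by (intro divide_right_mono) auto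
        thus ?thesis using False by simp
      qed simp
    qed
  qed
  also have "\<dots> = 0"
  proof (rule lim_imp_Limsup)
    have "((\<lambda>y. ln (max M 1) / y) \<longlongrightarrow> 0) at_top" by real_asymp
    thus "((\<lambda>y. ereal (ln (max M 1) / y)) \<longlongrightarrow> 0) at_top" by (simp add: zero_ereal_def)
  qed simp
  finally show ?thesis unfolding mean_type_def .
qed

lemma kernel_quotient_class:
  assumes h: "\<And>z. Im z > 0 \<Longrightarrow> h z = c * ((a - b * inner_of E z) / (z - of_real x))"
  shows "bounded_type h" "mean_type h \<le> 0"
proof -
  let ?x = "complex_of_real x"
  have ne: "z - ?x \<noteq> 0" if "Im z > 0" for z using that by (auto simp: complex_eq_iff)
  have ni: "z + \<i> \<noteq> 0" if "Im z > 0" for z using plus_i_nonzero[of z] that by simp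
  have hi: "inner_of E holomorphic_on upper_half_plane" using inner_E by (simp add: inner_function_def)
  have nb: "cmod (c * (a - b * inner_of E z)) \<le> cmod c * (cmod a + cmod b)" if "Im z > 0" for z
  proof -
    have "cmod b * cmod (inner_of E z) \<le> cmod b * 1" using inner_norm(2)[OF inner_E that] by (intro mult_left_mono) auto
    moreover have "cmod (a - b * inner_of E z) \<le> cmod a + cmod (b * inner_of E z)" by (rule norm_triangle_ineq4)
    ultimately have "cmod (a - b * inner_of E z) \<le> cmod a + cmod b" by (simp add: norm_mult)
    thus ?thesis by (simp add: norm_mult mult_left_mono)
  qed
  have ib: "cmod (1 / (z + \<i>)) \<le> 1" if "Im z > 0" for z
  proof -
    have "1 \<le> Im (z + \<i>)" using that by simp
    also have "\<dots> \<le> cmod (z + \<i>)" using abs_Im_le_cmod[of "z + \<i>"] by linarith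
    finally show ?thesis using frac_le[of "1::real" 1 1 "cmod (z + \<i>)"] by (simp add: norm_divide)
  qed
  show "bounded_type h"
  proof (rule bounded_typeI[of h "\<lambda>z. c * (a - b * inner_of E z) * (1 / (z + \<i>))" "\<lambda>z. (z - ?x) * (1 / (z + \<i>))"])
    have "(\<lambda>z. c * ((a - b * inner_of E z) / (z - ?x))) holomorphic_on upper_half_plane"
      by (intro holomorphic_intros hi) (use ne in \<open>auto simp: upper_half_plane_def\<close>)
    thus "h holomorphic_on upper_half_plane" by (rule holomorphic_transform) (simp add: h upper_half_plane_def)
    show "(\<lambda>z. c * (a - b * inner_of E z) * (1 / (z + \<i>))) holomorphic_on upper_half_plane"
      "(\<lambda>z. (z - ?x) * (1 / (z + \<i>))) holomorphic_on upper_half_plane"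
      by (intro holomorphic_intros hi; use ni in \<open>auto simp: upper_half_plane_def\<close>)+
    show "bounded ((\<lambda>z. c * (a - b * inner_of E z) * (1 / (z + \<i>))) ` upper_half_plane)"
      by (rule bounded_mult_image) (use nb ib in \<open>auto simp: bounded_iff upper_half_plane_def\<close>)
    show "bounded ((\<lambda>z. (z - ?x) * (1 / (z + \<i>))) ` upper_half_plane)"
      unfolding bounded_iff
    proof (intro exI[of _ "1 + cmod (\<i> + ?x)"] ballI)
      fix w assume "w \<in> (\<lambda>z. (z - ?x) * (1 / (z + \<i>))) ` upper_half_plane"
      then obtain z where z: "Im z > 0" "w = (z - ?x) * (1 / (z + \<i>))" by (auto simp: upper_half_plane_def)
      have weq: "w = 1 - (\<i> + ?x) * (1 / (z + \<i>))" using ni[OF z(1)] unfolding z(2) by (simp add: field_simps)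
      have "cmod w \<le> 1 + cmod ((\<i> + ?x) * (1 / (z + \<i>)))"
        unfolding weq using norm_triangle_ineq4[of "1::complex" "(\<i> + ?x) * (1 / (z + \<i>))"] by (simp only: norm_one)
      also have "cmod ((\<i> + ?x) * (1 / (z + \<i>))) \<le> cmod (\<i> + ?x) * 1" unfolding norm_mult by (intro mult_left_mono ib z) auto
      finally show "cmod w \<le> 1 + cmod (\<i> + ?x)" by simp
    qed
    show "\<exists>z\<in>upper_half_plane. (z - ?x) * (1 / (z + \<i>)) \<noteq> 0"
      using ne[of \<i>] ni[of \<i>] by (intro bexI[of _ \<i>]) (auto simp: upper_half_plane_def)
    fix z assume "z \<in> upper_half_plane"
    thus "h z = c * (a - b * inner_of E z) * (1 / (z + \<i>)) / ((z - ?x) * (1 / (z + \<i>)))"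
      using ne[of z] ni[of z] h[of z] by (simp add: upper_half_plane_def)
  qed
  show "mean_type h \<le> 0"
  proof (rule bounded_imp_mean_type)
    fix y :: real assume y: "y \<ge> 1"
    let ?z = "\<i> * complex_of_real y"
    have "1 \<le> Im (?z - ?x)" using y by simp
    also have "\<dots> \<le> cmod (?z - ?x)" using abs_Im_le_cmod[of "?z - ?x"] by linarith
    finally have d: "1 \<le> cmod (?z - ?x)" .
    have "cmod (h ?z) = cmod (c * (a - b * inner_of E ?z)) / cmod (?z - ?x)" using h[of ?z] y by (simp add: norm_mult norm_divide)
    also have "\<dots> \<le> (cmod c * (cmod a + cmod b)) / 1" using nb[of ?z] d y by (intro frac_le) auto
    finally show "cmod (h ?z) \<le> cmod c * (cmod a + cmod b)" by simp
  qed
qed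

text \<open>Fatou's lemma along the kernels at \<open>x + \<i> y\<close> as \<open>y \<rightarrow> 0\<close>.\<close>

lemma boundary_kernel_norm:
  "(\<integral>\<^sup>+t. ennreal ((cmod ((1 - inner_of E (of_real x) * cnj (inner_of E (of_real t))) / (of_real t - of_real x)))\<^sup>2) \<partial>lborel) \<le> ennreal (4 * pi * phase_density E x)"
proof -
  let ?\<Phi> = "inner_of E" and ?x = "complex_of_real x"
  define y where "y = (\<lambda>n. 1 / real (Suc n))"
  define w where "w = (\<lambda>n. Complex x (y n))"
  have y0: "y n > 0" for n by (simp add: y_def)
  have ylim: "y \<longlonglongrightarrow> 0" unfolding y_def by real_asymp
  have wlim: "w \<longlonglongrightarrow> ?x" unfolding w_def complex_of_real_def by (intro tendsto_Complex tendsto_const ylim)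
  have yr: "filterlim y (at_right 0) sequentially"
    by (rule tendsto_imp_filterlim_at_right[OF ylim]) (simp add: y0)
  have Plim: "(\<lambda>n. ?\<Phi> (w n)) \<longlonglongrightarrow> ?\<Phi> ?x"
  proof -
    have "isCont ?\<Phi> ?x"
      by (rule continuous_on_interior[OF holomorphic_on_imp_continuous_on[OF inner_holomorphic]])
        (use open_regular_set regular_set_closed_half_plane in \<open>auto simp: interior_open\<close>)
    thus ?thesis using wlim by (rule isCont_tendsto_compose)
  qed
  define K where "K = (\<lambda>n t. ennreal ((cmod ((1 - ?\<Phi> (w n) * cnj (?\<Phi> (complex_of_real t))) / (of_real t - w n)))\<^sup>2))"
  have Kmeas: "K n \<in> borel_measurable lborel" for n
    unfolding K_def using inner_kernel_meas[OF inner_E, of "w n"] by simp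
  have Kint: "(\<integral>\<^sup>+t. K n t \<partial>lborel) = ennreal (pi * ((1 - (cmod (?\<Phi> (Complex x (y n))))\<^sup>2) / y n))" for n
  proof -
    have "Im (w n) > 0" using y0 by (simp add: w_def)
    from nn_integral_eq_integral[OF model_kernel_norm(1)[OF inner_E this]] model_kernel_norm(2)[OF inner_E this]
    show ?thesis unfolding K_def by (simp add: w_def)
  qed
  have "(\<integral>\<^sup>+t. ennreal ((cmod ((1 - ?\<Phi> ?x * cnj (?\<Phi> (of_real t))) / (of_real t - ?x)))\<^sup>2) \<partial>lborel) = (\<integral>\<^sup>+t. liminf (\<lambda>n. K n t) \<partial>lborel)"
  proof (rule nn_integral_cong_AE)
    have "AE t in lborel. t \<noteq> x" by (rule AE_lborel_singleton)
    thus "AE t in lborel. ennreal ((cmod ((1 - ?\<Phi> ?x * cnj (?\<Phi> (of_real t))) / (of_real t - ?x)))\<^sup>2) = liminf (\<lambda>n. K n t)"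
    proof eventually_elim
      case (elim t)
      have "(\<lambda>n. K n t) \<longlonglongrightarrow> ennreal ((cmod ((1 - ?\<Phi> ?x * cnj (?\<Phi> (of_real t))) / (of_real t - ?x)))\<^sup>2)"
        unfolding K_def by (intro tendsto_intros tendsto_ennrealI Plim wlim) (use elim in auto)
      from lim_imp_Liminf[OF sequentially_bot this] show ?case by simp
    qed
  qed
  also have "\<dots> \<le> liminf (\<lambda>n. \<integral>\<^sup>+t. K n t \<partial>lborel)" by (rule nn_integral_liminf[OF Kmeas])
  also have "\<dots> = ennreal (pi * (4 * phase_density E x))"
  proof (rule lim_imp_Liminf[OF sequentially_bot])
    have "(\<lambda>n. (1 - (cmod (?\<Phi> (Complex x (y n))))\<^sup>2) / y n) \<longlonglongrightarrow> 4 * phase_density E x"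
      using filterlim_compose[OF phase_density_limit[of x] yr] .
    thus "(\<lambda>n. \<integral>\<^sup>+t. K n t \<partial>lborel) \<longlonglongrightarrow> ennreal (pi * (4 * phase_density E x))"
      unfolding Kint by (intro tendsto_ennrealI tendsto_mult tendsto_const)
  qed
  finally show ?thesis by (simp add: mult_ac)
qed

text \<open>The reproducing kernel at \<open>x\<close>. Together with \<open>point_evaluation_bound\<close> it identifies \<open>K(x, x)\<close> as the squared
norm of evaluation at \<open>x\<close>.\<close>

lemma extremal_function:
  obtains k where "k \<in> de_branges_space E" "kernel_diagonal E x \<le> cmod (k (of_real x))" "(de_branges_norm E k)\<^sup>2 \<le> kernel_diagonal E x"
proof -
  let ?x = "complex_of_real x" and ?\<Phi> = "inner_of E"
  define c where "c = - 1 / (2 * pi * \<i>)"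
  define q where "q = (\<lambda>z. if z = ?x then deriv (kernel_numerator x) ?x else kernel_numerator x z / (z - ?x))"
  define k where "k = (\<lambda>z. c * q z)"
  have q: "q holomorphic_on UNIV"
    using pole_lemma_open[OF kernel_numerator_holomorphic[of x] open_UNIV, of ?x] unfolding kernel_numerator_zero diff_zero q_def .
  have khol: "k holomorphic_on UNIV" unfolding k_def by (intro holomorphic_intros q)
  have kq: "k z / E z = c * ((cnj (E ?x) - E ?x * ?\<Phi> z) / (z - ?x))" if "z \<noteq> ?x" "E z \<noteq> 0" for z
    unfolding k_def q_def using that by (simp add: kernel_numerator_eq[OF that(2)])
  have kstar: "conj_reflect k z = k z" if "z \<noteq> ?x" for z
  proof -
    have "cnj z \<noteq> ?x" using that by (metis complex_cnj_cnj complex_cnj_complex_of_real)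
    moreover have "cnj (kernel_numerator x (cnj z)) = - kernel_numerator x z" by (simp add: kernel_numerator_def conj_reflect_def)
    moreover have "cnj c = - c" by (simp add: c_def)
    ultimately show ?thesis using that by (simp add: conj_reflect_def k_def q_def)
  qed
  have up: "z \<noteq> ?x" "E z \<noteq> 0" if "Im z > 0" for z using that E_nonzero[of z] by auto
  have h1: "k z / E z = c * ((cnj (E ?x) - E ?x * ?\<Phi> z) / (z - ?x))" if "Im z > 0" for z using kq[OF up[OF that]] .
  have h2: "conj_reflect k z / E z = c * ((cnj (E ?x) - E ?x * ?\<Phi> z) / (z - ?x))" if "Im z > 0" for z
    using h1[OF that] kstar[OF up(1)[OF that]] by simp
  have nrm: "(cmod (k (of_real t) / E (of_real t)))\<^sup>2 = (cmod (E ?x))\<^sup>2 / (4 * pi\<^sup>2) * (cmod ((1 - ?\<Phi> ?x * cnj (?\<Phi> (of_real t))) / (of_real t - ?x)))\<^sup>2"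
    if "t \<noteq> x" for t
  proof -
    have "cnj (E ?x) - E ?x * ?\<Phi> (of_real t) = cnj (E ?x) * cnj (1 - ?\<Phi> ?x * cnj (?\<Phi> (of_real t)))"
    proof -
      have "cnj (?\<Phi> ?x) = E ?x / cnj (E ?x)" by (simp add: inner_of_def conj_reflect_def)
      thus ?thesis using no_real_zeros[of x] by (simp add: right_diff_distrib)
    qed
    hence "k (of_real t) / E (of_real t) = c * (cnj (E ?x) * cnj (1 - ?\<Phi> ?x * cnj (?\<Phi> (of_real t))) / (of_real t - ?x))"
      using kq[of "of_real t"] that no_real_zeros[of t] by simp
    thus ?thesis by (simp only: norm_mult norm_divide complex_mod_cnj power_mult_distrib power_divide) (simp add: c_def norm_divide norm_mult power_divide power_mult_distrib)
  qed
  have meas: "(\<lambda>t. (cmod (k (of_real t) / E (of_real t)))\<^sup>2) \<in> borel_measurable borel"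
  proof (intro borel_measurable_continuous_onI continuous_intros)
    show "continuous_on UNIV (\<lambda>t. k (complex_of_real t))" "continuous_on UNIV (\<lambda>t. E (complex_of_real t))"
      by (rule continuous_on_compose2[OF holomorphic_on_imp_continuous_on], rule khol E_holomorphic, auto intro!: continuous_intros)+
  qed (use no_real_zeros in auto)
  have "(\<integral>\<^sup>+t. ennreal ((cmod (k (of_real t) / E (of_real t)))\<^sup>2) \<partial>lborel) =
    (\<integral>\<^sup>+t. ennreal ((cmod (E ?x))\<^sup>2 / (4 * pi\<^sup>2)) * ennreal ((cmod ((1 - ?\<Phi> ?x * cnj (?\<Phi> (of_real t))) / (of_real t - ?x)))\<^sup>2) \<partial>lborel)"
  proof (rule nn_integral_cong_AE)
    have "AE t in lborel. t \<noteq> x" by (rule AE_lborel_singleton)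
    thus "AE t in lborel. ennreal ((cmod (k (of_real t) / E (of_real t)))\<^sup>2) =
      ennreal ((cmod (E ?x))\<^sup>2 / (4 * pi\<^sup>2)) * ennreal ((cmod ((1 - ?\<Phi> ?x * cnj (?\<Phi> (of_real t))) / (of_real t - ?x)))\<^sup>2)"
    proof eventually_elim
      case (elim t)
      show ?case unfolding nrm[OF elim] by (rule ennreal_mult) auto
    qed
  qed
  also have "\<dots> = ennreal ((cmod (E ?x))\<^sup>2 / (4 * pi\<^sup>2)) * (\<integral>\<^sup>+t. ennreal ((cmod ((1 - ?\<Phi> ?x * cnj (?\<Phi> (of_real t))) / (of_real t - ?x)))\<^sup>2) \<partial>lborel)"
    using inner_kernel_meas[OF inner_E, of ?x] by (intro nn_integral_cmult) simp
  also have "\<dots> \<le> ennreal ((cmod (E ?x))\<^sup>2 / (4 * pi\<^sup>2)) * ennreal (4 * pi * phase_density E x)"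
    by (intro mult_left_mono boundary_kernel_norm) simp
  also have "\<dots> = ennreal (kernel_diagonal E x)"
    using phase_density_pos[of x] by (subst ennreal_mult''[symmetric]) (simp_all add: kernel_diagonal_def power2_eq_square)
  finally have le: "(\<integral>\<^sup>+t. ennreal ((cmod (k (of_real t) / E (of_real t)))\<^sup>2) \<partial>lborel) \<le> ennreal (kernel_diagonal E x)" .
  have int: "integrable lborel (\<lambda>t. (cmod (k (of_real t) / E (of_real t)))\<^sup>2)"
    unfolding integrable_iff_bounded using meas le by (auto intro: order_le_less_trans)
  show thesis
  proof (rule that[of k])
    show "k \<in> de_branges_space E" unfolding de_branges_space_def
      using khol int kernel_quotient_class[of "\<lambda>z. k z / E z", OF h1] kernel_quotient_class[of "\<lambda>z. conj_reflect k z / E z", OF h2] by blast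
    have "k ?x = - deriv (kernel_numerator x) ?x / (2 * pi * \<i>)" by (simp add: k_def q_def c_def)
    thus "kernel_diagonal E x \<le> cmod (k ?x)" using kernel_numerator_deriv[of x] complex_Re_le_cmod by metis
    have "ennreal ((de_branges_norm E k)\<^sup>2) \<le> ennreal (kernel_diagonal E x)"
      unfolding de_branges_norm_square using le nn_integral_eq_integral[OF int] by simp
    thus "(de_branges_norm E k)\<^sup>2 \<le> kernel_diagonal E x"
      using kernel_diagonal_pos[of x] by (subst (asm) ennreal_le_iff) auto
  qed
qed

end

text \<open>A continuous inclusion of spaces bounds norms of evaluation functionals: the bound is tested on the
extremal function of the smaller space.\<close>

lemma kernel_diagonal_comparison:
  assumes E1: "regular_hb E1" and E2: "regular_hb E2" and sub: "de_branges_space E1 \<subseteq> de_branges_space E2"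
    and b: "b > 0" "\<And>f. f \<in> de_branges_space E1 \<Longrightarrow> de_branges_norm E2 f \<le> b * de_branges_norm E1 f"
  shows "kernel_diagonal E1 x \<le> b\<^sup>2 * kernel_diagonal E2 x"
proof -
  obtain k where k: "k \<in> de_branges_space E1" "kernel_diagonal E1 x \<le> cmod (k (of_real x))" "(de_branges_norm E1 k)\<^sup>2 \<le> kernel_diagonal E1 x"
    using regular_hb.extremal_function[OF E1] by metis
  have d1: "kernel_diagonal E1 x > 0" and d2: "kernel_diagonal E2 x > 0" using regular_hb.kernel_diagonal_pos[OF E1] regular_hb.kernel_diagonal_pos[OF E2] by auto
  have n0: "de_branges_norm E2 k \<ge> 0" by (simp add: de_branges_norm_def)
  have "(kernel_diagonal E1 x)\<^sup>2 \<le> (cmod (k (of_real x)))\<^sup>2" using k(2) d1 by (intro power_mono) auto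
  also have "\<dots> \<le> kernel_diagonal E2 x * (de_branges_norm E2 k)\<^sup>2"
    by (rule regular_hb.point_evaluation_bound[OF E2]) (use k(1) sub in auto)
  also have "\<dots> \<le> kernel_diagonal E2 x * (b * de_branges_norm E1 k)\<^sup>2"
    using b(2)[OF k(1)] n0 d2 by (intro mult_left_mono power_mono) auto
  also have "\<dots> \<le> kernel_diagonal E2 x * (b\<^sup>2 * kernel_diagonal E1 x)"
    unfolding power_mult_distrib using k(3) d2 by (intro mult_left_mono) auto
  finally have "kernel_diagonal E1 x * kernel_diagonal E1 x \<le> (b\<^sup>2 * kernel_diagonal E2 x) * kernel_diagonal E1 x"
    by (simp add: power2_eq_square mult_ac)
  thus ?thesis using d1 by (simp only: mult_le_cancel_right_pos)
qed

section \<open>Sampling along the phase of a product\<close>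

lemma inner_of_mult: "inner_of (\<lambda>z. E z * F z) z = inner_of E z * inner_of F z"
  by (simp add: inner_of_def conj_reflect_def)

lemma regular_hb_mult:
  assumes "regular_hb E" "regular_hb F"
  shows "regular_hb (\<lambda>z. E z * F z)"
proof
  interpret E: regular_hb E by fact
  interpret F: regular_hb F by fact
  show "(\<lambda>z. E z * F z) \<in> hermite_biehler"
    unfolding hermite_biehler_def
  proof (intro CollectI conjI ballI)
    show "(\<lambda>z. E z * F z) holomorphic_on UNIV"
      by (intro holomorphic_intros E.E_holomorphic F.E_holomorphic)
    fix z assume "z \<in> upper_half_plane"
    hence "cmod (E (cnj z)) < cmod (E z)" "cmod (F (cnj z)) < cmod (F z)"
      using E.hb F.hb by (auto simp: hermite_biehler_def)
    thus "cmod (E (cnj z) * F (cnj z)) < cmod (E z * F z)"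
      unfolding norm_mult by (intro mult_strict_mono') auto
  qed
  show "E (of_real x) * F (of_real x) \<noteq> 0" for x
    using E.no_real_zeros F.no_real_zeros by simp
qed

lemma phase_density_mult:
  assumes "regular_hb E" "regular_hb F"
  shows "phase_density (\<lambda>z. E z * F z) x = phase_density E x + phase_density F x"
proof -
  interpret E: regular_hb E by fact
  interpret F: regular_hb F by fact
  let ?x = "complex_of_real x" and ?\<Phi> = "inner_of E" and ?\<Psi> = "inner_of F"
  have d: "(?\<Phi> has_field_derivative deriv ?\<Phi> ?x) (at ?x)" "(?\<Psi> has_field_derivative deriv ?\<Psi> ?x) (at ?x)"
    by (rule holomorphic_derivI[OF E.inner_holomorphic E.open_regular_set E.regular_set_closed_half_plane] holomorphic_derivI[OF F.inner_holomorphic F.open_regular_set F.regular_set_closed_half_plane]; simp)+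
  have "inner_of (\<lambda>z. E z * F z) = (\<lambda>z. ?\<Phi> z * ?\<Psi> z)" by (simp add: inner_of_mult fun_eq_iff)
  moreover have "deriv (\<lambda>z. ?\<Phi> z * ?\<Psi> z) ?x = deriv ?\<Phi> ?x * ?\<Psi> ?x + deriv ?\<Psi> ?x * ?\<Phi> ?x"
    by (rule DERIV_imp_deriv, rule DERIV_mult[OF d])
  moreover have "?\<Phi> ?x \<noteq> 0" "?\<Psi> ?x \<noteq> 0"
    using inner_norm(1)[OF E.inner_E, of x] inner_norm(1)[OF F.inner_E, of x] by force+
  ultimately show ?thesis unfolding phase_density_def by (simp add: add_divide_distrib)
qed

text \<open>On \<open>\<Lambda>\<close> the weights \<open>\<pi> / \<phi>'\<close> belong to the phase of \<open>E F\<close>, whereas \<open>|f|\<^sup>2 / K\<close> involves that of \<open>E\<close>; the density of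
\<open>E F\<close> lies between that of \<open>E\<close> and \<open>1 + C\<close> times it. The constants \<open>a\<close> and \<open>b\<close> of the norm equivalence enter
twice, once through the norms and once through the kernels.\<close>

theorem theorem5:
  fixes E\<^sub>0 E F :: "complex \<Rightarrow> complex"
    and \<phi>\<^sub>E \<phi>\<^sub>F \<phi>\<^sub>E\<^sub>F :: "real \<Rightarrow> real"
    and \<Lambda> :: "int \<Rightarrow> real" and \<alpha> :: real
  assumes "E\<^sub>0 \<in> hermite_biehler" and "E \<in> hermite_biehler" and "F \<in> hermite_biehler"
    and "\<And>x::real. E\<^sub>0 (complex_of_real x) \<noteq> 0"
    and "\<And>x::real. E (complex_of_real x) \<noteq> 0"
    and "\<And>x::real. F (complex_of_real x) \<noteq> 0"
    and "same_de_branges_space E\<^sub>0 E"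
    and "phase_function E \<phi>\<^sub>E" and "phase_function F \<phi>\<^sub>F"
    and "phase_function (\<lambda>z. E z * F z) \<phi>\<^sub>E\<^sub>F"
    and "\<exists>C>0. \<forall>x. deriv \<phi>\<^sub>F x \<le> C * deriv \<phi>\<^sub>E x"
    and "0 \<le> \<alpha>" and "\<alpha> < pi"
    and "\<And>n::int. \<phi>\<^sub>E\<^sub>F (\<Lambda> n) = of_int n * pi + \<alpha>"
  shows "normalized_sampling_sequence E\<^sub>0 \<Lambda>"
proof -
  interpret E0: regular_hb E\<^sub>0 by unfold_locales fact+
  interpret E: regular_hb E by unfold_locales fact+
  interpret F: regular_hb F by unfold_locales fact+
  interpret EF: regular_hb "\<lambda>z. E z * F z"
    by (rule regular_hb_mult) unfold_locales
  have rE0: "regular_hb E\<^sub>0" and rE: "regular_hb E" and rF: "regular_hb F" by unfold_locales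
  let ?d = "phase_density (\<lambda>z. E z * F z)"
  have dEF: "?d x = phase_density E x + phase_density F x" for x
    by (rule phase_density_mult[OF rE rF])
  obtain C where C: "C > 0" "\<And>x. phase_density F x \<le> C * phase_density E x"
    using assms(11) DERIV_imp_deriv[OF E.phase_derivative[OF assms(8)]] DERIV_imp_deriv[OF F.phase_derivative[OF assms(9)]]
    by auto
  have space: "de_branges_space E\<^sub>0 = de_branges_space E"
    using assms(7) by (simp add: same_de_branges_space_def)
  obtain a b where ab: "a > 0" "b > 0"
    and norms: "\<And>f. f \<in> de_branges_space E \<Longrightarrow> a * de_branges_norm E f \<le> de_branges_norm E\<^sub>0 f"
      "\<And>f. f \<in> de_branges_space E \<Longrightarrow> de_branges_norm E\<^sub>0 f \<le> b * de_branges_norm E f"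
    using assms(7) unfolding same_de_branges_space_def by blast
  have K1: "kernel_diagonal E x \<le> b\<^sup>2 * kernel_diagonal E\<^sub>0 x" for x
    by (rule kernel_diagonal_comparison[OF rE rE0 _ ab(2) norms(2)]) (simp add: space)
  have K0: "a\<^sup>2 * kernel_diagonal E\<^sub>0 x \<le> kernel_diagonal E x" for x
  proof -
    have "kernel_diagonal E\<^sub>0 x \<le> (1 / a)\<^sup>2 * kernel_diagonal E x"
    proof (rule kernel_diagonal_comparison[OF rE0 rE])
      fix f assume "f \<in> de_branges_space E\<^sub>0"
      hence "a * de_branges_norm E f \<le> de_branges_norm E\<^sub>0 f" using norms(1) space by simp
      thus "de_branges_norm E f \<le> 1 / a * de_branges_norm E\<^sub>0 f" using ab(1) by (simp add: pos_le_divide_eq mult.commute)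
    qed (use ab(1) space in auto)
    thus ?thesis using ab(1) by (simp add: power_divide pos_le_divide_eq mult.commute)
  qed
  have phase: "inner_of E (of_real t) * inner_of F (of_real t) = cis (2 * \<phi>\<^sub>E\<^sub>F t)" for t
    using EF.inner_of_phase[OF assms(10), of t] by (simp add: inner_of_mult)
  note setting = E.inner_E F.inner_E EF.phase_derivative[OF assms(10)] EF.continuous_phase_density EF.phase_density_pos phase assms(14)
  obtain \<delta> where \<delta>: "\<delta> > 0"
    "\<And>u v B. model_pair (inner_of E) u v \<Longrightarrow> (\<And>A. finite A \<Longrightarrow> (\<Sum>n\<in>A. pi * (cmod (u (of_real (\<Lambda> n))))\<^sup>2 / ?d (\<Lambda> n)) \<le> B) \<Longrightarrow>
      \<delta> * (LINT t|lborel. (cmod (u (of_real t)))\<^sup>2) \<le> B"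
    using model_sampling[OF setting] by blast
  show ?thesis
    unfolding normalized_sampling_sequence_def Let_def E0.de_branges_kernel_diagonal
  proof (rule exI[of _ "a\<^sup>2 * \<delta> / b\<^sup>2"], rule exI[of _ "b\<^sup>2 * (1 + C) / a\<^sup>2"], intro conjI ballI)
    show "a\<^sup>2 * \<delta> / b\<^sup>2 > 0" "b\<^sup>2 * (1 + C) / a\<^sup>2 > 0" using ab \<delta>(1) C(1) by simp_all
    fix f assume f0: "f \<in> de_branges_space E\<^sub>0"
    hence f: "f \<in> de_branges_space E" by (simp add: space)
    define u where "u = (\<lambda>z. f z / E z)"
    define \<nu> where "\<nu> = (\<lambda>n. pi * (cmod (u (of_real (\<Lambda> n))))\<^sup>2 / ?d (\<Lambda> n))"
    define s where "s = (\<lambda>n. (cmod (f (of_real (\<Lambda> n))))\<^sup>2 / kernel_diagonal E\<^sub>0 (\<Lambda> n))"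
    have uv: "model_pair (inner_of E) u (\<lambda>z. conj_reflect f z / E z)"
      unfolding u_def by (rule E.de_branges_model_pair[OF f])
    have m: "(LINT t|lborel. (cmod (u (of_real t)))\<^sup>2) = (de_branges_norm E f)\<^sup>2"
      unfolding E.de_branges_norm_square u_def ..
    have upper: "sum \<nu> A \<le> (de_branges_norm E f)\<^sup>2" if "finite A" for A
      unfolding m[symmetric] \<nu>_def
      by (rule sampling_bounds(1)[OF E.inner_E F.inner_E uv setting(3-7) that])
    have s0: "s n \<ge> 0" for n unfolding s_def using E0.kernel_diagonal_pos[of "\<Lambda> n"] by simp
    have s_\<nu>: "a\<^sup>2 * \<nu> n \<le> s n" "s n \<le> b\<^sup>2 * (1 + C) * \<nu> n" for n
    proof -
      let ?x = "\<Lambda> n"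
      let ?f = "(cmod (f (of_real ?x)))\<^sup>2"
      have pos: "phase_density E ?x > 0" "phase_density F ?x > 0" "kernel_diagonal E ?x > 0" "kernel_diagonal E\<^sub>0 ?x > 0" "?d ?x > 0"
        by (rule E.phase_density_pos F.phase_density_pos E.kernel_diagonal_pos E0.kernel_diagonal_pos EF.phase_density_pos)+
      have eq: "\<nu> n * ?d ?x = ?f / kernel_diagonal E ?x * phase_density E ?x"
        unfolding \<nu>_def u_def kernel_diagonal_def using pos E.no_real_zeros[of ?x]
        by (simp add: norm_divide power_divide)
      have "\<nu> n * phase_density E ?x \<le> \<nu> n * ?d ?x"
        unfolding dEF \<nu>_def using pos by (intro mult_left_mono) (auto simp: dEF)
      hence "\<nu> n \<le> ?f / kernel_diagonal E ?x" unfolding eq using pos(1) by (simp only: mult_le_cancel_right_pos)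
      hence "a\<^sup>2 * \<nu> n \<le> a\<^sup>2 * (?f / kernel_diagonal E ?x)" by (rule mult_left_mono) simp
      also have "\<dots> \<le> a\<^sup>2 * (?f / (a\<^sup>2 * kernel_diagonal E\<^sub>0 ?x))"
        using K0[of ?x] pos ab(1) by (intro mult_left_mono divide_left_mono) auto
      also have "\<dots> = s n" unfolding s_def using ab(1) by simp
      finally show "a\<^sup>2 * \<nu> n \<le> s n" .
      have \<nu>0: "\<nu> n \<ge> 0" unfolding \<nu>_def using pos(5) by simp
      have "?d ?x \<le> (1 + C) * phase_density E ?x" unfolding dEF using C(2)[of ?x] by (simp add: algebra_simps)
      hence "\<nu> n * ?d ?x \<le> \<nu> n * ((1 + C) * phase_density E ?x)" using \<nu>0 by (rule mult_left_mono)
      hence "?f / kernel_diagonal E ?x * phase_density E ?x \<le> ((1 + C) * \<nu> n) * phase_density E ?x"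
        unfolding eq by (simp add: mult_ac)
      hence le: "?f / kernel_diagonal E ?x \<le> (1 + C) * \<nu> n" using pos(1) by (simp only: mult_le_cancel_right_pos)
      have "s n = b\<^sup>2 * (?f / (b\<^sup>2 * kernel_diagonal E\<^sub>0 ?x))" unfolding s_def using ab(2) by simp
      also have "\<dots> \<le> b\<^sup>2 * (?f / kernel_diagonal E ?x)"
        using K1[of ?x] pos ab(2) by (intro mult_left_mono divide_left_mono) auto
      also have "\<dots> \<le> b\<^sup>2 * ((1 + C) * \<nu> n)" using le by (rule mult_left_mono) simp
      finally show "s n \<le> b\<^sup>2 * (1 + C) * \<nu> n" by (simp add: mult.assoc)
    qed
    have nE0: "de_branges_norm E g \<ge> 0" for g :: "complex \<Rightarrow> complex" by (simp add: de_branges_norm_def)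
    have nE00: "de_branges_norm E\<^sub>0 g \<ge> 0" for g :: "complex \<Rightarrow> complex" by (simp add: de_branges_norm_def)
    have n1: "a\<^sup>2 * (de_branges_norm E f)\<^sup>2 \<le> (de_branges_norm E\<^sub>0 f)\<^sup>2"
      using power_mono[OF norms(1)[OF f], of 2] ab(1) nE0 by (simp add: power_mult_distrib)
    have n2: "(de_branges_norm E\<^sub>0 f)\<^sup>2 \<le> b\<^sup>2 * (de_branges_norm E f)\<^sup>2"
      using power_mono[OF norms(2)[OF f] nE00, of 2] by (simp add: power_mult_distrib)
    have sums: "sum s A \<le> b\<^sup>2 * (1 + C) / a\<^sup>2 * (de_branges_norm E\<^sub>0 f)\<^sup>2" if A: "finite A" for A
    proof -
      have "sum s A \<le> (\<Sum>n\<in>A. b\<^sup>2 * (1 + C) * \<nu> n)" by (intro sum_mono s_\<nu>)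
      also have "\<dots> = b\<^sup>2 * (1 + C) * sum \<nu> A" by (simp add: sum_distrib_left)
      also have "\<dots> \<le> b\<^sup>2 * (1 + C) * (de_branges_norm E f)\<^sup>2" using upper[OF A] C(1) by (intro mult_left_mono) auto
      also have "\<dots> \<le> b\<^sup>2 * (1 + C) * ((de_branges_norm E\<^sub>0 f)\<^sup>2 / a\<^sup>2)"
        using n1 ab(1) C(1) by (intro mult_left_mono) (auto simp: pos_le_divide_eq mult.commute)
      finally show ?thesis by simp
    qed
    have summ: "s summable_on UNIV"
      by (rule nonneg_bdd_above_summable_on) (use s0 sums in \<open>auto intro!: bdd_aboveI2\<close>)
    show "(\<lambda>n. (cmod (f (of_real (\<Lambda> n))))\<^sup>2 / kernel_diagonal E\<^sub>0 (\<Lambda> n)) summable_on UNIV"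
      using summ unfolding s_def .
    show "infsum (\<lambda>n. (cmod (f (of_real (\<Lambda> n))))\<^sup>2 / kernel_diagonal E\<^sub>0 (\<Lambda> n)) UNIV \<le> b\<^sup>2 * (1 + C) / a\<^sup>2 * (de_branges_norm E\<^sub>0 f)\<^sup>2"
      unfolding s_def[symmetric] by (rule infsum_le_finite_sums[OF summ]) (use sums in auto)
    have "sum \<nu> A \<le> infsum s UNIV / a\<^sup>2" if A: "finite A" for A
    proof -
      have "a\<^sup>2 * sum \<nu> A = (\<Sum>n\<in>A. a\<^sup>2 * \<nu> n)" by (simp add: sum_distrib_left)
      also have "\<dots> \<le> sum s A" by (intro sum_mono s_\<nu>)
      also have "\<dots> \<le> infsum s UNIV" by (rule finite_sum_le_infsum[OF summ A]) (use s0 in auto)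
      finally show ?thesis using ab(1) by (simp add: pos_le_divide_eq mult.commute)
    qed
    from \<delta>(2)[OF uv this[unfolded \<nu>_def]] have "\<delta> * (de_branges_norm E f)\<^sup>2 \<le> infsum s UNIV / a\<^sup>2" unfolding m .
    hence low: "a\<^sup>2 * \<delta> * (de_branges_norm E f)\<^sup>2 \<le> infsum s UNIV" using ab(1) by (simp add: pos_le_divide_eq mult_ac)
    have "a\<^sup>2 * \<delta> / b\<^sup>2 * (de_branges_norm E\<^sub>0 f)\<^sup>2 \<le> a\<^sup>2 * \<delta> / b\<^sup>2 * (b\<^sup>2 * (de_branges_norm E f)\<^sup>2)"
      using n2 \<delta>(1) by (intro mult_left_mono) auto
    also have "\<dots> = a\<^sup>2 * \<delta> * (de_branges_norm E f)\<^sup>2" using ab(2) by simp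
    also note low
    finally show "a\<^sup>2 * \<delta> / b\<^sup>2 * (de_branges_norm E\<^sub>0 f)\<^sup>2 \<le> infsum (\<lambda>n. (cmod (f (of_real (\<Lambda> n))))\<^sup>2 / kernel_diagonal E\<^sub>0 (\<Lambda> n)) UNIV"
      unfolding s_def .
  qed
qed

end
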